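(* Let $f$ and $c_i$ ($i\in\mathcal{E}\cup\mathcal{I}$) be real polynomials in $x\in\mathbb{R}^n$ defining the problem $f_{\min}=\min f(x)$ s.t. $c_i(x)=0\ (i\in\mathcal{E})$, $c_j(x)\ge0\ (j\in\mathcal{I})$. Suppose $\mathcal{K}_c\neq\emptyset$ and Assumption A holds with polynomials $p_i$, and let $\phi,\psi,f_c,f_k^{pre},f_k'^{pre}$ be as in the context. Then $f_k^{pre}=f_k'^{pre}=f_c$ for all $k$ sufficiently large. Consequently, if $f_{\min}$ is achieved at a critical point (a feasible point lying in $\mathcal{K}_c$), then $f_k^{pre}=f_k'^{pre}=f_{\min}$ for all $k$ sufficiently large.
   Context: $\mathbb{R}[x]_d$: real polynomials of degree $\le d$; $\Sigma[x]$: sums of squares; $\Sigma[x]_d=\Sigma[x]\cap\mathbb{R}[x]_d$. $\mathcal{E},\mathcal{I}$ are disjoint finite index sets; $c_{eq}=(c_i)_{i\in\mathcal{E}}$, $c_{in}=(c_j)_{j\in\mathcal{I}}$. Critical pairs: $\mathcal{K}=\{(x,\lambda)\in\mathbb{R}^n\times\mathbb{R}^{\mathcal{E}\cup\mathcal{I}}: c_i(x)=0\ (i\in\mathcal{E}),\ \lambda_jc_j(x)=0\ (j\in\mathcal{I}),\ \nabla f(x)=\sum_i\lambda_i\nabla c_i(x)\}$; $\mathcal{K}_c=\{u:\exists\lambda,(u,\lambda)\in\mathcal{K}\}$. Assumption A: for each $i\in\mathcal{E}\cup\mathcal{I}$ there is $p_i\in\mathbb{R}[x]$ with $\lambda_i=p_i(x)$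 for all $(x,\lambda)\in\mathcal{K}$. Then $\phi=\big(\nabla f-\sum_ip_i\nabla c_i,\ (p_jc_j)_{j\in\mathcal{I}}\big)$ (the $n$ entries of the vector followed by the $p_jc_j$), $\psi=(p_j)_{j\in\mathcal{I}}$, and $f_c$ is the optimal value of $\min f(x)$ s.t. $c_{eq}(x)=0$, $c_{in}(x)\ge0$, $\phi(x)=0$, $\psi(x)\ge0$ ($+\infty$ if infeasible). Write the tuple $(c_{in},\psi)$ as $(g_1,\dots,g_\ell)$ and for $r\in\{0,1\}^\ell$ let $g^r=g_1^{r_1}\cdots g_\ell^{r_\ell}$. Truncated preordering: $\mathrm{Preord}(c_{in},\psi)_{2k}=\sum_{r\in\{0,1\}^\ell}g^r\Sigma[x]_{2k-\deg(g^r)}$; truncated ideal: $\mathrm{Ideal}(h)_{2k}=\sum_ih_i\mathbb{R}[x]_{2k-\deg h_i}$. For $y=(y_\alpha)_{|\alpha|\le 2k}$, $\langle\sum f_\alpha x^\alpha,y\rangle=\sum f_\alpha y_\alpha$; for $q\in\mathbb{R}[x]_{2k}$, $L_q^{(k)}(y)$ is the symmetric matrix with $\mathrm{vec}(a_1)^TL_q^{(k)}(y)\mathrm{vec}(a_2)=\langle qa_1a_2,y\rangle$ for all $a_1,a_2\in\mathbb{R}[x]_{k-\lceil\deg(q)/2\rceil}$; for a tuple, block diagonal. Define $f_k'^{pre}=\min\langle f,y\rangle$ s.t. $\langle1,y\rangle=1$, $L_{c_{eq}}^{(k)}(y)=0$, $L_\phi^{(k)}(y)=0$, $L_{g^r}^{(k)}(y)\succeq0$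 for all $r\in\{0,1\}^\ell$, $y\in\mathbb{R}^{\mathbb{N}^n_{2k}}$; $f_k^{pre}=\max\gamma$ s.t. $f-\gamma\in\mathrm{Ideal}(c_{eq},\phi)_{2k}+\mathrm{Preord}(c_{in},\psi)_{2k}$. *)

theory Defs
  imports "HOL-Analysis.Analysis" "HOL-Library.Poly_Mapping"
begin

text \<open>Monomials are exponent vectors 'n \<Rightarrow>0 nat; a polynomial is a finitely
supported map from monomials to real coefficients (a commutative ring).\<close>

type_synonym 'n mpoly = "('n \<Rightarrow>\<^sub>0 nat) \<Rightarrow>\<^sub>0 real"

definition mdeg :: "('n \<Rightarrow>\<^sub>0 nat) \<Rightarrow> nat" where
  "mdeg \<alpha> = (\<Sum>t\<in>Poly_Mapping.keys \<alpha>. Poly_Mapping.lookup \<alpha> t)"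

text \<open>Total degree (the zero polynomial gets degree 0; truncations below treat it separately).\<close>
definition pdeg :: "'n mpoly \<Rightarrow> nat" where
  "pdeg p = Max (insert 0 (mdeg ` Poly_Mapping.keys p))"

definition peval :: "'n::finite mpoly \<Rightarrow> ('n \<Rightarrow> real) \<Rightarrow> real" where
  "peval p x = (\<Sum>\<alpha>\<in>Poly_Mapping.keys p. Poly_Mapping.lookup p \<alpha> * (\<Prod>t\<in>UNIV. x t ^ Poly_Mapping.lookup \<alpha> t))"

definition pderivv :: "'n \<Rightarrow> 'n mpoly \<Rightarrow> 'n mpoly" where
  "pderivv t p = (\<Sum>\<alpha>\<in>Poly_Mapping.keys p.
      Poly_Mapping.single (\<alpha> - Poly_Mapping.single t 1) (of_nat (Poly_Mapping.lookup \<alpha> t) * Poly_Mapping.lookup p \<alpha>))"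

text \<open>R[x]_d for an integer bound d (empty-degree convention: the zero polynomial
belongs to every R[x]_d, and for d < 0 it is the only element).\<close>
definition polys_le :: "int \<Rightarrow> 'n mpoly set" where
  "polys_le d = {p. p = 0 \<or> int (pdeg p) \<le> d}"

definition SOS :: "'n mpoly set" where
  "SOS = {s. \<exists>A (q :: nat \<Rightarrow> 'n mpoly). finite A \<and> s = (\<Sum>i\<in>A. (q i)\<^sup>2)}"

definition SOS_le :: "int \<Rightarrow> 'n mpoly set" where
  "SOS_le d = SOS \<inter> polys_le d"

definition trunc_ideal :: "'a set \<Rightarrow> ('a \<Rightarrow> 'n mpoly) \<Rightarrow> nat \<Rightarrow> 'n mpoly set" where
  "trunc_ideal H h k = {p. \<exists>a. (\<forall>i\<in>H. a i \<in> polys_le (2 * int k - int (pdeg (h i))))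
                                 \<and> p = (\<Sum>i\<in>H. h i * a i)}"

text \<open>g^r for r in {0,1}^l, encoded by the subset S of indices with r_i = 1.\<close>
definition gpow :: "('a \<Rightarrow> 'n mpoly) \<Rightarrow> 'a set \<Rightarrow> 'n mpoly" where
  "gpow g S = (\<Prod>i\<in>S. g i)"

definition trunc_preord :: "'a set \<Rightarrow> ('a \<Rightarrow> 'n mpoly) \<Rightarrow> nat \<Rightarrow> 'n mpoly set" where
  "trunc_preord G g k = {p. \<exists>\<sigma>. (\<forall>S\<in>Pow G. \<sigma> S \<in> SOS_le (2 * int k - int (pdeg (gpow g S))))
                                 \<and> p = (\<Sum>S\<in>Pow G. gpow g S * \<sigma> S)}"

text \<open>Truncated moment vectors y in R^{N^n_{2k}} (coordinates of degree > 2k are fixed to 0).\<close>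
definition tms :: "nat \<Rightarrow> (('n \<Rightarrow>\<^sub>0 nat) \<Rightarrow> real) set" where
  "tms k = {y. \<forall>\<alpha>. 2 * k < mdeg \<alpha> \<longrightarrow> y \<alpha> = 0}"

definition riesz :: "'n mpoly \<Rightarrow> (('n \<Rightarrow>\<^sub>0 nat) \<Rightarrow> real) \<Rightarrow> real" where
  "riesz p y = (\<Sum>\<alpha>\<in>Poly_Mapping.keys p. Poly_Mapping.lookup p \<alpha> * y \<alpha>)"

text \<open>Index set of the localizing matrix of q of order k: monomials of degree
at most k - ceil(deg q / 2) (empty if this is negative).\<close>
definition loc_index :: "nat \<Rightarrow> 'n mpoly \<Rightarrow> ('n \<Rightarrow>\<^sub>0 nat) set" where
  "loc_index k q = {\<alpha>. int (mdeg \<alpha>) \<le> int k - \<lceil>real (pdeg q) / 2\<rceil>}"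

definition loc_matrix :: "nat \<Rightarrow> 'n mpoly \<Rightarrow> (('n \<Rightarrow>\<^sub>0 nat) \<Rightarrow> real)
     \<Rightarrow> ('n \<Rightarrow>\<^sub>0 nat) \<Rightarrow> ('n \<Rightarrow>\<^sub>0 nat) \<Rightarrow> real" where
  "loc_matrix k q y \<alpha> \<beta> =
     riesz (q * Poly_Mapping.single \<alpha> 1 * Poly_Mapping.single \<beta> 1) y"

definition psd_on :: "'b set \<Rightarrow> ('b \<Rightarrow> 'b \<Rightarrow> real) \<Rightarrow> bool" where
  "psd_on B M \<longleftrightarrow> (\<forall>v. (\<Sum>\<alpha>\<in>B. \<Sum>\<beta>\<in>B. v \<alpha> * M \<alpha> \<beta> * v \<beta>) \<ge> 0)"

definition loc_psd :: "nat \<Rightarrow> 'n mpoly \<Rightarrow> (('n \<Rightarrow>\<^sub>0 nat) \<Rightarrow> real) \<Rightarrow> bool" where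
  "loc_psd k q y \<longleftrightarrow> psd_on (loc_index k q) (loc_matrix k q y)"

definition loc_zero :: "nat \<Rightarrow> 'n mpoly \<Rightarrow> (('n \<Rightarrow>\<^sub>0 nat) \<Rightarrow> real) \<Rightarrow> bool" where
  "loc_zero k q y \<longleftrightarrow> (\<forall>\<alpha>\<in>loc_index k q. \<forall>\<beta>\<in>loc_index k q. loc_matrix k q y \<alpha> \<beta> = 0)"

text \<open>Critical pairs K (multipliers lambda live in R^{E \<union> I}: zero outside E \<union> I).\<close>
definition crit_pairs :: "'n::finite mpoly \<Rightarrow> ('i \<Rightarrow> 'n mpoly) \<Rightarrow> 'i set \<Rightarrow> 'i set
     \<Rightarrow> (('n \<Rightarrow> real) \<times> ('i \<Rightarrow> real)) set" where
  "crit_pairs f c E I = {(x, lam).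
      (\<forall>i. i \<notin> E \<union> I \<longrightarrow> lam i = 0) \<and>
      (\<forall>i\<in>E. peval (c i) x = 0) \<and>
      (\<forall>j\<in>I. lam j * peval (c j) x = 0) \<and>
      (\<forall>t. peval (pderivv t f) x = (\<Sum>i\<in>E \<union> I. lam i * peval (pderivv t (c i)) x))}"

definition crit_points :: "'n::finite mpoly \<Rightarrow> ('i \<Rightarrow> 'n mpoly) \<Rightarrow> 'i set \<Rightarrow> 'i set
     \<Rightarrow> ('n \<Rightarrow> real) set" where
  "crit_points f c E I = {u. \<exists>lam. (u, lam) \<in> crit_pairs f c E I}"

definition assumptionA :: "'n::finite mpoly \<Rightarrow> ('i \<Rightarrow> 'n mpoly) \<Rightarrow> 'i set \<Rightarrow> 'i set
     \<Rightarrow> ('i \<Rightarrow> 'n mpoly) \<Rightarrow> bool" where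
  "assumptionA f c E I p \<longleftrightarrow>
     (\<forall>(x, lam) \<in> crit_pairs f c E I. \<forall>i\<in>E \<union> I. lam i = peval (p i) x)"

text \<open>The tuple phi = (grad f - sum_i p_i grad c_i, (p_j c_j)_{j in I}):
index Inl t for the t-th gradient entry, Inr j for p_j c_j.\<close>
definition phi :: "'n mpoly \<Rightarrow> ('i \<Rightarrow> 'n mpoly) \<Rightarrow> 'i set \<Rightarrow> 'i set \<Rightarrow> ('i \<Rightarrow> 'n mpoly)
     \<Rightarrow> ('n + 'i) \<Rightarrow> 'n mpoly" where
  "phi f c E I p s = (case s of
       Inl t \<Rightarrow> pderivv t f - (\<Sum>i\<in>E \<union> I. p i * pderivv t (c i))
     | Inr j \<Rightarrow> p j * c j)"

definition phi_idx :: "'i set \<Rightarrow> ('n + 'i) set" where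
  "phi_idx I = range Inl \<union> Inr ` I"

text \<open>The tuple (c_eq, phi), indices Inl i (i in E) and Inr s (s a phi index).\<close>
definition eq_tuple :: "'n mpoly \<Rightarrow> ('i \<Rightarrow> 'n mpoly) \<Rightarrow> 'i set \<Rightarrow> 'i set \<Rightarrow> ('i \<Rightarrow> 'n mpoly)
     \<Rightarrow> ('i + ('n + 'i)) \<Rightarrow> 'n mpoly" where
  "eq_tuple f c E I p s = (case s of Inl i \<Rightarrow> c i | Inr r \<Rightarrow> phi f c E I p r)"

definition eq_idx :: "'i set \<Rightarrow> 'i set \<Rightarrow> ('i + ('n + 'i)) set" where
  "eq_idx E I = Inl ` E \<union> Inr ` phi_idx I"

text \<open>The tuple (g_1,...,g_l) = (c_in, psi) with psi = (p_j)_{j in I}: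
index Inl j gives c_j, Inr j gives p_j.\<close>
definition in_tuple :: "('i \<Rightarrow> 'n mpoly) \<Rightarrow> ('i \<Rightarrow> 'n mpoly) \<Rightarrow> ('i + 'i) \<Rightarrow> 'n mpoly" where
  "in_tuple c p s = (case s of Inl j \<Rightarrow> c j | Inr j \<Rightarrow> p j)"

definition in_idx :: "'i set \<Rightarrow> ('i + 'i) set" where
  "in_idx I = Inl ` I \<union> Inr ` I"

text \<open>f_c (as an extended real; +\<infinity> if infeasible).\<close>
definition f_c :: "'n::finite mpoly \<Rightarrow> ('i \<Rightarrow> 'n mpoly) \<Rightarrow> 'i set \<Rightarrow> 'i set \<Rightarrow> ('i \<Rightarrow> 'n mpoly) \<Rightarrow> ereal" where
  "f_c f c E I p = (INF x \<in> {x. (\<forall>i\<in>E. peval (c i) x = 0) \<and> (\<forall>j\<in>I. peval (c j) x \<ge> 0)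
        \<and> (\<forall>s\<in>phi_idx I. peval (phi f c E I p s) x = 0) \<and> (\<forall>j\<in>I. peval (p j) x \<ge> 0)}.
        ereal (peval f x))"

text \<open>f_min (as an extended real; +\<infinity> if infeasible).\<close>
definition feasible :: "('i \<Rightarrow> 'n::finite mpoly) \<Rightarrow> 'i set \<Rightarrow> 'i set \<Rightarrow> ('n \<Rightarrow> real) set" where
  "feasible c E I = {x. (\<forall>i\<in>E. peval (c i) x = 0) \<and> (\<forall>j\<in>I. peval (c j) x \<ge> 0)}"

definition f_min :: "'n::finite mpoly \<Rightarrow> ('i \<Rightarrow> 'n mpoly) \<Rightarrow> 'i set \<Rightarrow> 'i set \<Rightarrow> ereal" where
  "f_min f c E I = (INF x \<in> feasible c E I. ereal (peval f x))"

text \<open>SOS relaxation value f_k^{pre} (sup; -\<infinity> if infeasible).\<close>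
definition f_pre :: "'n::finite mpoly \<Rightarrow> ('i \<Rightarrow> 'n mpoly) \<Rightarrow> 'i set \<Rightarrow> 'i set \<Rightarrow> ('i \<Rightarrow> 'n mpoly)
     \<Rightarrow> nat \<Rightarrow> ereal" where
  "f_pre f c E I p k = (SUP \<gamma> \<in> {\<gamma>. \<exists>a b. a \<in> trunc_ideal (eq_idx E I) (eq_tuple f c E I p) k
        \<and> b \<in> trunc_preord (in_idx I) (in_tuple c p) k
        \<and> f - Poly_Mapping.single 0 \<gamma> = a + b}. ereal \<gamma>)"

text \<open>Moment relaxation value f_k'^{pre} (inf; +\<infinity> if infeasible).\<close>
definition f_pre' :: "'n::finite mpoly \<Rightarrow> ('i \<Rightarrow> 'n mpoly) \<Rightarrow> 'i set \<Rightarrow> 'i set \<Rightarrow> ('i \<Rightarrow> 'n mpoly)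
     \<Rightarrow> nat \<Rightarrow> ereal" where
  "f_pre' f c E I p k = (INF y \<in> {y \<in> tms k. riesz 1 y = 1
        \<and> (\<forall>s\<in>eq_idx E I. loc_zero k (eq_tuple f c E I p s) y)
        \<and> (\<forall>S\<in>Pow (in_idx I). loc_psd k (gpow (in_tuple c p) S) y)}. ereal (riesz f y))"

end

theory Submission
  imports Defs "HOL-Algebra.Algebraic_Closure_Type" "HOL-Computational_Algebra.Fraction_Field"
    "Subresultants.More_Homomorphisms"
begin

text \<open>
  Let \<open>M\<close> be the cone generated by the ideal of \<open>(c\<^sub>e\<^sub>q, \<phi>)\<close> and the preordering of \<open>(c\<^sub>i\<^sub>n, \<psi>)\<close>. At a
  prime cone containing \<open>M\<close> the critical equations make every derivation of the residue field over
  the reals vanish on \<open>f\<close>. Hence \<open>f\<close> is algebraic over the reals, so it is a real constant there, and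
  by the Artin-Lang principle this constant is a value of \<open>f\<close> at a real feasible critical point. Zorn's
  lemma turns this into \<open>- q(f)\<^sup>2 \<in> M\<close> for some product \<open>q = \<Prod> (t - v)\<close> over finitely many such values \<open>v\<close>.
  If \<open>\<gamma>\<close> lies below all of them, then \<open>t - \<gamma>\<close> is a square modulo \<open>q\<^sup>2\<close>, which yields a certificate for
  \<open>f - \<gamma>\<close> whose degree does not depend on \<open>\<gamma>\<close>. So both relaxations reach \<open>f\<^sub>c\<close> at a fixed order.

  The Artin-Lang principle is obtained from the real closure of an ordered field, a maximal ordered
  subfield of the algebraic closure, by comparing sign diagrams over two real closed fields.

  For the last claim, Assumption A makes the multipliers unique, which means that the active
  gradients are linearly independent at a critical point; so a minimizer has nonnegative multipliers
  and is feasible for the problem that defines \<open>f\<^sub>c\<close>.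
\<close>

text \<open>The obstacle is uniformity: one fixed order has to serve every \<gamma> below
  \<open>f_c\<close>. The value \<open>f_c\<close> itself is never certified, because t - v is not a
  square modulo (t - v)^2; for \<gamma> strictly below v it is, and the degree of the square root is
  bounded by the modulus alone. The multiplicative set avoided in Zorn's lemma consists of all
  finite products of f - v. A prime cone over \<open>M\<close> whose support avoids it cannot exist,
  and this is what produces one finite product; finiteness of the set of critical values need not be
  known beforehand. Without feasible critical points the only product is the empty one: then -1 lies
  in \<open>M\<close>, and \<open>f_c\<close> and both relaxations of large order are +\<infinity>.
  The residue field at a prime cone is ordered but need not be real closed. It meets the reals only
  through the signs of finitely many polynomials, and comparing these uses the intermediate value
  property on both sides; hence the real closure.\<close>

hide_const (open) Divisibility.irreducible Divisibility.prime Polynomials.lead_coeff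
  Polynomials.degree up_ring.monom up_ring.coeff Coset.order Module.smult

section \<open>Prime cones\<close>

text \<open>Membership of -1 is allowed: the cone of the relaxations is improper when there is no
  feasible critical point. Properness is added in \<open>prime_cone\<close>.\<close>

definition precone :: "'a::comm_ring_1 set \<Rightarrow> bool" where
  "precone M \<longleftrightarrow> (\<forall>x. x * x \<in> M) \<and> (\<forall>x\<in>M. \<forall>y\<in>M. x + y \<in> M) \<and> (\<forall>x\<in>M. \<forall>y\<in>M. x * y \<in> M)"

definition support :: "'a::comm_ring_1 set \<Rightarrow> 'a set" where
  "support Q = {x. x \<in> Q \<and> - x \<in> Q}"

definition prime_cone :: "'a::comm_ring_1 set \<Rightarrow> bool" where
  "prime_cone Q \<longleftrightarrow> precone Q \<and> - 1 \<notin> Q \<and> (\<forall>x. x \<in> Q \<or> - x \<in> Q)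
     \<and> (\<forall>x y. x * y \<in> support Q \<longrightarrow> x \<in> support Q \<or> y \<in> support Q)"

lemma preconeD:
  assumes "precone M"
  shows "x * x \<in> M" "x \<in> M \<Longrightarrow> y \<in> M \<Longrightarrow> x + y \<in> M" "x \<in> M \<Longrightarrow> y \<in> M \<Longrightarrow> x * y \<in> M"
    "0 \<in> M" "1 \<in> M"
proof -
  show "x * x \<in> M" and "x \<in> M \<Longrightarrow> y \<in> M \<Longrightarrow> x + y \<in> M" and "x \<in> M \<Longrightarrow> y \<in> M \<Longrightarrow> x * y \<in> M"
    using assms by (auto simp: precone_def)
  have "0 * 0 \<in> M" "1 * 1 \<in> M"
    using assms unfolding precone_def by blast+
  then show "0 \<in> M" "1 \<in> M"
    by auto
qed

lemma prime_coneD: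
  assumes "prime_cone Q"
  shows "precone Q" "- 1 \<notin> Q" "x \<in> Q \<or> - x \<in> Q"
    "x * y \<in> support Q \<Longrightarrow> x \<in> support Q \<or> y \<in> support Q"
  using assms by (auto simp: prime_cone_def)

text \<open>Totality makes the support an ideal: one of y and -y lies in \<open>Q\<close>, and
  either may serve as the factor.\<close>

lemma support_mult:
  assumes "precone Q" "\<And>x. x \<in> Q \<or> - x \<in> Q" "a \<in> support Q"
  shows "a * y \<in> support Q"
  using assms(2)[of y]
proof
  assume "y \<in> Q"
  then show ?thesis
    using assms(3) preconeD(3)[OF assms(1), of a y] preconeD(3)[OF assms(1), of "- a" y]
    by (auto simp: support_def)
next
  assume "- y \<in> Q"
  then show ?thesis
    using assms(3) preconeD(3)[OF assms(1), of a "- y"] preconeD(3)[OF assms(1), of "- a" "- y"]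
    by (auto simp: support_def)
qed

lemma support_add:
  assumes "precone Q" "a \<in> support Q" "b \<in> support Q"
  shows "a + b \<in> support Q"
  using assms preconeD(2)[OF assms(1), of a b] preconeD(2)[OF assms(1), of "- a" "- b"]
  by (auto simp: support_def)

lemma support_uminus: "a \<in> support Q \<Longrightarrow> - a \<in> support Q"
  by (auto simp: support_def)

lemma precone_adjoin:
  assumes "precone P"
  shows "precone {p + x * q | p q. p \<in> P \<and> q \<in> P}" (is "precone ?A")
  unfolding precone_def
proof (intro conjI allI ballI)
  note P = preconeD[OF assms]
  fix y
  show "y * y \<in> ?A"
    using P(1)[of y] P(4) by (intro CollectI exI[of _ "y * y"] exI[of _ 0]) auto
next
  note P = preconeD[OF assms]
  fix a b assume "a \<in> ?A" "b \<in> ?A"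
  then obtain p q p' q' where pq: "p \<in> P" "q \<in> P" "p' \<in> P" "q' \<in> P" and
    ab: "a = p + x * q" "b = p' + x * q'"
    by blast
  show "a + b \<in> ?A"
    using P(2) pq by (intro CollectI exI[of _ "p + p'"] exI[of _ "q + q'"]) (auto simp: ab algebra_simps)
  have "p * p' + x * x * (q * q') \<in> P" "p * q' + p' * q \<in> P"
    using P pq by auto
  then show "a * b \<in> ?A"
    by (intro CollectI exI[of _ "p * p' + x * x * (q * q')"] exI[of _ "p * q' + p' * q"])
      (auto simp: ab algebra_simps)
qed

text \<open>A cone \<open>P\<close> maximal among those without any \<open>- (s * s)\<close> works.
  If x is outside \<open>P\<close>, adjoining it yields an identity - s^2 = p + x q; multiplying two
  such identities, for x and -x or for -a and -b, would put - (s t)^2 into \<open>P\<close>. The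
  first pair gives totality, the second primality.\<close>

lemma prime_cone_exists:
  fixes M S :: "'a::comm_ring_1 set"
  assumes M: "precone M" and one: "1 \<in> S" and S: "\<And>s t. s \<in> S \<Longrightarrow> t \<in> S \<Longrightarrow> s * t \<in> S"
    and MS: "\<And>s. s \<in> S \<Longrightarrow> - (s * s) \<notin> M"
  shows "\<exists>Q. prime_cone Q \<and> M \<subseteq> Q \<and> support Q \<inter> S = {}"
proof -
  define \<A> where "\<A> = {P. precone P \<and> M \<subseteq> P \<and> (\<forall>s\<in>S. - (s * s) \<notin> P)}"
  have "\<exists>P\<in>\<A>. \<forall>Y\<in>\<A>. P \<subseteq> Y \<longrightarrow> Y = P"
  proof (rule subset_Zorn_nonempty)
    show "\<A> \<noteq> {}"
      using M MS by (auto simp: \<A>_def)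
  next
    fix C assume C: "C \<noteq> {}" "subset.chain \<A> C"
    have sub: "Y \<in> C \<Longrightarrow> Y \<in> \<A>" for Y
      using C(2) by (auto simp: subset.chain_def)
    have common: "\<exists>Y\<in>C. x \<in> Y \<and> y \<in> Y" if xy: "x \<in> \<Union>C" "y \<in> \<Union>C" for x y
    proof -
      obtain A B where "A \<in> C" "x \<in> A" "B \<in> C" "y \<in> B"
        using xy by blast
      then show ?thesis
        using C(2) unfolding subset.chain_def by (cases "A \<subseteq> B") blast+
    qed
    have "precone (\<Union>C)"
      unfolding precone_def
    proof (intro conjI allI ballI)
      fix x show "x * x \<in> \<Union>C"
        using C(1) sub by (force simp: \<A>_def precone_def)
    next
      fix x y assume "x \<in> \<Union>C" "y \<in> \<Union>C"
      then obtain Y where Y: "Y \<in> C" "x \<in> Y" "y \<in> Y"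
        using common by blast
      then have "precone Y"
        using sub by (auto simp: \<A>_def)
      then show "x + y \<in> \<Union>C" "x * y \<in> \<Union>C"
        using Y preconeD(2,3)[of Y x y] by blast+
    qed
    then show "\<Union>C \<in> \<A>"
      using C(1) sub by (auto simp: \<A>_def)
  qed
  then obtain P where P: "precone P" "M \<subseteq> P" "\<And>s. s \<in> S \<Longrightarrow> - (s * s) \<notin> P"
    and max: "\<And>Y. Y \<in> \<A> \<Longrightarrow> P \<subseteq> Y \<Longrightarrow> Y = P"
    by (auto simp: \<A>_def)
  note PD = preconeD[OF P(1)]
  have adj: "\<exists>s p q. s \<in> S \<and> p \<in> P \<and> q \<in> P \<and> - (s * s) = p + x * q" if x: "x \<notin> P" for x
  proof (rule ccontr)
    assume neg: "\<not> ?thesis"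
    let ?A = "{p + x * q | p q. p \<in> P \<and> q \<in> P}"
    have PA: "P \<subseteq> ?A"
    proof
      fix y assume "y \<in> P"
      then show "y \<in> ?A"
        using PD(4) by (intro CollectI exI[of _ y] exI[of _ 0]) auto
    qed
    have "x \<in> ?A"
      using PD(4,5) by (intro CollectI exI[of _ 0] exI[of _ 1]) auto
    moreover have "?A \<in> \<A>"
      unfolding \<A>_def
    proof (intro CollectI conjI ballI notI)
      show "precone ?A"
        by (rule precone_adjoin[OF P(1)])
      show "M \<subseteq> ?A"
        using PA P(2) by (rule order_trans[rotated])
      fix s assume s: "s \<in> S" and "- (s * s) \<in> ?A"
      then obtain p q where "p \<in> P" "q \<in> P" "- (s * s) = p + x * q"
        by blast
      then show False
        using neg s by blast
    qed
    ultimately show False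
      using max PA x by blast
  qed
  have total: "x \<in> P \<or> - x \<in> P" for x
  proof (rule ccontr)
    assume "\<not> ?thesis"
    then have nx: "x \<notin> P" "- x \<notin> P" by auto
    obtain s p q where 1: "s \<in> S" "p \<in> P" "q \<in> P" "- (s * s) = p + x * q"
      using adj[OF nx(1)] by blast
    obtain t p' q' where 2: "t \<in> S" "p' \<in> P" "q' \<in> P" "- (t * t) = p' + - x * q'"
      using adj[OF nx(2)] by blast
    have "x * q = - (s * s) - p"
      by (simp add: 1(4))
    moreover have "x * q' = t * t + p'"
      using arg_cong[OF 2(4), of uminus] by simp
    ultimately have "(x * q) * (x * q') = (- (s * s) - p) * (t * t + p')"
      by simp
    then have e: "x * x * (q * q') = (- (s * s) - p) * (t * t + p')"
      by (simp add: ac_simps)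
    have "- ((s * t) * (s * t)) = s * s * p' + t * t * p + p * p' + x * x * (q * q')"
      unfolding e by (simp add: algebra_simps)
    also have "\<dots> \<in> P"
      using 1 2 by (simp add: PD(1-3))
    finally show False
      using P(3) S 1(1) 2(1) by blast
  qed
  have ideal_out: "\<exists>s p q. s \<in> S \<and> p \<in> P \<and> q \<in> P \<and> a * q = s * s + p" if a: "- a \<notin> P" for a
  proof -
    obtain s p q where spq: "s \<in> S" "p \<in> P" "q \<in> P" and e: "- (s * s) = p + - a * q"
      using adj[OF a] by blast
    have "a * q = p - (p + - a * q)"
      by simp
    also have "\<dots> = s * s + p"
      unfolding e[symmetric] by simp
    finally show ?thesis
      using spq by blast
  qed
  have prime_pos: False if ab: "a * b \<in> support P" and a: "- a \<notin> P" and b: "- b \<notin> P" for a b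
  proof -
    obtain s p q where 1: "s \<in> S" "p \<in> P" "q \<in> P" "a * q = s * s + p"
      using ideal_out[OF a] by blast
    obtain t p' q' where 2: "t \<in> S" "p' \<in> P" "q' \<in> P" "b * q' = t * t + p'"
      using ideal_out[OF b] by blast
    have "(a * b) * (q * q') \<in> support P"
      by (rule support_mult[OF P(1) total ab])
    then have 3: "- ((a * b) * (q * q')) \<in> P"
      by (simp add: support_def)
    have "(a * b) * (q * q') = (a * q) * (b * q')"
      by (simp add: ac_simps)
    then have e: "(a * b) * (q * q') = (s * s + p) * (t * t + p')"
      by (simp only: 1(4) 2(4))
    have "- ((s * t) * (s * t)) = (s * s * p' + t * t * p + p * p') + - ((a * b) * (q * q'))"
      unfolding e by (simp add: algebra_simps)
    also have "\<dots> \<in> P"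
      by (rule PD(2)[OF _ 3]) (simp add: PD(1-3) 1 2)
    finally show False
      using P(3) S 1(1) 2(1) by blast
  qed
  have prime: "a \<in> support P \<or> b \<in> support P" if ab: "a * b \<in> support P" for a b
  proof (rule ccontr)
    assume "\<not> ?thesis"
    \<comment> \<open>An element is outside the support as soon as one of its two signs is missing
      from \<open>P\<close>, so up to signs both -a and -b are missing.\<close>
    then have "(- a \<notin> P \<or> - (- a) \<notin> P) \<and> (- b \<notin> P \<or> - (- b) \<notin> P)"
      by (auto simp: support_def)
    moreover have "a * - b \<in> support P" "- a * b \<in> support P" "- a * - b \<in> support P"
      using ab by (auto simp: support_def)
    ultimately show False
      using prime_pos[of a b] prime_pos[of "- a" b] prime_pos[of a "- b"] prime_pos[of "- a" "- b"] ab
      by blast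
  qed
  have "support P \<inter> S = {}"
  proof -
    have "- (s * s) \<in> P" if "s \<in> support P" for s
      using PD(3)[of s "- s"] that by (auto simp: support_def)
    then show ?thesis
      using P(3) by blast
  qed
  moreover have "- 1 \<notin> P"
    using P(3)[OF one] by simp
  ultimately show ?thesis
    using P(1,2) total prime unfolding prime_cone_def by blast
qed

section \<open>The real closure of an ordered field\<close>

text \<open>For an ordered field the intermediate value property of polynomials is equivalent to
  being real closed, and it is the form in which the sign arguments below use it.\<close>

class real_closed_field = linordered_field +
  assumes ivt_sum: "a < b \<Longrightarrow> (\<Sum>k\<le>n. f k * a ^ k) < 0 \<Longrightarrow> 0 < (\<Sum>k\<le>n. f k * b ^ k)
     \<Longrightarrow> \<exists>x. a < x \<and> x < b \<and> (\<Sum>k\<le>n. f k * x ^ k) = 0"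

text \<open>The nonnegative elements of an ordered subfield of the algebraic closure whose order
  extends the given one. The subfield is the union of P and -P, so a single set encodes field and
  order, and inclusion of sets is extension of ordered fields.\<close>

definition field_cone :: "'k::linordered_field alg_closure set \<Rightarrow> bool" where
  "field_cone P \<longleftrightarrow> (\<forall>x\<ge>0. to_ac x \<in> P) \<and> (\<forall>x\<in>P. \<forall>y\<in>P. x + y \<in> P) \<and> (\<forall>x\<in>P. \<forall>y\<in>P. x * y \<in> P)
     \<and> (\<forall>x\<in>P. inverse x \<in> P) \<and> (\<forall>x\<in>P. - x \<in> P \<longrightarrow> x = 0) \<and> (\<forall>x\<in>P. \<forall>y\<in>P. x - y \<in> P \<or> y - x \<in> P)"

lemma field_coneD:
  assumes "field_cone P"
  shows "0 \<le> x \<Longrightarrow> to_ac x \<in> P" "a \<in> P \<Longrightarrow> b \<in> P \<Longrightarrow> a + b \<in> P" "a \<in> P \<Longrightarrow> b \<in> P \<Longrightarrow> a * b \<in> P"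
    "a \<in> P \<Longrightarrow> inverse a \<in> P" "a \<in> P \<Longrightarrow> - a \<in> P \<Longrightarrow> a = 0" "a \<in> P \<Longrightarrow> b \<in> P \<Longrightarrow> a - b \<in> P \<or> b - a \<in> P"
  using assms by (simp_all add: field_cone_def)

lemma maximal_field_cone_exists:
  "\<exists>P :: 'k::linordered_field alg_closure set. field_cone P \<and> (\<forall>P'. field_cone P' \<longrightarrow> P \<subseteq> P' \<longrightarrow> P' = P)"
proof -
  let ?A = "{P :: 'k alg_closure set. field_cone P}"
  have "\<exists>P\<in>?A. \<forall>Y\<in>?A. P \<subseteq> Y \<longrightarrow> Y = P"
  proof (rule subset_Zorn_nonempty)
    have "field_cone (to_ac ` {0 :: 'k..})"
      unfolding field_cone_def
    proof (intro conjI ballI allI impI)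
      fix a b :: "'k alg_closure"
      assume "a \<in> to_ac ` {0..}" "b \<in> to_ac ` {0..}"
      then obtain x y where xy: "a = to_ac x" "b = to_ac y" "0 \<le> x" "0 \<le> y" by auto
      show "a + b \<in> to_ac ` {0..}"
        using xy by (intro image_eqI[of _ _ "x + y"]) auto
      show "a * b \<in> to_ac ` {0..}"
        using xy by (intro image_eqI[of _ _ "x * y"]) auto
      show "a - b \<in> to_ac ` {0..} \<or> b - a \<in> to_ac ` {0..}"
      proof (cases "x \<le> y")
        case True
        then have "b - a \<in> to_ac ` {0..}"
          using xy by (intro image_eqI[of _ _ "y - x"]) auto
        then show ?thesis ..
      next
        case False
        then have "a - b \<in> to_ac ` {0..}"
          using xy by (intro image_eqI[of _ _ "x - y"]) auto
        then show ?thesis ..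
      qed
    next
      fix a :: "'k alg_closure"
      assume "a \<in> to_ac ` {0..}"
      then obtain x where x: "a = to_ac x" "0 \<le> x" by auto
      show "inverse a \<in> to_ac ` {0..}"
        using x by (intro image_eqI[of _ _ "inverse x"]) auto
      assume "- a \<in> to_ac ` {0..}"
      then obtain y where y: "- a = to_ac y" "0 \<le> y" by auto
      then have "to_ac (- x) = to_ac y"
        using x(1) by simp
      then have "- x = y"
        by (simp only: to_ac_eq_iff)
      then show "a = 0"
        using x y by auto
    qed auto
    then show "?A \<noteq> {}"
      by blast
  next
    fix C assume C: "C \<noteq> {}" "subset.chain ?A C"
    have sub: "field_cone Y" if "Y \<in> C" for Y
      using C(2) that by (auto simp: subset.chain_def)
    have common: "\<exists>Y\<in>C. x \<in> Y \<and> y \<in> Y" if xy: "x \<in> \<Union>C" "y \<in> \<Union>C" for x y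
    proof -
      obtain A B where "A \<in> C" "x \<in> A" "B \<in> C" "y \<in> B"
        using xy by blast
      then show ?thesis
        using C(2) unfolding subset.chain_def by (cases "A \<subseteq> B") blast+
    qed
    have "field_cone (\<Union>C)"
      unfolding field_cone_def
    proof (intro conjI ballI allI impI)
      fix a b assume "a \<in> \<Union>C" "b \<in> \<Union>C"
      then obtain Y where Y: "Y \<in> C" "a \<in> Y" "b \<in> Y"
        using common by blast
      note Y' = field_coneD[OF sub[OF Y(1)]]
      show "a + b \<in> \<Union>C" "a * b \<in> \<Union>C" "a - b \<in> \<Union>C \<or> b - a \<in> \<Union>C"
        using Y Y'(2,3,6)[of a b] by blast+
    next
      fix a assume a: "a \<in> \<Union>C"
      then obtain Y where "Y \<in> C" "a \<in> Y"
        by blast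
      then show "inverse a \<in> \<Union>C"
        using field_coneD(4)[OF sub, of Y a] by blast
      assume "- a \<in> \<Union>C"
      then obtain Y where Y: "Y \<in> C" "a \<in> Y" "- a \<in> Y"
        using common[OF a] by blast
      then show "a = 0"
        using field_coneD(5)[OF sub[OF Y(1)]] by blast
    next
      fix x :: 'k assume "0 \<le> x"
      then show "to_ac x \<in> \<Union>C"
        using C(1) field_coneD(1)[OF sub] by blast
    qed
    then show "\<Union>C \<in> ?A"
      by simp
  qed
  then show ?thesis
    by blast
qed

definition closure_cone :: "'k::linordered_field alg_closure set" where
  "closure_cone = (SOME P. field_cone P \<and> (\<forall>P'. field_cone P' \<longrightarrow> P \<subseteq> P' \<longrightarrow> P' = P))"

lemma closure_cone: "field_cone closure_cone"
  unfolding closure_cone_def by (rule someI2_ex[OF maximal_field_cone_exists]) (rule conjunct1)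

lemma closure_cone_maximal: "field_cone P \<Longrightarrow> closure_cone \<subseteq> P \<Longrightarrow> P = closure_cone"
  using someI_ex[OF maximal_field_cone_exists, folded closure_cone_def] by blast

lemmas closure_coneD = field_coneD[OF closure_cone]

definition closure_carrier :: "'k::linordered_field alg_closure set" where
  "closure_carrier = {x. x \<in> closure_cone \<or> - x \<in> closure_cone}"

lemma closure_carrier_add:
  assumes "x \<in> closure_carrier" "y \<in> closure_carrier"
  shows "x + y \<in> closure_carrier"
proof -
  have *: "- y - x = - x - y" "y + x = x + y"
    by simp_all
  show ?thesis
    using assms closure_coneD(2)[of x y] closure_coneD(2)[of "- x" "- y"]
      closure_coneD(6)[of x "- y"] closure_coneD(6)[of "- x" y]
    by (auto simp: closure_carrier_def *)
qed

lemma closure_carrier_mult: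
  assumes "x \<in> closure_carrier" "y \<in> closure_carrier"
  shows "x * y \<in> closure_carrier"
  using assms closure_coneD(3)[of x y] closure_coneD(3)[of "- x" "- y"]
    closure_coneD(3)[of x "- y"] closure_coneD(3)[of "- x" y]
  by (auto simp: closure_carrier_def)

lemma closure_carrier_uminus: "x \<in> closure_carrier \<Longrightarrow> - x \<in> closure_carrier"
  by (auto simp: closure_carrier_def)

lemma closure_carrier_inverse:
  assumes "x \<in> closure_carrier" shows "inverse x \<in> closure_carrier"
  using assms closure_coneD(4)[of x] closure_coneD(4)[of "- x"]
  by (auto simp: closure_carrier_def)

lemma to_ac_in_closure_carrier: "to_ac x \<in> closure_carrier"
  using closure_coneD(1)[of x] closure_coneD(1)[of "- x"] by (cases "0 \<le> x") (auto simp: closure_carrier_def)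

lemma closure_cone_0_1: "0 \<in> closure_cone" "1 \<in> closure_cone"
  using closure_coneD(1)[of 0] closure_coneD(1)[of 1] by auto

section \<open>The real closure as an ordered field\<close>

typedef (overloaded) 'k::linordered_field real_closure = "closure_carrier :: 'k alg_closure set"
  using to_ac_in_closure_carrier by blast

setup_lifting type_definition_real_closure

instantiation real_closure :: (linordered_field) field
begin

lift_definition zero_real_closure :: "'a real_closure" is 0
  using to_ac_in_closure_carrier[of 0] by simp

lift_definition one_real_closure :: "'a real_closure" is 1
  using to_ac_in_closure_carrier[of 1] by simp

lift_definition plus_real_closure :: "'a real_closure \<Rightarrow> 'a real_closure \<Rightarrow> 'a real_closure" is "(+)"
  by (rule closure_carrier_add)

lift_definition uminus_real_closure :: "'a real_closure \<Rightarrow> 'a real_closure" is uminus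
  by (rule closure_carrier_uminus)

lift_definition minus_real_closure :: "'a real_closure \<Rightarrow> 'a real_closure \<Rightarrow> 'a real_closure" is "(-)"
  using closure_carrier_add closure_carrier_uminus by (metis add_uminus_conv_diff)

lift_definition times_real_closure :: "'a real_closure \<Rightarrow> 'a real_closure \<Rightarrow> 'a real_closure" is "(*)"
  by (rule closure_carrier_mult)

lift_definition inverse_real_closure :: "'a real_closure \<Rightarrow> 'a real_closure" is inverse
  by (rule closure_carrier_inverse)

lift_definition divide_real_closure :: "'a real_closure \<Rightarrow> 'a real_closure \<Rightarrow> 'a real_closure" is divide
  using closure_carrier_mult closure_carrier_inverse by (metis divide_inverse)

instance
  by standard (transfer; simp add: algebra_simps divide_inverse)+

end

instantiation real_closure :: (linordered_field) linordered_field
begin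

lift_definition less_eq_real_closure :: "'a real_closure \<Rightarrow> 'a real_closure \<Rightarrow> bool"
  is "\<lambda>x y. y - x \<in> closure_cone" .

definition less_real_closure :: "'a real_closure \<Rightarrow> 'a real_closure \<Rightarrow> bool"
  where "less_real_closure x y \<longleftrightarrow> x \<le> y \<and> x \<noteq> y"

definition abs_real_closure :: "'a real_closure \<Rightarrow> 'a real_closure"
  where "abs_real_closure x = (if x < 0 then - x else x)"

definition sgn_real_closure :: "'a real_closure \<Rightarrow> 'a real_closure"
  where "sgn_real_closure x = (if x = 0 then 0 else if 0 < x then 1 else - 1)"

instance
proof
  fix x y z :: "'a real_closure"
  show refl: "x \<le> x"
    by transfer (simp add: closure_cone_0_1)
  show antisym: "x \<le> y \<Longrightarrow> y \<le> x \<Longrightarrow> x = y"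
    by transfer (use closure_coneD(5) in fastforce)
  show trans: "x \<le> y \<Longrightarrow> y \<le> z \<Longrightarrow> x \<le> z"
    by transfer (use closure_coneD(2) in fastforce)
  show "x \<le> y \<or> y \<le> x"
  proof transfer
    fix x y :: "'a alg_closure"
    assume "x \<in> closure_carrier" "y \<in> closure_carrier"
    then have "y + - x \<in> closure_carrier"
      using closure_carrier_add closure_carrier_uminus by blast
    then show "y - x \<in> closure_cone \<or> x - y \<in> closure_cone"
      by (auto simp: closure_carrier_def)
  qed
  show "x < y \<longleftrightarrow> x \<le> y \<and> \<not> y \<le> x"
    using antisym refl by (auto simp: less_real_closure_def)
  show "x \<le> y \<Longrightarrow> z + x \<le> z + y"
    by transfer simp
  show "\<bar>x\<bar> = (if x < 0 then - x else x)"
    by (fact abs_real_closure_def)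
  show "sgn x = (if x = 0 then 0 else if 0 < x then 1 else - 1)"
    by (fact sgn_real_closure_def)
  have mult: "0 \<le> z \<Longrightarrow> x \<le> y \<Longrightarrow> z * x \<le> z * y"
    by transfer (metis closure_coneD(3) diff_zero right_diff_distrib)
  show "x < y \<Longrightarrow> 0 < z \<Longrightarrow> z * x < z * y"
    using mult unfolding less_real_closure_def by auto
qed

end

lift_definition to_rc :: "'k::linordered_field \<Rightarrow> 'k real_closure" is to_ac
  by (rule to_ac_in_closure_carrier)

lemma to_rc_hom: "to_rc 0 = 0" "to_rc 1 = 1" "to_rc (x + y) = to_rc x + to_rc y" "to_rc (x * y) = to_rc x * to_rc y"
  by (transfer; simp)+

lemma to_rc_eq_0: "to_rc x = 0 \<longleftrightarrow> x = 0"
  by transfer simp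

lemma to_rc_nonneg: "0 \<le> x \<Longrightarrow> 0 \<le> to_rc x"
  by transfer (simp add: closure_coneD(1))

lemma Rep_real_closure_hom:
  "Rep_real_closure 0 = 0" "Rep_real_closure 1 = 1"
  "Rep_real_closure (x + y) = Rep_real_closure x + Rep_real_closure y"
  "Rep_real_closure (x * y) = Rep_real_closure x * Rep_real_closure y"
  by (simp_all add: zero_real_closure.rep_eq one_real_closure.rep_eq plus_real_closure.rep_eq times_real_closure.rep_eq)

section \<open>Roots of polynomials that change sign\<close>

lemma irreducible_poly_dvd_ideal:
  fixes p :: "'a::field poly"
  assumes p: "irreducible p" and J: "p \<in> J" "1 \<notin> J" "\<And>x y. x \<in> J \<Longrightarrow> y \<in> J \<Longrightarrow> x + y \<in> J"
    "\<And>x y. x \<in> J \<Longrightarrow> x * y \<in> J" and g: "g \<in> J"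
  shows "p dvd g"
proof -
  have "p \<noteq> 0"
    using p by auto
  \<comment> \<open>An element \<open>d\<close> of least degree generates the ideal. It divides
    \<open>p\<close> and is no unit, so it is \<open>p\<close> up to a unit: \<open>p\<close>
    generates a maximal ideal.\<close>
  define n where "n = (LEAST n. \<exists>d\<in>J. d \<noteq> 0 \<and> degree d = n)"
  have ex: "\<exists>n. \<exists>d\<in>J. d \<noteq> 0 \<and> degree d = n"
    using J(1) \<open>p \<noteq> 0\<close> by blast
  obtain d where d: "d \<in> J" "d \<noteq> 0" "degree d = n"
    using LeastI_ex[OF ex] unfolding n_def by blast
  have dvd: "d dvd h" if h: "h \<in> J" for h
  proof (rule ccontr)
    assume "\<not> d dvd h"
    then have ne: "h mod d \<noteq> 0"
      by (simp add: dvd_eq_mod_eq_0)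
    have "h mod d = h + d * (- (h div d))"
      by (simp add: minus_mult_div_eq_mod[symmetric])
    then have "h mod d \<in> J"
      using J(3)[OF h J(4)[OF d(1)]] by metis
    then have "n \<le> degree (h mod d)"
      unfolding n_def using ne by (intro Least_le) blast
    moreover have "degree (h mod d) < degree d"
      using degree_mod_less[OF d(2), of h] ne by blast
    ultimately show False
      using d(3) by simp
  qed
  obtain e where e: "p = d * e"
    using dvd[OF J(1)] by (elim dvdE)
  have "\<not> d dvd 1"
  proof
    assume "d dvd 1"
    then obtain u where "1 = d * u" by (elim dvdE)
    then show False
      using J(4)[OF d(1), of u] J(2) by metis
  qed
  then have "e dvd 1"
    using Factorial_Ring.irreducibleD[OF p e] by blast
  then obtain u where "1 = e * u" by (elim dvdE)
  then have "d = p * u"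
    using e by (simp add: mult.assoc)
  then show ?thesis
    using dvd[OF g] by (metis dvd_mult_left)
qed

text \<open>Nonnegative constants enter as weights because they need not be squares in the base
  field. A cone that contains this set extends the order of that field.\<close>

inductive_set weighted_sos :: "'a::linordered_field poly set" where
  zero: "0 \<in> weighted_sos"
| add: "w \<in> weighted_sos \<Longrightarrow> 0 \<le> c \<Longrightarrow> w + smult c (q * q) \<in> weighted_sos"

lemma weighted_sos_add:
  assumes "v \<in> weighted_sos" "w \<in> weighted_sos" shows "v + w \<in> weighted_sos"
  using assms(2)
proof induction
  case (add w c q)
  then show ?case
    using weighted_sos.add[of "v + w" c q] by (simp add: add.assoc)
qed (use assms(1) in auto)

lemma weighted_sos_square: "0 \<le> c \<Longrightarrow> smult c (q * q) \<in> weighted_sos"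
  using weighted_sos.add[OF weighted_sos.zero] by simp

lemma weighted_sos_mult:
  assumes "v \<in> weighted_sos" "w \<in> weighted_sos" shows "v * w \<in> weighted_sos"
  using assms(2)
proof induction
  case (add w c q)
  have "v * smult c (q * q) \<in> weighted_sos"
    using assms(1)
  proof induction
    case (add u d r)
    have "(u + smult d (r * r)) * smult c (q * q) = u * smult c (q * q) + smult (d * c) ((r * q) * (r * q))"
      by (simp add: algebra_simps)
    then show ?case
      using weighted_sos_add[OF add.IH weighted_sos_square[of "d * c" "r * q"]] add.hyps \<open>0 \<le> c\<close> by simp
  qed (auto intro: weighted_sos.zero)
  then show ?case
    using weighted_sos_add[OF add.IH] by (simp add: distrib_left)
qed (auto intro: weighted_sos.zero)

lemma weighted_sos_nonneg:
  assumes "w \<in> weighted_sos" shows "0 \<le> poly w x"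
  using assms by induction auto

text \<open>The remainder is taken of each square root rather than of \<open>w\<close>, which keeps
  the shape of a weighted sum of squares and bounds the degree.\<close>

lemma weighted_sos_mod:
  assumes "w \<in> weighted_sos" "0 < degree p"
  shows "\<exists>v\<in>weighted_sos. p dvd w - v \<and> degree v \<le> 2 * (degree p - 1)"
  using assms(1)
proof induction
  case zero
  then show ?case
    by (intro bexI[of _ 0]) (auto intro: weighted_sos.zero)
next
  case (add w c q)
  then obtain v where v: "v \<in> weighted_sos" "p dvd w - v" "degree v \<le> 2 * (degree p - 1)"
    by blast
  let ?r = "q mod p"
  have "q = p * (q div p) + ?r"
    by simp
  then have "q * q - ?r * ?r = p * ((q div p) * (q + ?r))"
    by (metis (no_types, lifting) add_diff_cancel_right' mult.assoc mult.commute square_diff_square_factored)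
  then have e: "w + smult c (q * q) - (v + smult c (?r * ?r)) = (w - v) + smult c (p * ((q div p) * (q + ?r)))"
    by (metis (no_types, lifting) add_diff_add smult_diff_right)
  have "p dvd w + smult c (q * q) - (v + smult c (?r * ?r))"
    using dvd_add[OF v(2) dvd_smult[OF dvd_triv_left[of p "(q div p) * (q + ?r)"], of c]] unfolding e .
  moreover have "degree ?r \<le> degree p - 1"
    using degree_mod_less[of p q] assms(2) by (cases "?r = 0"; cases "p = 0") auto
  then have "degree (smult c (?r * ?r)) \<le> 2 * (degree p - 1)"
    using degree_mult_le[of ?r ?r] by (intro order_trans[OF degree_smult_le]) linarith
  then have "degree (v + smult c (?r * ?r)) \<le> 2 * (degree p - 1)"
    using v(3) by (intro degree_add_le)
  ultimately show ?case
    using weighted_sos.add[OF v(1) add.hyps(2), of ?r] by blast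
qed

interpretation Rep_real_closure: inj_idom_hom "Rep_real_closure :: 'k::linordered_field real_closure \<Rightarrow> 'k alg_closure"
  by unfold_locales (auto simp: Rep_real_closure_hom Rep_real_closure_inject[symmetric])

interpretation Rep_real_closure_poly: map_poly_inj_idom_hom "Rep_real_closure :: 'k::linordered_field real_closure \<Rightarrow> 'k alg_closure"
  ..

lemma sign_change_mult:
  fixes a b c d :: "'a::linordered_field"
  assumes "(a * c) * (b * d) < 0" shows "a * b < 0 \<or> c * d < 0"
proof -
  have "(a * b) * (c * d) < 0"
    using assms by (simp add: ac_simps)
  then show ?thesis
    by (auto simp: mult_less_0_iff[of "a * b" "c * d"])
qed

text \<open>Artin's descent: after reduction, -1 - v = p h with v of degree at most 2 (deg p - 1),
  so h has smaller degree than p. Since p h is negative everywhere, h changes sign where p does, yet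
  it has no root, against the induction hypothesis.\<close>

lemma minus_one_not_in_sign_change_precone:
  fixes p :: "'a::linordered_field poly"
  assumes IH: "\<And>h. degree h < degree p \<Longrightarrow> poly h a * poly h b < 0 \<Longrightarrow> \<exists>x. poly h x = 0"
    and p: "poly p a * poly p b < 0" and w: "w \<in> weighted_sos"
  shows "\<not> p dvd - 1 - w"
proof
  assume "p dvd - 1 - w"
  have deg: "0 < degree p"
  proof (rule ccontr)
    assume "\<not> ?thesis"
    then obtain c where "p = [:c:]"
      by (auto elim: degree_eq_zeroE)
    then show False
      using p by (simp add: not_less[symmetric])
  qed
  obtain v where v: "v \<in> weighted_sos" "p dvd w - v" "degree v \<le> 2 * (degree p - 1)"
    using weighted_sos_mod[OF w deg] by blast
  have "p dvd (- 1 - w) + (w - v)"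
    using \<open>p dvd - 1 - w\<close> v(2) by (rule dvd_add)
  then have "p dvd - 1 - v"
    by simp
  then obtain h where h: "- 1 - v = p * h"
    by (elim dvdE)
  have neg: "poly p x * poly h x < 0" for x
  proof -
    have "poly p x * poly h x = - 1 - poly v x"
      using arg_cong[OF h, of "\<lambda>q. poly q x"] by simp
    then show ?thesis
      using weighted_sos_nonneg[OF v(1), of x] by simp
  qed
  have "0 < (poly p a * poly h a) * (poly p b * poly h b)"
    using neg by (intro mult_neg_neg)
  then have "poly h a * poly h b < 0"
    using p by (auto simp: zero_less_mult_iff mult_less_0_iff)
  moreover have "degree h < degree p"
  proof -
    have "p \<noteq> 0" "h \<noteq> 0"
      using neg[of 0] by auto
    then have "degree p + degree h = degree (- 1 - v)"
      by (simp add: h degree_mult_eq)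
    also have "\<dots> \<le> 2 * (degree p - 1)"
      using v(3) by (intro degree_diff_le) auto
    finally show ?thesis
      using deg by linarith
  qed
  ultimately obtain x where "poly h x = 0"
    using IH by blast
  then show False
    using neg[of x] by simp
qed

text \<open>An irreducible polynomial that changes sign admits an ordering of the field obtained by
  adjoining one of its roots; maximality of the cone then puts the root into the field.\<close>

lemma real_closure_root_of_irreducible:
  fixes p :: "'k::linordered_field real_closure poly"
  assumes p: "irreducible p" and sos: "\<And>w. w \<in> weighted_sos \<Longrightarrow> \<not> p dvd - 1 - w"
  shows "\<exists>r. poly p r = 0"
proof -
  \<comment> \<open>Computing with congruences modulo \<open>p\<close> inside the polynomial ring
    replaces a quotient field. The support of the prime cone over \<open>M\<close> is the ideal of
    \<open>p\<close>.\<close>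
  define M where "M = {m. \<exists>w\<in>weighted_sos. p dvd m - w}"
  have WM: "w \<in> M" if "w \<in> weighted_sos" for w
    using that by (auto simp: M_def intro: bexI[of _ w])
  have "precone M"
    unfolding precone_def
  proof (intro conjI allI ballI)
    fix x show "x * x \<in> M"
      using weighted_sos_square[of 1 x] by (auto intro: WM)
  next
    fix x y assume "x \<in> M" "y \<in> M"
    then obtain v w where vw: "v \<in> weighted_sos" "w \<in> weighted_sos" "p dvd x - v" "p dvd y - w"
      by (auto simp: M_def)
    have "p dvd (x + y) - (v + w)"
      using dvd_add[OF vw(3,4)] by (simp add: algebra_simps)
    then show "x + y \<in> M"
      using weighted_sos_add vw by (auto simp: M_def)
    have "x * y - v * w = (x - v) * y + v * (y - w)"
      by (simp add: algebra_simps)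
    then have "p dvd x * y - v * w"
      using vw by auto
    then show "x * y \<in> M"
      using weighted_sos_mult vw by (auto simp: M_def)
  qed
  moreover have "- (s * s) \<notin> M" if "s \<in> {1}" for s
    using that sos by (auto simp: M_def)
  ultimately obtain Q where Q: "prime_cone Q" "M \<subseteq> Q"
    using prime_cone_exists[of M "{1}"] by auto
  note QD = prime_coneD[OF Q(1)]
  note QP = preconeD[OF QD(1)]
  have pQ: "p * h \<in> support Q" for h
  proof -
    have "p * h \<in> M" "- (p * h) \<in> M"
      by (auto simp: M_def intro!: bexI[of _ 0] weighted_sos.zero)
    then show ?thesis
      using Q(2) by (auto simp: support_def)
  qed
  have supp: "p dvd g" if "g \<in> support Q" for g
  proof (rule irreducible_poly_dvd_ideal[OF p, of "support Q"])
    show "p \<in> support Q"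
      using pQ[of 1] by simp
    show "1 \<notin> support Q"
      using QD(2) by (auto simp: support_def)
  qed (use that QD in \<open>auto intro: support_add support_mult\<close>)
  have "0 < degree p"
    using p by (auto simp: Factorial_Ring.irreducible_def is_unit_iff_degree)
  then obtain z where z: "poly (map_poly Rep_real_closure p) z = 0"
    using alg_closed_imp_poly_has_root[of "map_poly Rep_real_closure p"] by auto
  \<comment> \<open>Evaluation at a root of \<open>p\<close> has exactly the multiples of
    \<open>p\<close> as kernel, so it embeds the quotient field into the algebraic closure and
    carries \<open>Q\<close> to a candidate for a larger field cone.\<close>
  define \<phi> where "\<phi> g = poly (map_poly Rep_real_closure g) z" for g
  have \<phi>: "\<phi> (g + h) = \<phi> g + \<phi> h" "\<phi> (g * h) = \<phi> g * \<phi> h" "\<phi> (- g) = - \<phi> g" "\<phi> (g - h) = \<phi> g - \<phi> h"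
    "\<phi> 0 = 0" "\<phi> 1 = 1" for g h
    by (simp_all add: \<phi>_def hom_distribs)
  have \<phi>p: "\<phi> g = 0" if "p dvd g" for g
    using that z by (auto elim!: dvdE simp: \<phi>_def hom_distribs)
  have \<phi>c: "\<phi> [:c:] = Rep_real_closure c" for c
    by (simp add: \<phi>_def hom_distribs)
  have constQ: "[:c:] \<in> Q" if "0 \<le> c" for c
    using WM[OF weighted_sos_square[OF that, of 1]] Q(2) by auto
  have coneQ: "x \<in> \<phi> ` Q" if x: "x \<in> closure_cone" for x
  proof -
    have "Rep_real_closure (Abs_real_closure x) = x"
      using x by (intro Abs_real_closure_inverse) (simp add: closure_carrier_def)
    then have "0 \<le> Abs_real_closure x" "\<phi> [:Abs_real_closure x:] = x"
      using x by (simp_all add: less_eq_real_closure.rep_eq Rep_real_closure_hom \<phi>c)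
    then show ?thesis
      using constQ by (metis imageI)
  qed
  have "field_cone (\<phi> ` Q)"
    unfolding field_cone_def
  proof (intro conjI ballI allI impI)
    fix a b assume "a \<in> \<phi> ` Q" "b \<in> \<phi> ` Q"
    then obtain g h where gh: "g \<in> Q" "h \<in> Q" "a = \<phi> g" "b = \<phi> h" by blast
    show "a + b \<in> \<phi> ` Q" "a * b \<in> \<phi> ` Q"
      using gh QP(2,3)[of g h] by (auto simp flip: \<phi>)
    show "a - b \<in> \<phi> ` Q \<or> b - a \<in> \<phi> ` Q"
      using QD(3)[of "g - h"] gh by (auto simp flip: \<phi>)
  next
    fix x :: 'k assume "0 \<le> x"
    then show "to_ac x \<in> \<phi> ` Q"
      using closure_coneD(1) coneQ by blast
  next
    fix a assume "a \<in> \<phi> ` Q"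
    then obtain g where g: "g \<in> Q" "a = \<phi> g" by blast
    show "inverse a \<in> \<phi> ` Q"
    proof (cases "p dvd g")
      case True
      then have "inverse a = \<phi> 0"
        using g \<phi>p \<phi> by simp
      then show ?thesis
        using QP(4) by blast
    next
      case False
      \<comment> \<open>Bezout: \<open>u\<close> inverts \<open>g\<close> modulo \<open>p\<close>.
        It is nonnegative, since otherwise g (-u), corrected by a multiple of \<open>p\<close>,
        would put -1 into \<open>Q\<close>.\<close>
      have "1 \<in> {g * u + p * v | u v. True}" (is "1 \<in> ?J")
      proof (rule ccontr)
        assume 1: "1 \<notin> ?J"
        have "p dvd g"
        proof (rule irreducible_poly_dvd_ideal[OF p _ 1])
          show "p \<in> ?J" by (intro CollectI exI[of _ 0] exI[of _ 1]) auto
          show "g \<in> ?J" by (intro CollectI exI[of _ 1] exI[of _ 0]) auto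
          fix x y assume "x \<in> ?J"
          then obtain u v where x: "x = g * u + p * v" by blast
          show "x * y \<in> ?J"
            by (intro CollectI exI[of _ "u * y"] exI[of _ "v * y"]) (simp add: x algebra_simps)
          assume "y \<in> ?J"
          then obtain u' v' where y: "y = g * u' + p * v'" by blast
          show "x + y \<in> ?J"
            by (intro CollectI exI[of _ "u + u'"] exI[of _ "v + v'"]) (simp add: x y algebra_simps)
        qed
        then show False
          using False by blast
      qed
      then obtain u v where uv: "1 = g * u + p * v" by blast
      have "\<phi> 1 = \<phi> (g * u) + \<phi> (p * v)"
        using \<phi>(1) uv by metis
      then have "\<phi> 1 = \<phi> g * \<phi> u"
        using \<phi>p[of "p * v"] \<phi>(2)[of g u] by simp
      then have inv: "inverse a = \<phi> u"
        using g \<phi> by (simp add: inverse_unique)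
      have "u \<in> Q"
      proof (rule ccontr)
        assume "u \<notin> Q"
        then have "g * - u \<in> Q"
          using QD(3) QP(3)[OF g(1)] by blast
        moreover have "p * (- v) \<in> Q"
          using pQ[of "- v"] by (simp add: support_def)
        ultimately have "g * - u + p * - v \<in> Q"
          by (rule QP(2))
        moreover have "g * - u + p * - v = - 1"
          unfolding uv by simp
        ultimately show False
          using QD(2) by simp
      qed
      then show ?thesis
        using inv by blast
    qed
    assume "- a \<in> \<phi> ` Q"
    then obtain h where h: "h \<in> Q" "- a = \<phi> h" by blast
    show "a = 0"
    proof (cases "- g \<in> Q")
      case True
      then show ?thesis
        using g supp \<phi>p by (auto simp: support_def)
    next
      case False
      have "\<phi> (g + h) = 0"
        by (simp add: \<phi>(1) flip: g(2) h(2))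
      \<comment> \<open>The kernel of the evaluation is a proper ideal containing \<open>p\<close>,
        hence consists of multiples of \<open>p\<close>.\<close>
      have "p dvd g + h"
      proof (rule ccontr)
        assume ndvd: "\<not> p dvd g + h"
        have "1 \<in> {k. \<phi> k = 0}"
        proof (rule ccontr)
          assume "1 \<notin> {k. \<phi> k = 0}"
          then have "p dvd g + h"
            using \<open>\<phi> (g + h) = 0\<close> \<phi>p[of p] \<phi>
            by (intro irreducible_poly_dvd_ideal[OF p, of "{k. \<phi> k = 0}"]) auto
          then show False using ndvd by blast
        qed
        then show False
          using \<phi> by simp
      qed
      then obtain k where "g + h = p * k" by (elim dvdE)
      then have "- g = h + p * (- k)"
        by (simp add: algebra_simps add_eq_0_iff)
      also have "\<dots> \<in> Q"
        using h(1) pQ[of "- k"] by (intro QP(2)) (auto simp: support_def)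
      finally show ?thesis
        using False by blast
    qed
  qed
  then have eq: "\<phi> ` Q = closure_cone"
    using closure_cone_maximal coneQ by blast
  have "\<phi> [:0, 1:] = z"
    by (simp add: \<phi>_def hom_distribs)
  then have "z \<in> closure_carrier"
    using QD(3)[of "[:0, 1:]"] eq \<phi>(3)[of "[:0, 1:]"] unfolding closure_carrier_def
    by (metis (mono_tags, lifting) imageI mem_Collect_eq)
  then obtain r where r: "z = Rep_real_closure r"
    by (metis Rep_real_closure_cases)
  then have "poly p r = 0"
    using z by (simp add: Rep_real_closure_hom)
  then show ?thesis ..
qed

text \<open>By induction on the degree. A reducible polynomial has a factor of smaller degree that
  changes sign. An irreducible one has a root because the induction hypothesis excludes -1 from the
  weighted sums of squares modulo \<open>p\<close>; then it is linear and its root must lie between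
  \<open>a\<close> and \<open>b\<close>.\<close>

lemma real_closure_ivt:
  fixes p :: "'k::linordered_field real_closure poly"
  assumes "a < b" "poly p a * poly p b < 0"
  shows "\<exists>x. a < x \<and> x < b \<and> poly p x = 0"
  using assms(2)
proof (induction "degree p" arbitrary: p rule: less_induct)
  case less
  have p0: "p \<noteq> 0"
    using less.prems by auto
  have notunit: "\<not> p dvd 1"
  proof
    assume "p dvd 1"
    then obtain c where "p = [:c:]"
      using p0 by (auto simp: is_unit_iff_degree elim: degree_eq_zeroE)
    then show False
      using less.prems by (simp add: not_less[symmetric])
  qed
  show ?case
  proof (cases "irreducible p")
    case True
    obtain r where r: "poly p r = 0"
      using real_closure_root_of_irreducible[OF True] minus_one_not_in_sign_change_precone[of p a b] less by metis
    then obtain q where q: "p = [:- r, 1:] * q"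
      unfolding poly_eq_0_iff_dvd by (elim dvdE)
    then have "q dvd 1"
      using Factorial_Ring.irreducibleD[OF True q] by (auto simp: is_unit_iff_degree)
    then obtain c where c: "q = [:c:]"
      using q p0 by (auto simp: is_unit_iff_degree elim: degree_eq_zeroE)
    have "(a - r) * (b - r) * (c * c) < 0"
      using less.prems by (simp add: q c algebra_simps)
    then have "(a - r) * (b - r) < 0"
      by (auto simp: mult_less_0_iff not_less[symmetric] zero_less_mult_iff)
    then show ?thesis
      using r assms(1) by (auto simp: mult_less_0_iff)
  next
    case False
    then obtain g h where gh: "p = g * h" "\<not> g dvd 1" "\<not> h dvd 1"
      using p0 notunit by (auto simp: Factorial_Ring.irreducible_def)
    have "degree g > 0" "degree h > 0" "degree p = degree g + degree h"
      using gh p0 by (auto simp: is_unit_iff_degree degree_mult_eq)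
    moreover have "poly g a * poly g b < 0 \<or> poly h a * poly h b < 0"
      using less.prems by (intro sign_change_mult) (simp add: gh(1))
    ultimately show ?thesis
      using less.hyps[of g] less.hyps[of h] gh(1) by auto
  qed
qed

lemma sum_eq_poly: "(\<Sum>k\<le>n. f k * x ^ k) = poly (\<Sum>k\<le>n. monom (f k) k) (x :: 'a::comm_ring_1)"
  by (simp add: poly_sum poly_monom)

instance real_closure :: (linordered_field) real_closed_field
proof
  fix a b :: "'a real_closure" and f :: "nat \<Rightarrow> 'a real_closure" and n
  assume "a < b" "(\<Sum>k\<le>n. f k * a ^ k) < 0" "0 < (\<Sum>k\<le>n. f k * b ^ k)"
  then show "\<exists>x. a < x \<and> x < b \<and> (\<Sum>k\<le>n. f k * x ^ k) = 0"
    unfolding sum_eq_poly by (intro real_closure_ivt) (auto simp: mult_less_0_iff)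
qed

instance real :: real_closed_field
proof
  fix a b :: real and f :: "nat \<Rightarrow> real" and n
  assume "a < b" "(\<Sum>k\<le>n. f k * a ^ k) < 0" "0 < (\<Sum>k\<le>n. f k * b ^ k)"
  then show "\<exists>x. a < x \<and> x < b \<and> (\<Sum>k\<le>n. f k * x ^ k) = 0"
    unfolding sum_eq_poly by (intro poly_IVT_pos)
qed

section \<open>Polynomials over real closed fields\<close>

lemma rcf_ivt:
  fixes p :: "'a::real_closed_field poly"
  assumes "a < b" "poly p a * poly p b < 0"
  shows "\<exists>x. a < x \<and> x < b \<and> poly p x = 0"
proof -
  have main: "\<exists>x. a < x \<and> x < b \<and> poly q x = 0" if "poly q a < 0" "0 < poly q b" for q
    using ivt_sum[of a b "coeff q" "degree q"] that assms(1) by (simp add: poly_altdef)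
  show ?thesis
    using assms(2) main[of p] main[of "- p"] by (auto simp: mult_less_0_iff)
qed

lemma rcf_sgn_eq:
  fixes p :: "'a::real_closed_field poly"
  assumes "a \<le> b" "\<And>x. a \<le> x \<Longrightarrow> x \<le> b \<Longrightarrow> poly p x \<noteq> 0"
  shows "sgn (poly p a) = sgn (poly p b)"
proof (cases "a = b")
  case False
  then have "a < b"
    using assms(1) by simp
  have "\<not> poly p a * poly p b < 0"
    using rcf_ivt[OF \<open>a < b\<close>, of p] assms(2) by force
  then show ?thesis
    using assms(2)[of a] assms(2)[of b] assms(1)
    by (auto simp: mult_less_0_iff sgn_if not_less)
qed simp

lemma order_decomp_nonzero:
  fixes p :: "'a::idom poly"
  assumes "p \<noteq> 0" "poly p a = 0"
  shows "\<exists>m q. p = [:- a, 1:] ^ Suc m * q \<and> poly q a \<noteq> 0"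
proof -
  obtain q where q: "p = [:- a, 1:] ^ Polynomial.order a p * q" "\<not> [:- a, 1:] dvd q"
    using order_decomp[OF assms(1)] by blast
  moreover have "Polynomial.order a p \<noteq> 0"
    using assms by (simp add: order_root)
  then obtain m where "Polynomial.order a p = Suc m"
    by (meson not0_implies_Suc)
  ultimately show ?thesis
    by (auto simp: poly_eq_0_iff_dvd)
qed

text \<open>Maxima on intervals are not at hand over a general real closed field, so the proof is
  algebraic. With c the first root after a, p = (x - a)^(m+1) (x - c)^(n+1) g where g keeps its sign
  on [a, c]. Then p' = (x - a)^m (x - c)^n k, and the cofactor k has opposite signs at a and
  c.\<close>

lemma rcf_rolle:
  fixes p :: "'a::real_closed_field poly"
  assumes "a < b" "poly p a = 0" "poly p b = 0"
  shows "\<exists>x. a < x \<and> x < b \<and> poly (pderiv p) x = 0"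
proof (cases "p = 0")
  case True
  then show ?thesis
    using dense[OF assms(1)] by auto
next
  case False
  define R where "R = {x. a < x \<and> poly p x = 0}"
  have R: "finite R" "b \<in> R"
    using poly_roots_finite[OF False] assms by (auto simp: R_def)
  define c where "c = Min R"
  have c: "c \<in> R" "c \<le> b"
    unfolding c_def using R by (auto intro!: Min_in Min_le)
  have cmin: "poly p x \<noteq> 0" if "a < x" "x < c" for x
    using Min_le[OF R(1), of x] that unfolding c_def R_def by auto
  have ac: "a < c" "poly p c = 0"
    using c(1) by (auto simp: R_def)
  obtain m q where q: "p = [:- a, 1:] ^ Suc m * q" "poly q a \<noteq> 0"
    using order_decomp_nonzero[OF False assms(2)] by blast
  have "q \<noteq> 0" "poly q c = 0"
    using q ac by auto
  then obtain n g where g: "q = [:- c, 1:] ^ Suc n * g" "poly g c \<noteq> 0"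
    using order_decomp_nonzero by blast
  have ga: "poly g a \<noteq> 0"
    using q(2) g(1) by auto
  have "poly g x \<noteq> 0" if "a \<le> x" "x \<le> c" for x
    using that ga g(2) cmin[of x] by (cases "x = a \<or> x = c") (auto simp: q(1) g(1))
  then have sg: "sgn (poly g a) = sgn (poly g c)"
    using ac by (intro rcf_sgn_eq) auto
  define k where "k = smult (of_nat (Suc m)) ([:- c, 1:] * g) + smult (of_nat (Suc n)) ([:- a, 1:] * g)
    + [:- a, 1:] * [:- c, 1:] * pderiv g"
  have pk: "pderiv p = [:- a, 1:] ^ m * [:- c, 1:] ^ n * k"
    unfolding q(1) g(1) pderiv_mult pderiv_power_Suc k_def
    by (simp add: pderiv_pCons algebra_simps del: mult_pCons_left mult_pCons_right of_nat_Suc)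
  have "poly k a = of_nat (Suc m) * ((a - c) * poly g a)" "poly k c = of_nat (Suc n) * ((c - a) * poly g c)"
    unfolding k_def by (simp_all del: of_nat_Suc mult_pCons_left mult_pCons_right)
  then have "poly k a * poly k c = (of_nat (Suc m) * of_nat (Suc n)) * (((a - c) * (c - a)) * (poly g a * poly g c))"
    by (simp only: ac_simps)
  moreover have "(a - c) * (c - a) < 0" "0 < (of_nat (Suc m) * of_nat (Suc n) :: 'a)"
    using ac by (auto simp: mult_less_0_iff simp del: of_nat_Suc)
  moreover have "0 < poly g a * poly g c"
    using sg ga g(2) by (auto simp: sgn_if zero_less_mult_iff split: if_splits)
  ultimately have "poly k a * poly k c < 0"
    by (metis mult_less_0_iff mult_pos_neg)
  then obtain x where "a < x" "x < c" "poly k x = 0"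
    using rcf_ivt[OF ac(1)] by blast
  then show ?thesis
    using c(2) pk by (intro exI[of _ x]) auto
qed

lemma rcf_mvt:
  fixes p :: "'a::real_closed_field poly"
  assumes "a < b"
  shows "\<exists>x. a < x \<and> x < b \<and> poly p b - poly p a = (b - a) * poly (pderiv p) x"
proof -
  define s where "s = (poly p b - poly p a) / (b - a)"
  define q where "q = p - [:poly p a - s * a, s:]"
  have s: "s * (b - a) = poly p b - poly p a"
    using assms by (simp add: s_def)
  then have "poly q a = 0" "poly q b = 0"
    by (simp_all add: q_def algebra_simps)
  then obtain x where "a < x" "x < b" "poly (pderiv q) x = 0"
    using rcf_rolle[OF assms] by blast
  then show ?thesis
    using s by (intro exI[of _ x]) (auto simp: q_def pderiv_diff pderiv_pCons algebra_simps)
qed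

lemma poly_sign_at_top:
  fixes p :: "'a::linordered_field poly"
  assumes "p \<noteq> 0"
  shows "\<exists>M. \<forall>x\<ge>M. sgn (poly p x) = sgn (lead_coeff p)"
proof -
  \<comment> \<open>A positive lower bound \<open>c\<close> is carried along, because in the step x
    q(x) has to outweigh the new constant coefficient; the threshold (|a| + c) / c achieves
    this.\<close>
  have "\<exists>M c. 0 < c \<and> (\<forall>x\<ge>M. c \<le> sgn (lead_coeff p) * poly p x)"
    using assms
  proof (induction p)
    case (pCons a q)
    show ?case
    proof (cases "q = 0")
      case True
      then show ?thesis
        using pCons.hyps by (intro exI[of _ 0] exI[of _ "\<bar>a\<bar>"]) (auto simp: abs_if sgn_if)
    next
      case False
      then obtain M c where M: "0 < c" "\<And>x. M \<le> x \<Longrightarrow> c \<le> sgn (lead_coeff q) * poly q x"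
        using pCons.IH by blast
      have "c \<le> sgn (lead_coeff (pCons a q)) * poly (pCons a q) x"
        if x: "max (max M 0) ((\<bar>a\<bar> + c) / c) \<le> x" for x
      proof -
        have "(\<bar>a\<bar> + c) / c \<le> x" "0 \<le> x"
          using x by auto
        then have "\<bar>a\<bar> + c \<le> x * c"
          using M(1) by (simp add: pos_divide_le_eq)
        also have "\<dots> \<le> x * (sgn (lead_coeff q) * poly q x)"
          using M(2)[of x] x \<open>0 \<le> x\<close> by (intro mult_left_mono) auto
        finally have "\<bar>a\<bar> + c \<le> sgn (lead_coeff q) * (x * poly q x)"
          by (simp add: ac_simps)
        moreover have "- \<bar>a\<bar> \<le> sgn (lead_coeff q) * a"
          by (auto simp: sgn_if)
        ultimately show ?thesis
          using False by (simp add: distrib_left)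
      qed
      then show ?thesis
        using M(1) by blast
    qed
  qed simp
  then obtain M c where "0 < c" "\<And>x. M \<le> x \<Longrightarrow> c \<le> sgn (lead_coeff p) * poly p x"
    by blast
  then have pos: "0 < sgn (lead_coeff p) * poly p x" if "M \<le> x" for x
    using that less_le_trans by blast
  show ?thesis
  proof (intro exI[of _ M] allI impI)
    fix x assume "M \<le> x"
    then show "sgn (poly p x) = sgn (lead_coeff p)"
      using pos[of x] by (auto simp: zero_less_mult_iff sgn_if split: if_splits)
  qed
qed

lemma poly_sign_at_bot:
  fixes p :: "'a::linordered_field poly"
  assumes "p \<noteq> 0"
  shows "\<exists>M. \<forall>x\<ge>M. sgn (poly p (- x)) = sgn ((- 1) ^ degree p * lead_coeff p)"
proof -
  let ?q = "pcompose p [:0, - 1:]"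
  have "?q \<noteq> 0"
    using assms by (simp add: pcompose_eq_0_iff)
  moreover have "lead_coeff ?q = (- 1) ^ degree p * lead_coeff p"
    by (subst lead_coeff_comp) auto
  ultimately show ?thesis
    using poly_sign_at_top[of ?q] by (simp add: poly_pcompose)
qed

text \<open>Outside the window [-M, M] all signs are those of the leading terms, so the ends of the
  window can play the role of the two infinities.\<close>

lemma sentinel_exists:
  fixes P :: "'i \<Rightarrow> 'a::linordered_field poly"
  assumes "finite B" "\<And>i. i \<in> B \<Longrightarrow> P i \<noteq> 0"
  shows "\<exists>M>0. \<forall>i\<in>B. \<forall>x\<ge>M. sgn (poly (P i) x) = sgn (lead_coeff (P i))
    \<and> sgn (poly (P i) (- x)) = sgn ((- 1) ^ degree (P i) * lead_coeff (P i))"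
  using assms
proof (induction B rule: finite_induct)
  case empty
  show ?case
    by (intro exI[of _ 1]) auto
next
  case (insert i B)
  then obtain M where M: "0 < M" "\<forall>i\<in>B. \<forall>x\<ge>M. sgn (poly (P i) x) = sgn (lead_coeff (P i))
    \<and> sgn (poly (P i) (- x)) = sgn ((- 1) ^ degree (P i) * lead_coeff (P i))"
    by blast
  obtain M1 where M1: "\<forall>x\<ge>M1. sgn (poly (P i) x) = sgn (lead_coeff (P i))"
    using poly_sign_at_top[of "P i"] insert.prems by blast
  obtain M2 where M2: "\<forall>x\<ge>M2. sgn (poly (P i) (- x)) = sgn ((- 1) ^ degree (P i) * lead_coeff (P i))"
    using poly_sign_at_bot[of "P i"] insert.prems by blast
  show ?case
    using M M1 M2 by (intro exI[of _ "max M (max M1 M2)"]) auto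
qed

section \<open>Sign diagrams\<close>

text \<open>The two arguments live in different fields, so their values of \<open>sgn\<close> cannot
  be equated.\<close>

definition same_sign :: "'a::linordered_field \<Rightarrow> 'b::linordered_field \<Rightarrow> bool" where
  "same_sign a b \<longleftrightarrow> (0 < a \<longleftrightarrow> 0 < b) \<and> (a < 0 \<longleftrightarrow> b < 0)"

lemma same_sign_simps [simp]: "same_sign 0 0" "same_sign 1 1" "same_sign a 0 \<longleftrightarrow> a = 0" "same_sign 0 b \<longleftrightarrow> b = 0"
  by (auto simp: same_sign_def)

lemma same_sign_sym: "same_sign a b \<Longrightarrow> same_sign b a"
  by (auto simp: same_sign_def)

lemma same_sign_eq_0: "same_sign a b \<Longrightarrow> a = 0 \<longleftrightarrow> b = 0"
  unfolding same_sign_def by (metis linorder_neqE_linordered_idom less_irrefl)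

lemma same_sign_sgn: "same_sign a b \<Longrightarrow> sgn a = sgn a' \<Longrightarrow> sgn b = sgn b' \<Longrightarrow> same_sign a' b'"
  by (auto simp: same_sign_def sgn_if split: if_splits)

lemma same_sign_mult: "same_sign a b \<Longrightarrow> same_sign c d \<Longrightarrow> same_sign (a * c) (b * d)"
  unfolding same_sign_def zero_less_mult_iff mult_less_0_iff by blast

lemma same_sign_power: "same_sign a b \<Longrightarrow> same_sign (a ^ n) (b ^ n)"
  by (induction n) (auto intro: same_sign_mult)

lemma same_sign_cancel:
  assumes "same_sign (a * c) (b * d)" "same_sign a b" "a \<noteq> 0" shows "same_sign c d"
proof -
  have "a < 0 \<and> b < 0 \<or> 0 < a \<and> 0 < b"
    using assms(2,3) by (auto simp: same_sign_def)
  then show ?thesis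
    using assms(1) by (auto simp: same_sign_def zero_less_mult_iff mult_less_0_iff)
qed

lemma same_sign_uminus: "same_sign a b \<Longrightarrow> same_sign (- a) (- b)"
  by (auto simp: same_sign_def)

definition matched :: "('r::linorder \<times> 's::linorder) set \<Rightarrow> 'r \<Rightarrow> 's \<Rightarrow> bool" where
  "matched Z x y \<longleftrightarrow> (\<forall>(z, w)\<in>Z. (x < z \<longleftrightarrow> y < w) \<and> (z < x \<longleftrightarrow> w < y))"

lemma matchedD:
  assumes "matched Z x y" "(z, w) \<in> Z"
  shows "x < z \<longleftrightarrow> y < w" "z < x \<longleftrightarrow> w < y"
  using assms by (auto simp: matched_def)

lemma matched_converse: "matched (Z\<inverse>) y x \<longleftrightarrow> matched Z x y"
  unfolding matched_def by fastforce

text \<open>Two families of polynomials over two real closed fields have the same sign diagram: the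
  roots in the windows \<open>[-M, M]\<close> and \<open>[-N, N]\<close> are paired off monotonically by \<open>Z\<close>, and the
  signs agree at any two points in the same position relative to \<open>Z\<close>.\<close>

definition diagram :: "'r::linordered_field \<Rightarrow> 's::linordered_field \<Rightarrow> 'i set \<Rightarrow> ('i \<Rightarrow> 'r poly) \<Rightarrow> ('i \<Rightarrow> 's poly)
    \<Rightarrow> ('r \<times> 's) set \<Rightarrow> bool" where
  "diagram M N B P Q Z \<longleftrightarrow> finite Z \<and> 0 < M \<and> 0 < N \<and> (- M, - N) \<in> Z \<and> (M, N) \<in> Z \<and>
     (\<forall>(z, w)\<in>Z. matched Z z w \<and> - M \<le> z \<and> z \<le> M \<and> - N \<le> w \<and> w \<le> N \<and>
        ((z, w) = (- M, - N) \<or> (z, w) = (M, N) \<or> (\<exists>i\<in>B. poly (P i) z = 0 \<and> poly (Q i) w = 0))) \<and>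
     (\<forall>i\<in>B. \<forall>x. - M \<le> x \<longrightarrow> x \<le> M \<longrightarrow> poly (P i) x = 0 \<longrightarrow> (\<exists>y. (x, y) \<in> Z)) \<and>
     (\<forall>i\<in>B. \<forall>y. - N \<le> y \<longrightarrow> y \<le> N \<longrightarrow> poly (Q i) y = 0 \<longrightarrow> (\<exists>x. (x, y) \<in> Z)) \<and>
     (\<forall>i\<in>B. \<forall>x y. - M \<le> x \<longrightarrow> x \<le> M \<longrightarrow> - N \<le> y \<longrightarrow> y \<le> N \<longrightarrow> matched Z x y \<longrightarrow>
        same_sign (poly (P i) x) (poly (Q i) y))"

lemma diagramD:
  assumes "diagram M N B P Q Z"
  shows "finite Z" "0 < M" "0 < N" "(- M, - N) \<in> Z" "(M, N) \<in> Z"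
    "(z, w) \<in> Z \<Longrightarrow> matched Z z w"
    "(z, w) \<in> Z \<Longrightarrow> - M \<le> z \<and> z \<le> M \<and> - N \<le> w \<and> w \<le> N"
    "(z, w) \<in> Z \<Longrightarrow> (z, w) = (- M, - N) \<or> (z, w) = (M, N) \<or> (\<exists>i\<in>B. poly (P i) z = 0 \<and> poly (Q i) w = 0)"
    "i \<in> B \<Longrightarrow> - M \<le> x \<Longrightarrow> x \<le> M \<Longrightarrow> poly (P i) x = 0 \<Longrightarrow> \<exists>y. (x, y) \<in> Z"
    "i \<in> B \<Longrightarrow> - N \<le> y \<Longrightarrow> y \<le> N \<Longrightarrow> poly (Q i) y = 0 \<Longrightarrow> \<exists>x. (x, y) \<in> Z"
    "i \<in> B \<Longrightarrow> - M \<le> x \<Longrightarrow> x \<le> M \<Longrightarrow> - N \<le> y \<Longrightarrow> y \<le> N \<Longrightarrow> matched Z x y \<Longrightarrow>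
        same_sign (poly (P i) x) (poly (Q i) y)"
proof -
  note d = assms[unfolded diagram_def]
  show "finite Z" "0 < M" "0 < N" "(- M, - N) \<in> Z" "(M, N) \<in> Z"
    using d by simp_all
  show "(z, w) \<in> Z \<Longrightarrow> matched Z z w"
    "(z, w) \<in> Z \<Longrightarrow> - M \<le> z \<and> z \<le> M \<and> - N \<le> w \<and> w \<le> N"
    "(z, w) \<in> Z \<Longrightarrow> (z, w) = (- M, - N) \<or> (z, w) = (M, N) \<or> (\<exists>i\<in>B. poly (P i) z = 0 \<and> poly (Q i) w = 0)"
    using d by auto
  show "i \<in> B \<Longrightarrow> - M \<le> x \<Longrightarrow> x \<le> M \<Longrightarrow> poly (P i) x = 0 \<Longrightarrow> \<exists>y. (x, y) \<in> Z"
    "i \<in> B \<Longrightarrow> - N \<le> y \<Longrightarrow> y \<le> N \<Longrightarrow> poly (Q i) y = 0 \<Longrightarrow> \<exists>x. (x, y) \<in> Z"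
    "i \<in> B \<Longrightarrow> - M \<le> x \<Longrightarrow> x \<le> M \<Longrightarrow> - N \<le> y \<Longrightarrow> y \<le> N \<Longrightarrow> matched Z x y \<Longrightarrow>
        same_sign (poly (P i) x) (poly (Q i) y)"
    using d by simp_all
qed

lemma diagram_converse:
  assumes "diagram M N B P Q Z" shows "diagram N M B Q P (Z\<inverse>)"
  unfolding diagram_def
proof (intro conjI ballI)
  note DD = diagramD[OF assms]
  show "finite (Z\<inverse>)" "0 < M" "0 < N" "(- N, - M) \<in> Z\<inverse>" "(N, M) \<in> Z\<inverse>"
    using DD(1-5) by simp_all
  fix wz assume "wz \<in> Z\<inverse>"
  then obtain w z where wz: "wz = (w, z)" "(z, w) \<in> Z"
    by auto
  show "case wz of (z, w) \<Rightarrow> matched (Z\<inverse>) z w \<and> - N \<le> z \<and> z \<le> N \<and> - M \<le> w \<and> w \<le> M \<and>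
      ((z, w) = (- N, - M) \<or> (z, w) = (N, M) \<or> (\<exists>i\<in>B. poly (Q i) z = 0 \<and> poly (P i) w = 0))"
    using DD(6,7,8)[OF wz(2)] by (auto simp: wz(1) matched_converse)
next
  note DD = diagramD[OF assms]
  fix i assume i: "i \<in> B"
  show "\<forall>y. - N \<le> y \<longrightarrow> y \<le> N \<longrightarrow> poly (Q i) y = 0 \<longrightarrow> (\<exists>x. (y, x) \<in> Z\<inverse>)"
    using DD(10)[OF i] by simp
  show "\<forall>x. - M \<le> x \<longrightarrow> x \<le> M \<longrightarrow> poly (P i) x = 0 \<longrightarrow> (\<exists>y. (y, x) \<in> Z\<inverse>)"
    using DD(9)[OF i] by simp
  show "\<forall>y x. - N \<le> y \<longrightarrow> y \<le> N \<longrightarrow> - M \<le> x \<longrightarrow> x \<le> M \<longrightarrow> matched (Z\<inverse>) y x \<longrightarrow>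
      same_sign (poly (Q i) y) (poly (P i) x)"
    using DD(11)[OF i] by (simp add: matched_converse same_sign_sym)
qed

lemma neighbours:
  fixes Z :: "('r::linordered_field \<times> 's::linordered_field) set"
  assumes "finite Z" "(a, a') \<in> Z" "a < x" "(b, b') \<in> Z" "x < b" "\<And>w. (x, w) \<notin> Z"
  shows "\<exists>l l' u u'. (l, l') \<in> Z \<and> (u, u') \<in> Z \<and> l < x \<and> x < u \<and> (\<forall>(z, w)\<in>Z. z \<le> l \<or> u \<le> z)"
proof -
  define L where "L = {z \<in> fst ` Z. z < x}"
  define U where "U = {z \<in> fst ` Z. x < z}"
  have fin: "finite L" "finite U" and ne: "L \<noteq> {}" "U \<noteq> {}"
    using assms unfolding L_def U_def by force+
  have "Max L \<in> L" "Min U \<in> U"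
    using fin ne by auto
  then obtain l' u' where "(Max L, l') \<in> Z" "(Min U, u') \<in> Z" "Max L < x" "x < Min U"
    by (auto simp: L_def U_def)
  moreover have "z \<le> Max L \<or> Min U \<le> z" if z: "(z, w) \<in> Z" for z w
  proof -
    have "z \<noteq> x" "z \<in> fst ` Z"
      using z assms(6) by force+
    then have "z \<in> L \<or> z \<in> U"
      by (auto simp: L_def U_def)
    then show ?thesis
      using fin Max_ge[of L z] Min_le[of U z] by blast
  qed
  ultimately show ?thesis
    by blast
qed

text \<open>The sign just right of \<open>l\<close> is inherited from the value at \<open>l\<close>;
  if that value is 0, it comes from the derivative by the mean value theorem.\<close>

lemma sign_on_interval:
  fixes p :: "'a::real_closed_field poly"
  assumes "l < x" and p: "\<And>\<xi>. l < \<xi> \<Longrightarrow> \<xi> \<le> x \<Longrightarrow> poly p \<xi> \<noteq> 0"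
    and p': "\<And>\<xi>. l < \<xi> \<Longrightarrow> \<xi> \<le> x \<Longrightarrow> poly (pderiv p) \<xi> \<noteq> 0"
  shows "poly p l \<noteq> 0 \<Longrightarrow> sgn (poly p x) = sgn (poly p l)"
    and "poly p l = 0 \<Longrightarrow> sgn (poly p x) = sgn (poly (pderiv p) x)"
proof -
  assume "poly p l \<noteq> 0"
  then have "poly p \<xi> \<noteq> 0" if "l \<le> \<xi>" "\<xi> \<le> x" for \<xi>
    using p[of \<xi>] that by (cases "\<xi> = l") auto
  then show "sgn (poly p x) = sgn (poly p l)"
    using rcf_sgn_eq[of l x p] assms(1) by simp
next
  assume "poly p l = 0"
  then obtain \<xi> where \<xi>: "l < \<xi>" "\<xi> < x" "poly p x = (x - l) * poly (pderiv p) \<xi>"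
    using rcf_mvt[OF assms(1), of p] by auto
  have "sgn (poly (pderiv p) \<xi>) = sgn (poly (pderiv p) x)"
    using \<xi> p' by (intro rcf_sgn_eq) auto
  then show "sgn (poly p x) = sgn (poly (pderiv p) x)"
    using \<xi> assms(1) by (simp add: sgn_mult)
qed

lemma matched_between:
  assumes D: "diagram M N B P Q Z" and "(l, l') \<in> Z" "(u, u') \<in> Z" "l < x" "x < u" "\<forall>(z, w)\<in>Z. z \<le> l \<or> u \<le> z" "l' < y" "y < u'"
  shows "matched Z x y"
  unfolding matched_def
proof (intro ballI, clarify)
  fix z w assume zw: "(z, w) \<in> Z"
  have "(l < z \<longleftrightarrow> l' < w)" "(z < u \<longleftrightarrow> w < u')"
    using matchedD[OF diagramD(6)[OF D zw]] assms(2,3) by blast+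
  then show "(x < z \<longleftrightarrow> y < w) \<and> (z < x \<longleftrightarrow> w < y)"
    using zw assms by (auto simp: not_less[symmetric])
qed

context
  fixes M :: "'r::real_closed_field" and N :: "'s::real_closed_field" and B :: "'i set" and P Q Z j d
  assumes D: "diagram M N B P Q Z" and d: "d \<in> B" "P d = pderiv (P j)" "Q d = pderiv (Q j)"
    and S: "\<And>z w. (z, w) \<in> Z \<Longrightarrow> same_sign (poly (P j) z) (poly (Q j) w)"
begin

text \<open>By Rolle, two roots of \<open>P j\<close> are separated by a root of its derivative.
  That root is a point of \<open>Z\<close>, and its partner separates \<open>y\<close> from
  \<open>y'\<close>.\<close>

lemma new_pairs_less:
  assumes "matched Z x y" "matched Z x' y'" "poly (P j) x = 0" "poly (P j) x' = 0"
    "- M \<le> x" "x' \<le> M" "x < x'"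
  shows "y < y'"
proof -
  obtain \<xi> where \<xi>: "x < \<xi>" "\<xi> < x'" "poly (P d) \<xi> = 0"
    using rcf_rolle[OF assms(7,3,4)] d by auto
  then obtain \<omega> where "(\<xi>, \<omega>) \<in> Z"
    using diagramD(9)[OF D d(1), of \<xi>] assms by auto
  then show ?thesis
    using matchedD[OF assms(1)] matchedD[OF assms(2)] \<xi> less_trans by blast
qed

text \<open>Between neighbouring points of \<open>Z\<close> the derivative has no root, so a root of
  \<open>P j\<close> strictly inside forces opposite signs at the two neighbours. \<open>S\<close>
  carries these signs to the other field, where the intermediate value property supplies the
  partner.\<close>

lemma new_root_matched:
  assumes "- M \<le> x" "x \<le> M" "poly (P j) x = 0"
  shows "\<exists>y. - N \<le> y \<and> y \<le> N \<and> matched Z x y \<and> poly (Q j) y = 0"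
proof (cases "\<exists>w. (x, w) \<in> Z")
  case True
  then obtain w where "(x, w) \<in> Z" ..
  then show ?thesis
    using diagramD(6,7)[OF D, of x w] S[of x w] assms(3) by auto
next
  case False
  then have "x \<noteq> - M" "x \<noteq> M"
    using diagramD(4,5)[OF D] by auto
  then have "- M < x" "x < M"
    using assms by auto
  then obtain l l' u u' where lu: "(l, l') \<in> Z" "(u, u') \<in> Z" "l < x" "x < u"
    and gap: "\<forall>(z, w)\<in>Z. z \<le> l \<or> u \<le> z"
    using neighbours[OF diagramD(1)[OF D] diagramD(4)[OF D] _ diagramD(5)[OF D], of x] False by blast
  have rng: "- M \<le> l" "u \<le> M" "- N \<le> l'" "u' \<le> N"
    using diagramD(7)[OF D] lu by blast+
  have no_crit: "poly (pderiv (P j)) \<xi> \<noteq> 0" if "l < \<xi>" "\<xi> < u" for \<xi>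
    using diagramD(9)[OF D d(1), of \<xi>] gap that rng d by fastforce
  have "poly (P j) l \<noteq> 0" "poly (P j) u \<noteq> 0"
    using rcf_rolle[of l x "P j"] rcf_rolle[of x u "P j"] no_crit lu assms(3) by force+
  moreover have "\<not> 0 < poly (P j) l * poly (P j) u"
  proof
    assume pos: "0 < poly (P j) l * poly (P j) u"
    obtain \<xi> where \<xi>: "l < \<xi>" "\<xi> < x" "0 - poly (P j) l = (x - l) * poly (pderiv (P j)) \<xi>"
      using rcf_mvt[OF lu(3), of "P j"] assms(3) by auto
    obtain \<eta> where \<eta>: "x < \<eta>" "\<eta> < u" "poly (P j) u - 0 = (u - x) * poly (pderiv (P j)) \<eta>"
      using rcf_mvt[OF lu(4), of "P j"] assms(3) by auto
    have "sgn (poly (pderiv (P j)) \<xi>) = sgn (poly (pderiv (P j)) \<eta>)"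
      using \<xi> \<eta> no_crit by (intro rcf_sgn_eq) auto
    moreover have "sgn (- poly (P j) l) = sgn (poly (pderiv (P j)) \<xi>)" "sgn (poly (P j) u) = sgn (poly (pderiv (P j)) \<eta>)"
      using \<xi> \<eta> lu by (simp_all add: sgn_mult)
    ultimately have "sgn (- poly (P j) l) = sgn (poly (P j) u)"
      by simp
    then show False
      using pos by (auto simp: sgn_if zero_less_mult_iff split: if_splits)
  qed
  ultimately have "poly (P j) l * poly (P j) u < 0"
    by (metis linorder_neqE_linordered_idom mult_eq_0_iff)
  then have "poly (Q j) l' * poly (Q j) u' < 0"
    using same_sign_mult[OF S[OF lu(1)] S[OF lu(2)]] by (simp add: same_sign_def)
  moreover have "l' < u'"
    using matchedD[OF diagramD(6)[OF D lu(1)] lu(2)] lu by auto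
  ultimately obtain y where y: "l' < y" "y < u'" "poly (Q j) y = 0"
    using rcf_ivt by blast
  then show ?thesis
    using matched_between[OF D lu gap y(1,2)] rng by (intro exI[of _ y]) auto
qed

end

text \<open>The inductive step: a polynomial can join once its derivative belongs to the diagram and
  its signs at the old points agree on both sides.\<close>

lemma diagram_insert:
  fixes M :: "'r::real_closed_field" and N :: "'s::real_closed_field"
  assumes D: "diagram M N B P Q Z" and d: "d \<in> B" "P d = pderiv (P j)" "Q d = pderiv (Q j)"
    and S: "\<And>z w. (z, w) \<in> Z \<Longrightarrow> same_sign (poly (P j) z) (poly (Q j) w)"
    and ne: "P j \<noteq> 0" "Q j \<noteq> 0"
  shows "\<exists>Z'. diagram M N (insert j B) P Q Z'"
proof -
  note DD = diagramD[OF D]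
  note D' = diagram_converse[OF D]
  have S': "same_sign (poly (Q j) w) (poly (P j) z)" if "(w, z) \<in> Z\<inverse>" for z w
    using S that by (auto intro: same_sign_sym)
  \<comment> \<open>Position relative to the old \<open>Z\<close> already determines the pairing,
    since distinct new roots are separated by old points. Monotonicity and existence of partners are
    proved once and applied to the converse diagram for the other direction.\<close>
  define Y where "Y = {(x, y). - M \<le> x \<and> x \<le> M \<and> - N \<le> y \<and> y \<le> N \<and> matched Z x y
    \<and> poly (P j) x = 0 \<and> poly (Q j) y = 0}"
  define Z' where "Z' = Z \<union> Y"
  have ZZ': "Z \<subseteq> Z'" and YZ': "Y \<subseteq> Z'"
    by (auto simp: Z'_def)
  have matchedZ: "matched Z x y" if "matched Z' x y" for x y
    using that ZZ' by (auto simp: matched_def)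
  have "Y \<subseteq> {x. poly (P j) x = 0} \<times> {y. poly (Q j) y = 0}"
    by (auto simp: Y_def)
  then have "finite Y"
    using poly_roots_finite[OF ne(1)] poly_roots_finite[OF ne(2)] finite_subset by blast
  then have fin: "finite Z'"
    using DD(1) by (simp add: Z'_def)
  have rng: "- M \<le> z \<and> z \<le> M \<and> - N \<le> w \<and> w \<le> N" if "(z, w) \<in> Z'" for z w
    using that DD(7) by (auto simp: Z'_def Y_def)
  have mZ: "matched Z z w" if "(z, w) \<in> Z'" for z w
    using that DD(6) by (auto simp: Z'_def Y_def)
  have mono: "matched Z' z w" if zw: "(z, w) \<in> Z'" for z w
    unfolding matched_def
  proof (intro ballI, clarify)
    fix z' w' assume zw': "(z', w') \<in> Z'"
    show "(z < z' \<longleftrightarrow> w < w') \<and> (z' < z \<longleftrightarrow> w' < w)"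
    proof (cases "(z, w) \<in> Z \<or> (z', w') \<in> Z")
      case True
      then show ?thesis
        using matchedD[OF mZ[OF zw], of z' w'] matchedD[OF mZ[OF zw'], of z w] by blast
    next
      case False
      then have Y: "(z, w) \<in> Y" "(z', w') \<in> Y"
        using zw zw' by (auto simp: Z'_def)
      have *: "a < a' \<longleftrightarrow> b < b'" if "(a, b) \<in> Y" "(a', b') \<in> Y" for a b a' b'
        using that new_pairs_less[OF D d S, of a b a' b'] new_pairs_less[OF D' d(1,3,2) S', of b a b' a']
        by (auto simp: Y_def matched_converse)
      show ?thesis
        using *[OF Y] *[OF Y(2,1)] by blast
    qed
  qed
  have rootP: "\<exists>y. (x, y) \<in> Z'" if "- M \<le> x" "x \<le> M" "poly (P j) x = 0" for x
    using new_root_matched[OF D d S that] that by (auto simp: Z'_def Y_def)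
  have rootQ: "\<exists>x. (x, y) \<in> Z'" if "- N \<le> y" "y \<le> N" "poly (Q j) y = 0" for y
    using new_root_matched[OF D' d(1,3,2) S' that] that by (auto simp: Z'_def Y_def matched_converse)
  have S2: "same_sign (poly (P j) z) (poly (Q j) w)" if "(z, w) \<in> Z'" for z w
    using that S by (auto simp: Z'_def Y_def)
  \<comment> \<open>The sign off the points of \<open>Z'\<close> is read off at the nearest point to
    the left: from the value there or, if it vanishes, from the derivative, whose signs the old
    diagram controls.\<close>
  have signs: "same_sign (poly (P j) x) (poly (Q j) y)"
    if xy: "- M \<le> x" "x \<le> M" "- N \<le> y" "y \<le> N" "matched Z' x y" for x y
  proof (cases "\<exists>w. (x, w) \<in> Z'")
    case True
    then obtain w where w: "(x, w) \<in> Z'" ..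
    then have "y = w"
      using matchedD[OF xy(5) w] by auto
    then show ?thesis
      using S2 w by blast
  next
    case False
    then have "x \<noteq> - M" "x \<noteq> M"
      using DD(4,5) ZZ' by auto
    then have "- M < x" "x < M"
      using xy by auto
    then obtain l l' u u' where lu: "(l, l') \<in> Z'" "(u, u') \<in> Z'" "l < x" "x < u"
      and gap: "\<forall>(z, w)\<in>Z'. z \<le> l \<or> u \<le> z"
      using neighbours[OF fin, of "- M" "- N" x M N] DD(4,5) ZZ' False by blast
    have ly: "l' < y"
      using matchedD[OF xy(5) lu(1)] lu by blast
    have nP: "(\<xi>, \<omega>) \<notin> Z'" if "l < \<xi>" "\<xi> \<le> x" for \<xi> \<omega>
      using gap lu that by force
    have nQ: "(\<xi>, \<omega>) \<notin> Z'" if "l' < \<omega>" "\<omega> \<le> y" for \<xi> \<omega>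
    proof
      assume z: "(\<xi>, \<omega>) \<in> Z'"
      have "l < \<xi>"
        using matchedD[OF mono[OF z] lu(1)] that by blast
      moreover have "\<xi> \<le> x"
        using matchedD[OF xy(5) z] that by auto
      ultimately show False
        using nP z by blast
    qed
    have rl: "- M \<le> l" "- N \<le> l'"
      using rng[OF lu(1)] by auto
    have 1: "poly (P j) \<xi> \<noteq> 0" "poly (pderiv (P j)) \<xi> \<noteq> 0" if "l < \<xi>" "\<xi> \<le> x" for \<xi>
      using rootP[of \<xi>] DD(9)[OF d(1), of \<xi>] nP[OF that] that rl xy d ZZ' by force+
    have 2: "poly (Q j) \<xi> \<noteq> 0" "poly (pderiv (Q j)) \<xi> \<noteq> 0" if "l' < \<xi>" "\<xi> \<le> y" for \<xi>
      using rootQ[of \<xi>] DD(10)[OF d(1), of \<xi>] nQ[OF that] that rl xy d ZZ' by force+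
    have s1: "poly (P j) l \<noteq> 0 \<Longrightarrow> sgn (poly (P j) x) = sgn (poly (P j) l)"
      "poly (P j) l = 0 \<Longrightarrow> sgn (poly (P j) x) = sgn (poly (pderiv (P j)) x)"
      using sign_on_interval[OF lu(3), of "P j"] 1 by blast+
    have s2: "poly (Q j) l' \<noteq> 0 \<Longrightarrow> sgn (poly (Q j) y) = sgn (poly (Q j) l')"
      "poly (Q j) l' = 0 \<Longrightarrow> sgn (poly (Q j) y) = sgn (poly (pderiv (Q j)) y)"
      using sign_on_interval[OF ly, of "Q j"] 2 by blast+
    show ?thesis
    proof (cases "poly (P j) l = 0")
      case True
      then have "poly (Q j) l' = 0"
        using S2[OF lu(1)] by simp
      have "same_sign (poly (P d) x) (poly (Q d) y)"
        using DD(11)[OF d(1) xy(1-4) matchedZ[OF xy(5)]] .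
      then show ?thesis
        using s1(2)[OF True] s2(2)[OF \<open>poly (Q j) l' = 0\<close>] d by (auto intro: same_sign_sgn)
    next
      case False
      then have "poly (Q j) l' \<noteq> 0"
        using same_sign_eq_0[OF S2[OF lu(1)]] by simp
      then show ?thesis
        using s1(1)[OF False] s2(1) S2[OF lu(1)] by (auto intro: same_sign_sgn)
    qed
  qed
  have "diagram M N (insert j B) P Q Z'"
    unfolding diagram_def
  proof (intro conjI ballI)
    show "finite Z'" "0 < M" "0 < N" "(- M, - N) \<in> Z'" "(M, N) \<in> Z'"
      using fin DD ZZ' by auto
    fix i assume i: "i \<in> insert j B"
    show "\<forall>x. - M \<le> x \<longrightarrow> x \<le> M \<longrightarrow> poly (P i) x = 0 \<longrightarrow> (\<exists>y. (x, y) \<in> Z')"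
      using i rootP DD(9) ZZ' by (cases "i = j") blast+
    show "\<forall>y. - N \<le> y \<longrightarrow> y \<le> N \<longrightarrow> poly (Q i) y = 0 \<longrightarrow> (\<exists>x. (x, y) \<in> Z')"
      using i rootQ DD(10) ZZ' by (cases "i = j") blast+
    show "\<forall>x y. - M \<le> x \<longrightarrow> x \<le> M \<longrightarrow> - N \<le> y \<longrightarrow> y \<le> N \<longrightarrow> matched Z' x y \<longrightarrow>
        same_sign (poly (P i) x) (poly (Q i) y)"
      using i signs DD(11) matchedZ by (cases "i = j") blast+
  next
    fix zw assume "zw \<in> Z'"
    moreover obtain z w where eq: "zw = (z, w)" by fastforce
    ultimately have zw: "(z, w) \<in> Z'" by simp
    have "(z, w) = (- M, - N) \<or> (z, w) = (M, N) \<or> (\<exists>i\<in>insert j B. poly (P i) z = 0 \<and> poly (Q i) w = 0)"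
    proof (cases "(z, w) \<in> Z")
      case True
      then show ?thesis
        using DD(8) by blast
    next
      case False
      then have "poly (P j) z = 0 \<and> poly (Q j) w = 0"
        using zw by (simp add: Z'_def Y_def)
      then show ?thesis
        by blast
    qed
    then show "case zw of (z, w) \<Rightarrow> matched Z' z w \<and> - M \<le> z \<and> z \<le> M \<and> - N \<le> w \<and> w \<le> N \<and>
        ((z, w) = (- M, - N) \<or> (z, w) = (M, N) \<or> (\<exists>i\<in>insert j B. poly (P i) z = 0 \<and> poly (Q i) w = 0))"
      using mono[OF zw] rng[OF zw] unfolding eq prod.case by blast
  qed
  then show ?thesis ..
qed

section \<open>Families closed under tails, derivatives and pseudo-division\<close>

definition poly_tail :: "'a::comm_ring_1 poly \<Rightarrow> 'a poly" where
  "poly_tail f = f - monom (lead_coeff f) (degree f)"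

text \<open>\<open>pderiv\<close> is only available over rings without zero divisors.\<close>

definition formal_deriv :: "'a::comm_ring_1 poly \<Rightarrow> 'a poly" where
  "formal_deriv f = (\<Sum>n<degree f. monom (of_nat (Suc n) * coeff f (Suc n)) n)"

lemma coeff_poly_tail: "coeff (poly_tail f) n = (if n = degree f then 0 else coeff f n)"
  by (auto simp: poly_tail_def)

lemma coeff_formal_deriv: "coeff (formal_deriv f) n = of_nat (Suc n) * coeff f (Suc n)"
proof -
  have "coeff (formal_deriv f) n = (\<Sum>i<degree f. if i = n then of_nat (Suc i) * coeff f (Suc i) else 0)"
    by (simp add: formal_deriv_def coeff_sum del: of_nat_Suc)
  also have "\<dots> = (if n < degree f then of_nat (Suc n) * coeff f (Suc n) else 0)"
    by (subst sum.delta) auto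
  finally show ?thesis
    by (auto simp: coeff_eq_0 not_less)
qed

lemma degree_poly_tail: "0 < degree f \<Longrightarrow> degree (poly_tail f) < degree f"
  using degree_le[of "degree f - 1" "poly_tail f"] by (force simp: coeff_poly_tail coeff_eq_0)

lemma degree_formal_deriv: "0 < degree f \<Longrightarrow> degree (formal_deriv f) < degree f"
  using degree_le[of "degree f - 1" "formal_deriv f"] by (force simp: coeff_formal_deriv coeff_eq_0)

lemma poly_tail_const: "degree f = 0 \<Longrightarrow> poly_tail f = 0"
  by (rule poly_eqI) (simp add: coeff_poly_tail coeff_eq_0)

lemma formal_deriv_const: "degree f = 0 \<Longrightarrow> formal_deriv f = 0"
  by (simp add: formal_deriv_def)

text \<open>The coefficients form a mere ring, later itself a polynomial ring. Division therefore
  costs a power of the leading coefficient of the divisor, a harmless factor because its sign is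
  known.\<close>

definition pseudo_rem :: "'a::comm_ring_1 poly \<Rightarrow> 'a poly \<Rightarrow> 'a poly" where
  "pseudo_rem f g = snd (pseudo_divmod f g)"

lemma degree_pseudo_rem: "0 < degree g \<Longrightarrow> degree (pseudo_rem f g) < degree g"
  using pseudo_divmod(2)[of g f "fst (pseudo_divmod f g)" "pseudo_rem f g"] by (force simp: pseudo_rem_def)

definition division_closed :: "nat \<Rightarrow> 'a::comm_ring_1 poly set \<Rightarrow> bool" where
  "division_closed n F \<longleftrightarrow> 0 \<in> F \<and> (\<forall>f\<in>F. n \<le> degree f \<longrightarrow> poly_tail f \<in> F \<and> formal_deriv f \<in> F)
     \<and> (\<forall>f\<in>F. \<forall>g\<in>F. 0 < degree g \<and> n \<le> degree g \<and> degree g \<le> degree f \<longrightarrow> pseudo_rem f g \<in> F)"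

text \<open>All three operations lower degrees, so closing up from the top degree downwards terminates.\<close>

lemma division_closure:
  fixes F :: "'a::comm_ring_1 poly set"
  assumes "finite F"
  shows "\<exists>F'. finite F' \<and> F \<subseteq> F' \<and> division_closed 0 F'"
proof -
  have step: "\<exists>F'. finite F' \<and> F \<subseteq> F' \<and> division_closed n F'"
    if F: "finite F" "division_closed (Suc n) F" for n and F :: "'a poly set"
  proof -
    define N where "N = poly_tail ` F \<union> formal_deriv ` F \<union> (\<lambda>(f, g). pseudo_rem f g) ` {(f, g) \<in> F \<times> F. 0 < degree g \<and> degree g \<le> degree f}"
    have "finite (F \<union> N)"
      unfolding N_def using F(1) by (auto intro: finite_subset[of _ "F \<times> F"])
    \<comment> \<open>Whatever is new has degree below \<open>n\<close>, so no operation of level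
      \<open>n\<close> applies to it again.\<close>
    moreover have new: "h \<in> F \<or> degree h < n" if h: "h \<in> N" for h
    proof -
      consider (t) f where "f \<in> F" "h = poly_tail f \<or> h = formal_deriv f"
        | (m) f g where "f \<in> F" "g \<in> F" "0 < degree g" "degree g \<le> degree f" "h = pseudo_rem f g"
        using h by (auto simp: N_def)
      then show ?thesis
      proof cases
        case t
        then show ?thesis
          using F(2) degree_poly_tail[of f] degree_formal_deriv[of f] poly_tail_const[of f] formal_deriv_const[of f]
          unfolding division_closed_def by (cases "degree f = 0"; cases "Suc n \<le> degree f") auto
      next
        case m
        then show ?thesis
          using F(2) degree_pseudo_rem[of g f]
          unfolding division_closed_def by (cases "Suc n \<le> degree g") auto
      qed
    qed
    have "division_closed n (F \<union> N)"
      unfolding division_closed_def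
    proof (intro conjI ballI impI)
      show "0 \<in> F \<union> N"
        using F(2) by (simp add: division_closed_def)
      fix f assume f: "f \<in> F \<union> N"
      {
        assume "n \<le> degree f"
        then have "f \<in> F"
          using f new[of f] by auto
        then show "poly_tail f \<in> F \<union> N" "formal_deriv f \<in> F \<union> N"
          by (auto simp: N_def)
      next
        fix g assume g: "g \<in> F \<union> N" and deg: "0 < degree g \<and> n \<le> degree g \<and> degree g \<le> degree f"
        then have "g \<in> F" "f \<in> F"
          using f new[of f] new[of g] by auto
        then show "pseudo_rem f g \<in> F \<union> N"
          using deg by (force simp: N_def)
      }
    qed
    ultimately show ?thesis
      by blast
  qed
  have "\<exists>F'. finite F' \<and> F \<subseteq> F' \<and> division_closed n F'" if "finite F" "division_closed (n + m) F"
    for n m and F :: "'a poly set"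
    using that
  proof (induction m arbitrary: F)
    case (Suc m)
    then obtain F' where "finite F'" "F \<subseteq> F'" "division_closed (n + m) F'"
      using step[of F "n + m"] by auto
    then show ?case
      using Suc.IH[of F'] by blast
  qed auto
  moreover have "division_closed (0 + Suc (Max (degree ` insert 0 F))) (insert 0 F)"
  proof -
    have "degree f \<le> Max (degree ` insert 0 F)" if "f \<in> insert 0 F" for f
      using that assms by (intro Max_ge) auto
    then have *: "\<not> 0 + Suc (Max (degree ` insert 0 F)) \<le> degree f" if "f \<in> insert 0 F" for f
      using that by (simp add: not_less_eq_eq)
    have "division_closed n A" if "0 \<in> A" "\<And>f. f \<in> A \<Longrightarrow> \<not> n \<le> degree f" for n and A :: "'a poly set"
      using that by (auto simp: division_closed_def)
    then show ?thesis
      using * by (metis insertI1)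
  qed
  ultimately obtain F' where "finite F'" "insert 0 F \<subseteq> F'" "division_closed 0 F'"
    using assms by (metis finite_insert)
  then show ?thesis
    by blast
qed

lemma degree_lead_coeff_map_poly:
  assumes "h 0 = 0" "h (lead_coeff f) \<noteq> 0"
  shows "degree (map_poly h f) = degree f" "lead_coeff (map_poly h f) = h (lead_coeff f)" "map_poly h f \<noteq> 0"
proof -
  have c: "coeff (map_poly h f) n = h (coeff f n)" for n
    using assms(1) by (simp add: coeff_map_poly)
  show deg: "degree (map_poly h f) = degree f"
    using assms(2) by (intro antisym[OF degree_map_poly_le] le_degree) (simp add: c)
  show "lead_coeff (map_poly h f) = h (lead_coeff f)"
    unfolding deg c ..
  then show "map_poly h f \<noteq> 0"
    using assms(2) by auto
qed

lemma map_poly_formal_deriv: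
  fixes h :: "'a::comm_ring_1 \<Rightarrow> 'b::idom"
  assumes "comm_ring_hom h"
  shows "map_poly h (formal_deriv f) = pderiv (map_poly h f)"
proof -
  interpret comm_ring_hom h by fact
  show ?thesis
    by (rule poly_eqI) (simp add: coeff_pderiv coeff_formal_deriv hom_distribs del: of_nat_Suc)
qed

text \<open>This reduces the sign of \<open>f\<close> at a root of \<open>g\<close> to the sign of a
  polynomial of smaller degree than \<open>g\<close>.\<close>

lemma map_poly_pseudo_rem:
  fixes h :: "'a::comm_ring_1 \<Rightarrow> 'b::idom"
  assumes "comm_ring_hom h" "g \<noteq> 0" "poly (map_poly h g) z = 0"
  shows "h (lead_coeff g) ^ (Suc (degree f) - degree g) * poly (map_poly h f) z = poly (map_poly h (pseudo_rem f g)) z"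
proof -
  interpret comm_ring_hom h by fact
  interpret hp: map_poly_comm_ring_hom h ..
  obtain q r where qr: "pseudo_divmod f g = (q, r)"
    by fastforce
  have "smult (lead_coeff g ^ (Suc (degree f) - degree g)) f = g * q + pseudo_rem f g"
    using pseudo_divmod(1)[OF assms(2) qr] qr by (simp add: pseudo_rem_def)
  from arg_cong[OF this, of "\<lambda>p. poly (map_poly h p) z"] show ?thesis
    using assms(3) by (simp add: hom_distribs)
qed

lemma diagram_empty:
  assumes "0 < M" "0 < N"
  shows "diagram M N {} P Q {(- M, - N), (M, N)}"
  using assms by (auto simp: diagram_def matched_def)

lemma diagram_insert_const:
  assumes D: "diagram M N B P Q Z" and "P j = [:a:]" "Q j = [:b:]" "a \<noteq> 0" "same_sign a b"
  shows "diagram M N (insert j B) P Q Z"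
proof -
  have "b \<noteq> 0"
    using assms same_sign_eq_0 by blast
  then show ?thesis
    using assms unfolding diagram_def by (auto 0 4)
qed

text \<open>The signs of the leading coefficients determine the whole diagram. Polynomials are added
  by increasing degree: their signs at old roots come from pseudo-remainders, their new roots from
  Rolle and the derivative, and their signs at the window ends from the leading coefficient.\<close>

lemma closed_family_transfer:
  fixes F :: "'a::comm_ring_1 poly set" and \<alpha> :: "'a \<Rightarrow> 'r::real_closed_field" and \<beta> :: "'a \<Rightarrow> 's::real_closed_field"
  assumes fin: "finite F" and cl: "division_closed 0 F" and \<alpha>: "comm_ring_hom \<alpha>" and \<beta>: "comm_ring_hom \<beta>"
    and lc: "\<And>f. f \<in> F \<Longrightarrow> same_sign (\<alpha> (lead_coeff f)) (\<beta> (lead_coeff f))"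
  shows "\<exists>y. \<forall>f\<in>F. same_sign (poly (map_poly \<alpha> f) x) (poly (map_poly \<beta> f) y)"
proof -
  interpret \<alpha>: comm_ring_hom \<alpha> by fact
  interpret \<beta>: comm_ring_hom \<beta> by fact
  interpret \<alpha>p: map_poly_comm_ring_hom \<alpha> ..
  interpret \<beta>p: map_poly_comm_ring_hom \<beta> ..
  let ?P = "map_poly \<alpha>" and ?Q = "map_poly \<beta>"
  \<comment> \<open>On \<open>K\<close> the leading coefficient survives both homomorphisms, so
    degrees are preserved and the images are nonzero. Any other member has the same image as its
    tail, and \<open>reduce\<close> repeats this until it reaches \<open>K\<close> or 0.\<close>
  define K where "K = {f \<in> F. \<alpha> (lead_coeff f) \<noteq> 0}"
  have K: "f \<in> F" "\<alpha> (lead_coeff f) \<noteq> 0" "\<beta> (lead_coeff f) \<noteq> 0" if "f \<in> K" for f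
    using that lc[of f] same_sign_eq_0[OF lc, of f] by (auto simp: K_def)
  have finK: "finite K"
    using fin by (simp add: K_def)
  note KP = degree_lead_coeff_map_poly[of \<alpha>, OF \<alpha>.hom_zero K(2)]
  note KQ = degree_lead_coeff_map_poly[of \<beta>, OF \<beta>.hom_zero K(3)]
  have reduce: "\<exists>r'. (r' = 0 \<or> r' \<in> K) \<and> degree r' \<le> degree r \<and> ?P r = ?P r' \<and> ?Q r = ?Q r'" if "r \<in> F" for r
    using that
  proof (induction "degree r" arbitrary: r rule: less_induct)
    case less
    show ?case
    proof (cases "\<alpha> (lead_coeff r) = 0")
      case False
      then show ?thesis
        using less.prems by (intro exI[of _ r]) (auto simp: K_def)
    next
      case True
      then have "\<beta> (lead_coeff r) = 0"
        using same_sign_eq_0[OF lc[OF less.prems]] by simp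
      with True have eq: "?P (poly_tail r) = ?P r" "?Q (poly_tail r) = ?Q r"
        by (simp_all add: poly_tail_def hom_distribs)
      show ?thesis
      proof (cases "degree r = 0")
        case True
        then show ?thesis
          using eq poly_tail_const[of r] by (intro exI[of _ 0]) auto
      next
        case False
        then have "degree (poly_tail r) < degree r" "poly_tail r \<in> F"
          using degree_poly_tail[of r] cl less.prems by (auto simp: division_closed_def)
        then show ?thesis
          using less.hyps[of "poly_tail r"] eq by (metis less_imp_le order_trans)
      qed
    qed
  qed
  obtain M where M: "0 < M" "\<And>f x. f \<in> K \<Longrightarrow> M \<le> x \<Longrightarrow> sgn (poly (?P f) x) = sgn (\<alpha> (lead_coeff f))
      \<and> sgn (poly (?P f) (- x)) = sgn ((- 1) ^ degree f * \<alpha> (lead_coeff f))"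
    using sentinel_exists[of K ?P] finK KP by (metis (no_types, lifting))
  obtain N where N: "0 < N" "\<And>f x. f \<in> K \<Longrightarrow> N \<le> x \<Longrightarrow> sgn (poly (?Q f) x) = sgn (\<beta> (lead_coeff f))
      \<and> sgn (poly (?Q f) (- x)) = sgn ((- 1) ^ degree f * \<beta> (lead_coeff f))"
    using sentinel_exists[of K ?Q] finK KQ by (metis (no_types, lifting))
  have m1: "same_sign ((- 1) ^ n * a) ((- 1) ^ n * b)" if "same_sign a b" for n and a :: 'r and b :: 's
    using that same_sign_power[OF same_sign_uminus[OF same_sign_simps(2)]] by (intro same_sign_mult)
  have ends: "same_sign (poly (?P f) M) (poly (?Q f) N)" "same_sign (poly (?P f) (- M)) (poly (?Q f) (- N))"
    if "f \<in> K" for f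
    using same_sign_sgn[OF lc] same_sign_sgn[OF m1[OF lc]] M(2)[OF that] N(2)[OF that] K(1)[OF that] by auto
  \<comment> \<open>\<open>B\<close> is downward closed in degree. The induction removes an element
    of largest degree, so its derivative and its reduced remainders stay in the rest.\<close>
  have diag: "\<exists>Z. diagram M N B ?P ?Q Z"
    if "finite B" "B \<subseteq> K" "\<And>f g. f \<in> B \<Longrightarrow> g \<in> K \<Longrightarrow> degree g < degree f \<Longrightarrow> g \<in> B" for B
    using that
  proof (induction "card B" arbitrary: B)
    case 0
    then show ?case
      using diagram_empty[OF M(1) N(1)] by auto
  next
    case (Suc m)
    then have "B \<noteq> {}" by auto
    have "\<exists>j\<in>B. \<forall>g\<in>B. degree g \<le> degree j"
    proof -
      have "Max (degree ` B) \<in> degree ` B"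
        using \<open>B \<noteq> {}\<close> Suc.prems(1) by (intro Max_in) auto
      then obtain j where "j \<in> B" "degree j = Max (degree ` B)"
        by auto
      then show ?thesis
        using Suc.prems(1) by (metis Max_ge finite_imageI imageI)
    qed
    then obtain j where j: "j \<in> B" "\<And>g. g \<in> B \<Longrightarrow> degree g \<le> degree j"
      by blast
    let ?B = "B - {j}"
    have low: "g \<in> ?B" if "g \<in> K" "degree g < degree j" for g
      using Suc.prems(3)[OF j(1) that] that by auto
    have "\<exists>Z. diagram M N ?B ?P ?Q Z"
    proof (rule Suc.hyps(1))
      show "m = card ?B"
        using Suc.hyps(2) Suc.prems(1) j(1) by simp
      show "g \<in> ?B" if "f \<in> ?B" "g \<in> K" "degree g < degree f" for f g
        using Suc.prems(3)[of f g] that j(2)[of f] by auto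
    qed (use Suc.prems in auto)
    then obtain Z where Z: "diagram M N ?B ?P ?Q Z" ..
    have jK: "j \<in> K"
      using j(1) Suc.prems(2) by blast
    have ins: "insert j ?B = B"
      using j(1) by blast
    show ?case
    proof (cases "degree j = 0")
      case True
      then obtain c where c: "j = [:c:]"
        by (elim degree_eq_zeroE)
      have "diagram M N (insert j ?B) ?P ?Q Z"
        using Z by (rule diagram_insert_const[of _ _ _ _ _ _ _ "\<alpha> c" "\<beta> c"])
          (use K[OF jK] lc[of j] in \<open>auto simp: c hom_distribs\<close>)
      then show ?thesis
        unfolding ins ..
    next
      case False
      let ?d = "formal_deriv j"
      \<comment> \<open>In characteristic 0 the leading coefficient of the derivative survives
        together with that of \<open>j\<close>, which places the derivative in
        \<open>K\<close>.\<close>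
      have dd: "coeff ?d (degree j - 1) = of_nat (degree j) * lead_coeff j"
        using False by (simp add: coeff_formal_deriv del: of_nat_Suc)
      have dne: "\<alpha> (coeff ?d (degree j - 1)) \<noteq> 0"
        unfolding dd using K(2)[OF jK] False by (simp add: hom_distribs)
      then have "coeff ?d (degree j - 1) \<noteq> 0"
        by force
      then have "degree ?d = degree j - 1"
        using degree_formal_deriv[of j] False le_degree[of ?d "degree j - 1"] by simp
      then have "?d \<in> K"
        using dne K(1)[OF jK] cl by (simp add: K_def division_closed_def)
      then have d: "?d \<in> ?B"
        using low degree_formal_deriv[of j] False by simp
      have S: "same_sign (poly (?P j) z) (poly (?Q j) w)" if zw: "(z, w) \<in> Z" for z w
      proof -
        note DZ = diagramD[OF Z]
        consider "(z, w) = (- M, - N)" | "(z, w) = (M, N)"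
          | i where "i \<in> ?B" "poly (?P i) z = 0" "poly (?Q i) w = 0"
          using DZ(8)[OF zw] by blast
        then show ?thesis
        proof cases
          case 3
          then have iK: "i \<in> K"
            using Suc.prems(2) by blast
          have "degree i \<noteq> 0"
          proof
            assume "degree i = 0"
            then obtain c where "i = [:c:]"
              by (elim degree_eq_zeroE)
            then show False
              using 3(2) K(2)[OF iK] by (simp add: hom_distribs)
          qed
          then have i0: "0 < degree i" "i \<noteq> 0"
            by auto
          \<comment> \<open>At a root of \<open>i\<close> the value of \<open>j\<close> is, up to a
            power of a leading coefficient of known sign, the value of the remainder, and that one
            is already in the diagram after reduction.\<close>
          let ?r = "pseudo_rem j i" and ?k = "Suc (degree j) - degree i"
          have "?r \<in> F"
            using cl K(1)[OF jK] K(1)[OF iK] i0 j(2)[of i] 3(1) by (simp add: division_closed_def)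
          then obtain r' where r': "r' = 0 \<or> r' \<in> K" "degree r' \<le> degree ?r" "?P ?r = ?P r'" "?Q ?r = ?Q r'"
            using reduce by blast
          have "same_sign (poly (?P r') z) (poly (?Q r') w)"
          proof (cases "r' = 0")
            case False
            have "degree r' < degree j"
              using r'(2) degree_pseudo_rem[OF i0(1), of j] j(2)[of i] 3(1) by simp
            then have "r' \<in> ?B"
              using low r'(1) False by blast
            then show ?thesis
              using DZ(11)[of r' z w] DZ(6,7)[OF zw] by blast
          qed simp
          then have "same_sign (\<alpha> (lead_coeff i) ^ ?k * poly (?P j) z) (\<beta> (lead_coeff i) ^ ?k * poly (?Q j) w)"
            using map_poly_pseudo_rem[OF \<alpha> i0(2) 3(2), of j] map_poly_pseudo_rem[OF \<beta> i0(2) 3(3), of j] r'(3,4)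
            by simp
          then show ?thesis
            by (rule same_sign_cancel) (use lc[OF K(1)[OF iK]] K(2)[OF iK] in \<open>auto intro: same_sign_power\<close>)
        qed (use ends[OF jK] in auto)
      qed
      have "\<exists>Z'. diagram M N (insert j ?B) ?P ?Q Z'"
        by (rule diagram_insert[OF Z d map_poly_formal_deriv[OF \<alpha>] map_poly_formal_deriv[OF \<beta>] S KP(3)[OF jK] KQ(3)[OF jK]])
      then show ?thesis
        unfolding ins .
    qed
  qed
  obtain Z where Z: "diagram M N K ?P ?Q Z"
    using diag[OF finK] by blast
  note DZ = diagramD[OF Z]
  \<comment> \<open>Clamping \<open>x\<close> to the window changes no sign of a member of
    \<open>K\<close>, and inside the window the diagram applies.\<close>
  define x' where "x' = max (- M) (min M x)"
  have x': "- M \<le> x'" "x' \<le> M"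
    using M(1) by (auto simp: x'_def)
  have sx: "sgn (poly (?P f) x') = sgn (poly (?P f) x)" if f: "f \<in> K" for f
  proof -
    consider "M \<le> x" | "x \<le> - M" | "- M \<le> x" "x \<le> M"
      by linarith
    then show ?thesis
    proof cases
      case 1
      then have "x' = M"
        using M(1) by (simp add: x'_def)
      then show ?thesis
        using M(2)[OF f, of x] M(2)[OF f, of M] 1 by simp
    next
      case 2
      then have "x' = - M"
        using M(1) by (simp add: x'_def)
      then show ?thesis
        using M(2)[OF f, of "- x"] M(2)[OF f, of M] 2 by simp
    qed (simp add: x'_def)
  qed
  obtain y where y: "- N \<le> y" "y \<le> N" "matched Z x' y"
  proof (cases "\<exists>w. (x', w) \<in> Z")
    case True
    then obtain w where "(x', w) \<in> Z" ..
    then show ?thesis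
      using DZ(6,7) that by blast
  next
    case False
    then have "x' \<noteq> - M" "x' \<noteq> M"
      using DZ(4,5) by auto
    then have "- M < x'" "x' < M"
      using x' by auto
    then obtain l l' u u' where lu: "(l, l') \<in> Z" "(u, u') \<in> Z" "l < x'" "x' < u"
      and gap: "\<forall>(z, w)\<in>Z. z \<le> l \<or> u \<le> z"
      using neighbours[OF DZ(1) DZ(4) _ DZ(5), of x'] False by blast
    have "l' < u'"
      using matchedD[OF DZ(6)[OF lu(1)] lu(2)] lu by auto
    then obtain y where y: "l' < y" "y < u'"
      using dense by blast
    then show ?thesis
      using that[of y] matched_between[OF Z lu gap y] DZ(7)[OF lu(1)] DZ(7)[OF lu(2)] by auto
  qed
  have "same_sign (poly (?P f) x) (poly (?Q f) y)" if f: "f \<in> F" for f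
  proof -
    obtain r where r: "r = 0 \<or> r \<in> K" "?P f = ?P r" "?Q f = ?Q r"
      using reduce[OF f] by blast
    show ?thesis
    proof (cases "r = 0")
      case False
      then have "same_sign (poly (?P r) x') (poly (?Q r) y)"
        using DZ(11)[of r x' y] r(1) x' y by blast
      then show ?thesis
        using same_sign_sgn sx[of r] r False by metis
    qed (use r in auto)
  qed
  then show ?thesis
    by blast
qed

text \<open>Elimination of one variable. \<open>G\<close> is fixed before the homomorphisms and the
  point, so when the ring is itself a polynomial ring, \<open>G\<close> is the family from which the
  next variable is eliminated.\<close>

lemma sign_transfer_one_variable:
  fixes F :: "'a::comm_ring_1 poly set"
  assumes "finite F"
  shows "\<exists>G. finite G \<and> (\<forall>(\<alpha> :: 'a \<Rightarrow> 'r::real_closed_field) (\<beta> :: 'a \<Rightarrow> 's::real_closed_field).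
    comm_ring_hom \<alpha> \<longrightarrow> comm_ring_hom \<beta> \<longrightarrow> (\<forall>g\<in>G. same_sign (\<alpha> g) (\<beta> g)) \<longrightarrow>
    (\<forall>x. \<exists>y. \<forall>f\<in>F. same_sign (poly (map_poly \<alpha> f) x) (poly (map_poly \<beta> f) y)))"
proof -
  obtain F' where F': "finite F'" "F \<subseteq> F'" "division_closed 0 F'"
    using division_closure[OF assms] by blast
  show ?thesis
  proof (intro exI[of _ "lead_coeff ` F'"] conjI allI impI)
    fix \<alpha> :: "'a \<Rightarrow> 'r" and \<beta> :: "'a \<Rightarrow> 's" and x
    assume "comm_ring_hom \<alpha>" "comm_ring_hom \<beta>" "\<forall>g\<in>lead_coeff ` F'. same_sign (\<alpha> g) (\<beta> g)"
    then show "\<exists>y. \<forall>f\<in>F. same_sign (poly (map_poly \<alpha> f) x) (poly (map_poly \<beta> f) y)"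
      using closed_family_transfer[OF F'(1,3), of \<alpha> \<beta> x] F'(2) by blast
  qed (use F'(1) in simp)
qed

section \<open>Multivariate polynomials\<close>

abbreviation (input) "lookup \<equiv> Poly_Mapping.lookup"
abbreviation (input) "keys \<equiv> Poly_Mapping.keys"
abbreviation (input) "single \<equiv> Poly_Mapping.single"

abbreviation mconst :: "real \<Rightarrow> 'n mpoly" where
  "mconst r \<equiv> single 0 r"

abbreviation mvar :: "'n \<Rightarrow> 'n mpoly" where
  "mvar t \<equiv> single (single t 1) 1"

definition mon_eval :: "('n::finite \<Rightarrow> 'k::comm_ring_1) \<Rightarrow> ('n \<Rightarrow>\<^sub>0 nat) \<Rightarrow> 'k" where
  "mon_eval x \<alpha> = (\<Prod>t\<in>UNIV. x t ^ lookup \<alpha> t)"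

text \<open>Depending on \<open>e\<close> and \<open>x\<close> this is evaluation at a real point or
  at a point over an ordered extension, the identity (\<open>mp_eval_mconst_mvar\<close>), or the
  passage to one distinguished variable (\<open>isolate_var\<close>).\<close>

definition mp_eval :: "(real \<Rightarrow> 'k::comm_ring_1) \<Rightarrow> ('n::finite \<Rightarrow> 'k) \<Rightarrow> 'n mpoly \<Rightarrow> 'k" where
  "mp_eval e x p = (\<Sum>\<alpha>\<in>keys p. e (lookup p \<alpha>) * mon_eval x \<alpha>)"

lemma peval_eq_mp_eval: "peval p x = mp_eval (\<lambda>r. r) x p"
  by (simp add: peval_def mp_eval_def mon_eval_def)

lemma mon_eval_0 [simp]: "mon_eval x 0 = 1"
  by (simp add: mon_eval_def)

lemma mon_eval_add: "mon_eval x (\<alpha> + \<beta>) = mon_eval x \<alpha> * mon_eval x \<beta>"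
  by (simp add: mon_eval_def lookup_add power_add prod.distrib)

lemma mon_eval_single: "mon_eval x (single t n) = x t ^ n"
proof -
  have "mon_eval x (single t n) = (\<Prod>s\<in>UNIV. if s = t then x s ^ n else 1)"
    unfolding mon_eval_def by (intro prod.cong) (auto simp: lookup_single when_def)
  then show ?thesis
    by simp
qed

lemma mp_eval_superset:
  assumes "finite A" "keys p \<subseteq> A" "e 0 = 0"
  shows "mp_eval e x p = (\<Sum>\<alpha>\<in>A. e (lookup p \<alpha>) * mon_eval x \<alpha>)"
  unfolding mp_eval_def using assms
  by (intro sum.mono_neutral_left) (auto simp: in_keys_iff)

lemma mp_eval_single: "e 0 = 0 \<Longrightarrow> mp_eval e x (single \<alpha> c) = e c * mon_eval x \<alpha>"
  by (subst mp_eval_superset[of "{\<alpha>}"]) auto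

lemma mpoly_eq_sum: "p = (\<Sum>\<alpha>\<in>keys p. single \<alpha> (lookup p \<alpha>))"
proof (rule poly_mapping_eqI)
  fix \<beta>
  have "(\<Sum>\<alpha>\<in>keys p. lookup (single \<alpha> (lookup p \<alpha>)) \<beta>)
    = (\<Sum>\<alpha>\<in>keys p. if \<alpha> = \<beta> then lookup p \<alpha> else 0)"
    by (intro sum.cong) (auto simp: lookup_single when_def)
  then show "lookup p \<beta> = lookup (\<Sum>\<alpha>\<in>keys p. single \<alpha> (lookup p \<alpha>)) \<beta>"
    by (auto simp: lookup_sum in_keys_iff)
qed

lemma comm_ring_hom_mp_eval:
  fixes e :: "real \<Rightarrow> 'k::comm_ring_1" and x :: "'n::finite \<Rightarrow> 'k"
  assumes "comm_ring_hom e"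
  shows "comm_ring_hom (mp_eval e x)"
proof -
  interpret e: comm_ring_hom e by fact
  have add: "mp_eval e x (p + q) = mp_eval e x p + mp_eval e x q" for p q :: "'n mpoly"
    by (subst (1 2 3) mp_eval_superset[of "keys p \<union> keys q"])
      (use Poly_Mapping.keys_add[of p q] in \<open>auto simp: lookup_add e.hom_add distrib_right sum.distrib\<close>)
  have zero: "mp_eval e x 0 = 0"
    by (simp add: mp_eval_def)
  have sum: "mp_eval e x (sum f A) = (\<Sum>a\<in>A. mp_eval e x (f a))" for f :: "('n \<Rightarrow>\<^sub>0 nat) \<Rightarrow> 'n mpoly" and A
    by (induction A rule: infinite_finite_induct) (simp_all add: zero add)
  have mult: "mp_eval e x (p * q) = mp_eval e x p * mp_eval e x q" for p q :: "'n mpoly"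
  proof -
    let ?s = "\<lambda>p :: 'n mpoly. \<lambda>\<alpha>. single \<alpha> (lookup p \<alpha>)"
    have "p * q = sum (?s p) (keys p) * sum (?s q) (keys q)"
      by (rule arg_cong2[where f = "(*)"]; rule mpoly_eq_sum)
    then have "mp_eval e x (p * q) = (\<Sum>\<alpha>\<in>keys p. \<Sum>\<beta>\<in>keys q. mp_eval e x (?s p \<alpha> * ?s q \<beta>))"
      by (simp only: sum_product sum)
    also have "\<dots> = (\<Sum>\<alpha>\<in>keys p. \<Sum>\<beta>\<in>keys q.
        (e (lookup p \<alpha>) * mon_eval x \<alpha>) * (e (lookup q \<beta>) * mon_eval x \<beta>))"
      by (intro sum.cong) (simp_all add: mult_single mp_eval_single mon_eval_add e.hom_mult ac_simps)
    also have "\<dots> = mp_eval e x p * mp_eval e x q"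
      by (simp add: mp_eval_def sum_product)
    finally show ?thesis .
  qed
  have one: "mp_eval e x 1 = 1"
    using mp_eval_single[of e x 0 1] by simp
  show ?thesis
    by unfold_locales (simp_all add: zero one add mult)
qed

lemma comm_ring_hom_id: "comm_ring_hom (\<lambda>r. r)"
  by unfold_locales auto

interpretation peval: comm_ring_hom "\<lambda>p. peval p x"
  unfolding peval_eq_mp_eval by (rule comm_ring_hom_mp_eval[OF comm_ring_hom_id])

lemma peval_const [simp]: "peval (mconst r) x = r"
  by (simp add: peval_eq_mp_eval mp_eval_single)

lemma comm_ring_hom_mconst: "comm_ring_hom (mconst :: real \<Rightarrow> 'n mpoly)"
  by unfold_locales (auto simp: single_add mult_single)

lemma hom_mp_eval:
  assumes "comm_ring_hom h"
  shows "h (mp_eval e x p) = mp_eval (\<lambda>r. h (e r)) (\<lambda>t. h (x t)) p"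
proof -
  interpret h: comm_ring_hom h by fact
  show ?thesis
    by (simp add: mp_eval_def mon_eval_def hom_distribs)
qed

lemma mp_eval_mconst_mvar: "mp_eval mconst mvar p = p"
proof -
  have pow: "mvar t ^ n = single (single t n) (1 :: real)" for t :: 'a and n
    by (induction n) (auto simp: mult_single single_add[symmetric])
  have prod: "(\<Prod>t\<in>A. single (\<gamma> t) (1 :: real)) = single (\<Sum>t\<in>A. \<gamma> t) 1"
    for A and \<gamma> :: "'a \<Rightarrow> 'a \<Rightarrow>\<^sub>0 nat"
    by (induction A rule: infinite_finite_induct) (auto simp: mult_single)
  have mon: "mon_eval mvar \<alpha> = single \<alpha> 1" for \<alpha> :: "'a \<Rightarrow>\<^sub>0 nat"
  proof -
    have "(\<Sum>t\<in>UNIV. single t (lookup \<alpha> t)) = \<alpha>"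
    proof (rule poly_mapping_eqI)
      fix s
      have "(\<Sum>t\<in>UNIV. lookup (single t (lookup \<alpha> t)) s)
        = (\<Sum>t\<in>UNIV. if t = s then lookup \<alpha> t else 0)"
        by (intro sum.cong) (auto simp: lookup_single when_def)
      then show "lookup (\<Sum>t\<in>UNIV. single t (lookup \<alpha> t)) s = lookup \<alpha> s"
        by (simp add: lookup_sum)
    qed
    then show ?thesis
      unfolding mon_eval_def pow prod by simp
  qed
  show ?thesis
    unfolding mp_eval_def mon using mpoly_eq_sum[of p] by (simp add: mult_single)
qed

lemma mpoly_induct [case_names const var add mult]:
  fixes p :: "'n::finite mpoly"
  assumes "\<And>r. R (mconst r)" "\<And>t. R (mvar t)" "\<And>p q. R p \<Longrightarrow> R q \<Longrightarrow> R (p + q)" "\<And>p q. R p \<Longrightarrow> R q \<Longrightarrow> R (p * q)"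
  shows "R p"
proof -
  have one: "R 1"
    using assms(1)[of 1] by simp
  have pow: "R (q ^ n)" if "R q" for q n
    using that one by (induction n) (auto intro: assms)
  have prod: "R (prod f A)" if "\<And>t. t \<in> A \<Longrightarrow> R (f t)" for f :: "'n \<Rightarrow> 'n mpoly" and A
    using that one by (induction A rule: infinite_finite_induct) (auto intro: assms)
  have zero: "R 0"
    using assms(1)[of 0] by simp
  have sum: "R (sum f A)" if "\<And>t. t \<in> A \<Longrightarrow> R (f t)" for f :: "('n \<Rightarrow>\<^sub>0 nat) \<Rightarrow> 'n mpoly" and A
    using that zero by (induction A rule: infinite_finite_induct) (auto intro: assms)
  have "R (mp_eval mconst mvar p)"
    unfolding mp_eval_def mon_eval_def by (intro sum assms(4) prod pow assms(1,2))
  then show ?thesis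
    unfolding mp_eval_mconst_mvar .
qed

text \<open>The coefficients no longer involve \<open>t\<close> but keep the type
  \<open>'n mpoly\<close>, so that elimination can be iterated.\<close>

definition isolate_var :: "'n::finite \<Rightarrow> 'n mpoly \<Rightarrow> 'n mpoly poly" where
  "isolate_var t = mp_eval (\<lambda>r. [:mconst r:]) (\<lambda>s. if s = t then [:0, 1:] else [:mvar s:])"

lemma comm_ring_hom_poly_map_poly:
  fixes h :: "'a::comm_ring_1 \<Rightarrow> 'b::comm_ring_1"
  assumes "comm_ring_hom h" shows "comm_ring_hom (\<lambda>q. poly (map_poly h q) y)"
proof -
  interpret h: comm_ring_hom h by fact
  interpret hp: map_poly_comm_ring_hom h ..
  show ?thesis
    by unfold_locales (simp_all add: hom_distribs)
qed

lemma poly_isolate_var: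
  assumes e: "comm_ring_hom e"
  shows "poly (map_poly (mp_eval e u) (isolate_var t p)) y = mp_eval e (u(t := y)) p"
proof -
  interpret e: comm_ring_hom e by fact
  interpret ev: comm_ring_hom "mp_eval e u" by (rule comm_ring_hom_mp_eval[OF e])
  have "poly (map_poly (mp_eval e u) (isolate_var t p)) y =
    mp_eval (\<lambda>r. poly (map_poly (mp_eval e u) [:mconst r:]) y)
      (\<lambda>s. poly (map_poly (mp_eval e u) (if s = t then [:0, 1:] else [:mvar s:])) y) p"
    unfolding isolate_var_def by (rule hom_mp_eval[OF comm_ring_hom_poly_map_poly[OF comm_ring_hom_mp_eval[OF e]]])
  also have "(\<lambda>r. poly (map_poly (mp_eval e u) [:mconst r:]) y) = e"
    by (auto simp: hom_distribs mp_eval_single)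
  also have "(\<lambda>s. poly (map_poly (mp_eval e u) (if s = t then [:0, 1:] else [:mvar s:])) y) = u(t := y)"
    by (auto simp: hom_distribs mp_eval_single mon_eval_single)
  finally show ?thesis .
qed

section \<open>The Artin-Lang principle\<close>

text \<open>Positive reals are squares of units, hence so are their images; no compatibility of
  \<open>e\<close> with the orders has to be assumed.\<close>

lemma hom_real_same_sign:
  fixes e :: "real \<Rightarrow> 'r::linordered_field"
  assumes "comm_ring_hom e"
  shows "same_sign (e r) r"
proof -
  interpret e: comm_ring_hom e by fact
  have pos: "0 < e s" if "0 < s" for s
  proof -
    have "e s = e (sqrt s) * e (sqrt s)"
      using that by (simp flip: e.hom_mult)
    moreover have "e s * e (inverse s) = 1"
      using that by (simp flip: e.hom_mult)
    then have "e s \<noteq> 0"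
      by force
    ultimately show ?thesis
      by (metis mult_eq_0_iff not_real_square_gt_zero not_square_less_zero linorder_neqE_linordered_idom)
  qed
  show ?thesis
    using pos[of r] pos[of "- r"] by (cases "r = 0"; cases "0 < r") (auto simp: same_sign_def e.hom_uminus)
qed

text \<open>The type fixes the number of coordinates, so the eliminated variables in
  \<open>V\<close> are set to 0 instead of being dropped. The quantifier order matters:
  \<open>G\<close> depends on \<open>F\<close> and \<open>V\<close> but not on the points.\<close>

lemma sign_transfer:
  fixes e :: "real \<Rightarrow> 'r::real_closed_field" and V :: "'n::finite set"
  assumes e: "comm_ring_hom e" and "finite V" "finite F"
  shows "\<exists>G. finite G \<and> (\<forall>u w. (\<forall>g\<in>G. same_sign (mp_eval e (\<lambda>t. if t \<in> V then 0 else u t) g) (peval g (\<lambda>t. if t \<in> V then 0 else w t)))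
    \<longrightarrow> (\<exists>w'. (\<forall>t. t \<notin> V \<longrightarrow> w' t = w t) \<and> (\<forall>f\<in>F. same_sign (mp_eval e u f) (peval f w'))))"
  using assms(2,3)
proof (induction V arbitrary: F rule: finite_induct)
  case empty
  then show ?case
    by (intro exI[of _ F]) auto
next
  case (insert s V)
  have id: "comm_ring_hom (\<lambda>r :: real. r)"
    by (rule comm_ring_hom_id)
  have "finite (isolate_var s ` F)"
    using insert.prems by simp
  from sign_transfer_one_variable[OF this, where ?'r = 'r and ?'s = real] obtain G1 where G1: "finite G1"
    and G1_transfer: "\<forall>(\<alpha> :: 'n mpoly \<Rightarrow> 'r) (\<beta> :: 'n mpoly \<Rightarrow> real).
      comm_ring_hom \<alpha> \<longrightarrow> comm_ring_hom \<beta> \<longrightarrow> (\<forall>g\<in>G1. same_sign (\<alpha> g) (\<beta> g)) \<longrightarrow>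
      (\<forall>x. \<exists>y. \<forall>f\<in>isolate_var s ` F. same_sign (poly (map_poly \<alpha> f) x) (poly (map_poly \<beta> f) y))"
    by (elim exE conjE)
  from insert.IH[OF G1] obtain G where G: "finite G"
    and G_transfer: "\<forall>u w. (\<forall>g\<in>G. same_sign (mp_eval e (\<lambda>t. if t \<in> V then 0 else u t) g) (peval g (\<lambda>t. if t \<in> V then 0 else w t)))
      \<longrightarrow> (\<exists>w'. (\<forall>t. t \<notin> V \<longrightarrow> w' t = w t) \<and> (\<forall>f\<in>G1. same_sign (mp_eval e u f) (peval f w')))"
    by (elim exE conjE)
  show ?case
  proof (intro exI[of _ G] conjI allI impI)
    fix u :: "'n \<Rightarrow> 'r" and w :: "'n \<Rightarrow> real"
    assume *: "\<forall>g\<in>G. same_sign (mp_eval e (\<lambda>t. if t \<in> insert s V then 0 else u t) g)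
      (peval g (\<lambda>t. if t \<in> insert s V then 0 else w t))"
    have eq: "(\<lambda>t. if t \<in> V then 0 else (v(s := 0)) t) = (\<lambda>t. if t \<in> insert s V then 0 else v t)" for v :: "'n \<Rightarrow> 'b::zero"
      by auto
    have "\<exists>w'. (\<forall>t. t \<notin> V \<longrightarrow> w' t = (w(s := 0)) t) \<and> (\<forall>f\<in>G1. same_sign (mp_eval e (u(s := 0)) f) (peval f w'))"
      by (rule G_transfer[THEN spec, THEN spec, THEN mp]) (use * in \<open>simp only: eq\<close>)
    then obtain w1 where w1: "\<forall>t. t \<notin> V \<longrightarrow> w1 t = (w(s := 0)) t"
      "\<forall>g\<in>G1. same_sign (mp_eval e (u(s := 0)) g) (peval g w1)"
      by (elim exE conjE)
    have "\<exists>y. \<forall>f\<in>isolate_var s ` F. same_sign (poly (map_poly (mp_eval e (u(s := 0))) f) (u s))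
        (poly (map_poly (mp_eval (\<lambda>r. r) w1) f) y)"
      by (rule G1_transfer[THEN spec, THEN spec, THEN mp, THEN mp, THEN mp, THEN spec])
        (use comm_ring_hom_mp_eval[OF e] comm_ring_hom_mp_eval[OF id] w1(2) in \<open>simp_all only: peval_eq_mp_eval\<close>)
    then obtain y where y: "\<forall>f\<in>isolate_var s ` F. same_sign (poly (map_poly (mp_eval e (u(s := 0))) f) (u s))
        (poly (map_poly (mp_eval (\<lambda>r. r) w1) f) y)"
      by (elim exE)
    have "same_sign (mp_eval e u f) (peval f (w1(s := y)))" if f: "f \<in> F" for f
      using bspec[OF y imageI[OF f]] unfolding poly_isolate_var[OF e] poly_isolate_var[OF id]
      by (simp add: peval_eq_mp_eval)
    moreover have "\<forall>t. t \<notin> insert s V \<longrightarrow> (w1(s := y)) t = w t"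
      using w1(1) by auto
    ultimately show "\<exists>w'. (\<forall>t. t \<notin> insert s V \<longrightarrow> w' t = w t) \<and> (\<forall>f\<in>F. same_sign (mp_eval e u f) (peval f w'))"
      by blast
  qed (rule G)
qed

text \<open>The Artin-Lang principle. With all variables eliminated, the conditions concern values
  at the origin, which are real constants and their images under \<open>e\<close>.\<close>

lemma real_point_same_signs:
  fixes e :: "real \<Rightarrow> 'r::real_closed_field" and u :: "'n::finite \<Rightarrow> 'r"
  assumes e: "comm_ring_hom e" and "finite F"
  shows "\<exists>w. \<forall>f\<in>F. same_sign (mp_eval e u f) (peval f w)"
proof -
  interpret e: comm_ring_hom e by fact
  from sign_transfer[OF e finite assms(2), of UNIV] obtain G where G:
    "\<forall>u w. (\<forall>g\<in>G. same_sign (mp_eval e (\<lambda>t :: 'n. if t \<in> UNIV then 0 else u t) g) (peval g (\<lambda>t. if t \<in> UNIV then 0 else w t)))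
      \<longrightarrow> (\<exists>w'. (\<forall>t. t \<notin> UNIV \<longrightarrow> w' t = w t) \<and> (\<forall>f\<in>F. same_sign (mp_eval e u f) (peval f w')))"
    by (elim exE conjE)
  have 0: "same_sign (mp_eval e (\<lambda>t. 0) g) (peval g (\<lambda>t. 0))" for g :: "'n mpoly"
    using hom_mp_eval[OF e, of "\<lambda>r. r" "\<lambda>t. 0" g] hom_real_same_sign[OF e, of "peval g (\<lambda>t. 0)"]
    by (simp add: peval_eq_mp_eval)
  have "\<exists>w'. (\<forall>t. t \<notin> UNIV \<longrightarrow> w' t = 0) \<and> (\<forall>f\<in>F. same_sign (mp_eval e u f) (peval f w'))"
    by (rule G[THEN spec, THEN spec, THEN mp]) (simp add: 0)
  then show ?thesis
    by blast
qed

section \<open>Critical values\<close>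

lemma pderivv_superset:
  assumes "finite A" "keys p \<subseteq> A"
  shows "pderivv t p = (\<Sum>\<alpha>\<in>A. single (\<alpha> - single t 1)
    (of_nat (lookup \<alpha> t) * lookup p \<alpha>))"
  unfolding pderivv_def using assms by (intro sum.mono_neutral_left) (auto simp: in_keys_iff)

lemma pderivv_single:
  "pderivv t (single \<alpha> c) = single (\<alpha> - single t 1) (of_nat (lookup \<alpha> t) * c)"
  by (subst pderivv_superset[of "{\<alpha>}"]) auto

lemma pderivv_add: "pderivv t (p + q) = pderivv t p + pderivv t q"
  by (subst (1 2 3) pderivv_superset[of "keys p \<union> keys q"])
    (use Poly_Mapping.keys_add[of p q] in \<open>auto simp: lookup_add distrib_left single_add sum.distrib\<close>)

lemma pderivv_sum: "pderivv t (sum f A) = (\<Sum>a\<in>A. pderivv t (f a))"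
  by (induction A rule: infinite_finite_induct) (simp_all add: pderivv_add pderivv_def[of t 0])

lemma pderivv_mult_single:
  "pderivv t (single \<alpha> a * single \<beta> b) =
    pderivv t (single \<alpha> a) * single \<beta> b + single \<alpha> a * pderivv t (single \<beta> b)"
proof -
  \<comment> \<open>Subtraction of exponents truncates at 0; where that would spoil the identity,
    the coefficient is 0.\<close>
  have shift: "\<alpha> - single t 1 + \<beta> = \<alpha> + \<beta> - single t 1" if "lookup \<alpha> t \<noteq> 0" for \<alpha> \<beta> :: "'a \<Rightarrow>\<^sub>0 nat"
    using that by (intro poly_mapping_eqI) (auto simp: lookup_add lookup_minus lookup_single when_def)
  have 1: "single (\<alpha> - single t 1 + \<beta>) (of_nat (lookup \<alpha> t) * a * b)
    = single (\<alpha> + \<beta> - single t 1) (of_nat (lookup \<alpha> t) * a * b)"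
    using shift[of \<alpha> \<beta>] by (cases "lookup \<alpha> t = 0") auto
  have 2: "single (\<alpha> + (\<beta> - single t 1)) (a * (of_nat (lookup \<beta> t) * b))
    = single (\<alpha> + \<beta> - single t 1) (a * (of_nat (lookup \<beta> t) * b))"
    using shift[of \<beta> \<alpha>] by (cases "lookup \<beta> t = 0") (auto simp: add.commute)
  show ?thesis
    unfolding pderivv_single mult_single 1 2 by (simp add: lookup_add single_add[symmetric] algebra_simps)
qed

lemma pderivv_mult: "pderivv t (p * q) = pderivv t p * q + p * pderivv t q"
proof -
  let ?s = "\<lambda>p :: 'a mpoly. \<lambda>\<alpha>. single \<alpha> (lookup p \<alpha>)"
  let ?P = "keys p" and ?Q = "keys q"
  have p: "p = sum (?s p) ?P" and q: "q = sum (?s q) ?Q"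
    by (rule mpoly_eq_sum)+
  have "pderivv t (sum (?s p) ?P * sum (?s q) ?Q) = pderivv t (sum (?s p) ?P) * sum (?s q) ?Q + sum (?s p) ?P * pderivv t (sum (?s q) ?Q)"
    by (simp add: sum_product pderivv_sum pderivv_mult_single sum.distrib)
  then show ?thesis
    unfolding p[symmetric] q[symmetric] .
qed

lemma pderivv_const: "pderivv t (mconst r) = 0"
  by (simp add: pderivv_single)

lemma pderivv_var: "pderivv t (mvar s) = (if s = t then 1 else 0)"
  by (auto simp: pderivv_single lookup_single)

text \<open>The graph of a derivation from a subring of \<open>'k\<close> into \<open>'k\<close> is a subring of the ring of dual
  numbers that meets the line of pure dual parts only in zero.\<close>

definition derivation_graph :: "(real \<Rightarrow> 'k::field) \<Rightarrow> ('k \<times> 'k) set \<Rightarrow> bool" where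
  "derivation_graph e G \<longleftrightarrow> (\<forall>r. (e r, 0) \<in> G) \<and>
     (\<forall>a a' b b'. (a, a') \<in> G \<longrightarrow> (b, b') \<in> G \<longrightarrow> (a + b, a' + b') \<in> G \<and> (a * b, a * b' + a' * b) \<in> G) \<and>
     (\<forall>b. (0, b) \<in> G \<longrightarrow> b = 0)"

text \<open>\<open>g'\<close> arises from \<open>g\<close> by applying the derivation to each
  coefficient.\<close>

definition poly_pair :: "('k::field \<times> 'k) set \<Rightarrow> 'k poly \<Rightarrow> 'k poly \<Rightarrow> bool" where
  "poly_pair G g g' \<longleftrightarrow> (\<forall>i. (coeff g i, coeff g' i) \<in> G)"

text \<open>The chain rule: the derivative that g(z) must get from any extension of the derivation
  with z mapped to w.\<close>

definition extended_value :: "'k::field_char_0 \<Rightarrow> 'k \<Rightarrow> 'k poly \<Rightarrow> 'k poly \<Rightarrow> 'k" where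
  "extended_value z w g g' = poly g' z + poly (pderiv g) z * w"

lemma derivation_graphD:
  assumes "derivation_graph e G"
  shows "(e r, 0) \<in> G" "(a, a') \<in> G \<Longrightarrow> (b, b') \<in> G \<Longrightarrow> (a + b, a' + b') \<in> G"
    "(a, a') \<in> G \<Longrightarrow> (b, b') \<in> G \<Longrightarrow> (a * b, a * b' + a' * b) \<in> G" "(0, b) \<in> G \<Longrightarrow> b = 0"
  using assms unfolding derivation_graph_def by simp_all

context
  fixes e :: "real \<Rightarrow> 'k::field_char_0" and G
  assumes e: "comm_ring_hom e" and G: "derivation_graph e G"
begin

interpretation e: comm_ring_hom e by (rule e)

lemma derivation_graph_zero: "(0, 0) \<in> G"
  using derivation_graphD(1)[OF G, of 0] by simp

lemma derivation_graph_uminus: "(a, a') \<in> G \<Longrightarrow> (- a, - a') \<in> G"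
  using derivation_graphD(3)[OF G derivation_graphD(1)[OF G, of "- 1"], of a a'] by (simp add: e.hom_uminus)

lemma derivation_graph_sum: "(\<And>i. i \<in> A \<Longrightarrow> (f i, f' i) \<in> G) \<Longrightarrow> (sum f A, sum f' A) \<in> G"
  by (induction A rule: infinite_finite_induct) (auto intro: derivation_graph_zero derivation_graphD(2)[OF G])

lemma derivation_graph_unique: "(a, b) \<in> G \<Longrightarrow> (a, b') \<in> G \<Longrightarrow> b = b'"
  using derivation_graphD(2)[OF G, of a b "- a" "- b'"] derivation_graph_uminus[of a b'] derivation_graphD(4)[OF G, of "b - b'"] by simp

lemma poly_pair_add: "poly_pair G g g' \<Longrightarrow> poly_pair G h h' \<Longrightarrow> poly_pair G (g + h) (g' + h')"
  using derivation_graphD(2)[OF G] by (simp add: poly_pair_def)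

lemma poly_pair_uminus: "poly_pair G g g' \<Longrightarrow> poly_pair G (- g) (- g')"
  using derivation_graph_uminus by (simp add: poly_pair_def)

lemma poly_pair_mult: "poly_pair G g g' \<Longrightarrow> poly_pair G h h' \<Longrightarrow> poly_pair G (g * h) (g * h' + g' * h)"
  unfolding poly_pair_def coeff_mult coeff_add sum.distrib[symmetric]
  by (intro allI derivation_graph_sum derivation_graphD(3)[OF G]) auto

lemma poly_pair_monom: "(a, a') \<in> G \<Longrightarrow> poly_pair G (monom a n) (monom a' n)"
  using derivation_graph_zero by (simp add: poly_pair_def)

lemma poly_pair_pderiv: "poly_pair G g g' \<Longrightarrow> poly_pair G (pderiv g) (pderiv g')"
proof -
  assume g: "poly_pair G g g'"
  have n: "(of_nat n, 0) \<in> G" for n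
    using derivation_graphD(1)[OF G, of "of_nat n"] by (simp add: hom_distribs)
  have "(of_nat (Suc i) * coeff g (Suc i), of_nat (Suc i) * coeff g' (Suc i)) \<in> G" for i
    using derivation_graphD(3)[OF G n[of "Suc i"], of "coeff g (Suc i)" "coeff g' (Suc i)"] g
    by (simp add: poly_pair_def del: of_nat_Suc)
  then show ?thesis
    unfolding poly_pair_def coeff_pderiv ..
qed

text \<open>The assumption is the well-definedness of the extension: two expressions of an element
  through \<open>z\<close> differ by a relation, and relations must get derivative 0.\<close>

lemma derivation_graph_adjoin:
  assumes ext: "\<And>g g'. poly_pair G g g' \<Longrightarrow> poly g z = 0 \<Longrightarrow> extended_value z w g g' = 0"
  shows "\<exists>H. derivation_graph e H \<and> G \<subseteq> H \<and> (z, w) \<in> H"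
proof -
  define H where "H = {(poly g z, extended_value z w g g') | g g'. poly_pair G g g'}"
  have GH: "(a, a') \<in> H" if "(a, a') \<in> G" for a a'
    unfolding H_def using poly_pair_monom[OF that, of 0]
    by (intro CollectI exI[of _ "monom a 0"] exI[of _ "monom a' 0"]) (auto simp: extended_value_def poly_monom monom_0)
  have "(1, 0) \<in> G"
    using derivation_graphD(1)[OF G, of 1] by simp
  then have "(z, w) \<in> H"
    unfolding H_def using poly_pair_monom[of 1 0 1]
    by (intro CollectI exI[of _ "monom 1 1"] exI[of _ "monom 0 1"]) (auto simp: extended_value_def poly_monom pderiv_monom monom_0)
  moreover have "derivation_graph e H"
    unfolding derivation_graph_def
  proof (intro conjI allI impI)
    show "(e r, 0) \<in> H" for r
      by (rule GH[OF derivation_graphD(1)[OF G]])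
    show "b = 0" if "(0, b) \<in> H" for b
    proof -
      obtain g g' where "poly_pair G g g'" "0 = poly g z" "b = extended_value z w g g'"
        using \<open>(0, b) \<in> H\<close> unfolding H_def by blast
      then show ?thesis
        using ext[of g g'] by simp
    qed
    fix a a' b b' assume "(a, a') \<in> H" "(b, b') \<in> H"
    then obtain g g' h h' where gh: "poly_pair G g g'" "poly_pair G h h'" "a = poly g z" "b = poly h z"
      "a' = extended_value z w g g'" "b' = extended_value z w h h'"
      unfolding H_def by blast
    show "(a + b, a' + b') \<in> H"
      unfolding H_def using poly_pair_add[OF gh(1,2)]
      by (intro CollectI exI[of _ "g + h"] exI[of _ "g' + h'"]) (simp add: gh extended_value_def pderiv_add algebra_simps)
    show "(a * b, a * b' + a' * b) \<in> H"
      unfolding H_def using poly_pair_mult[OF gh(1,2)]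
      by (intro CollectI exI[of _ "g * h"] exI[of _ "g * h' + g' * h"]) (simp add: gh extended_value_def pderiv_mult algebra_simps)
  qed
  ultimately show ?thesis
    using GH by auto
qed

text \<open>If \<open>z\<close> satisfies no relation, any derivative is consistent. Otherwise a
  relation \<open>m\<close> of least degree dictates \<open>w\<close>; its derivative does not
  vanish at \<open>z\<close>, by minimality and characteristic 0. All other relations follow by
  reduction against \<open>m\<close>.\<close>

lemma derivation_graph_extend: "\<exists>w H. derivation_graph e H \<and> G \<subseteq> H \<and> (z, w) \<in> H"
proof (cases "\<exists>g g'. poly_pair G g g' \<and> g \<noteq> 0 \<and> poly g z = 0")
  case False
  have "extended_value z 0 g g' = 0" if "poly_pair G g g'" "poly g z = 0" for g g'
  proof -
    have "g = 0"
      using False that by blast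
    then have "g' = 0"
      using that(1) derivation_graphD(4)[OF G] by (intro poly_eqI) (auto simp: poly_pair_def)
    then show ?thesis
      by (simp add: extended_value_def)
  qed
  then show ?thesis
    using derivation_graph_adjoin[of z 0] by blast
next
  case True
  define n where "n = (LEAST n. \<exists>g g'. poly_pair G g g' \<and> g \<noteq> 0 \<and> poly g z = 0 \<and> degree g = n)"
  have "\<exists>n. \<exists>g g'. poly_pair G g g' \<and> g \<noteq> 0 \<and> poly g z = 0 \<and> degree g = n"
    using True by blast
  from LeastI_ex[OF this] obtain m m' where m: "poly_pair G m m'" "m \<noteq> 0" "poly m z = 0" "degree m = n"
    unfolding n_def[symmetric] by blast
  have min: "n \<le> degree g" if "poly_pair G g g'" "g \<noteq> 0" "poly g z = 0" for g g'
    unfolding n_def using that by (intro Least_le) blast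
  have "0 < n"
    using m by (metis degree_eq_zeroE gr0I mult_eq_0_iff pCons_eq_0_iff poly_const_conv)
  then have "degree (pderiv m) < n" "pderiv m \<noteq> 0"
    using m by (auto simp: degree_pderiv pderiv_eq_0_iff)
  then have dm: "poly (pderiv m) z \<noteq> 0"
    using min[OF poly_pair_pderiv[OF m(1)]] by force
  define w where "w = - poly m' z / poly (pderiv m) z"
  have mw: "extended_value z w m m' = 0"
    using dm by (simp add: extended_value_def w_def)
  have ext: "extended_value z w g g' = 0" if "poly_pair G g g'" "poly g z = 0" for g g'
    using that
  proof (induction "degree g" arbitrary: g g' rule: less_induct)
    case less
    show ?case
    proof (cases "g = 0")
      case True
      then have "g' = 0"
        using less.prems(1) derivation_graphD(4)[OF G] by (intro poly_eqI) (auto simp: poly_pair_def)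
      then show ?thesis
        using True by (simp add: extended_value_def)
    next
      case False
      have deg: "n \<le> degree g"
        using min[OF less.prems(1) False less.prems(2)] .
      define k where "k = degree g - n"
      let ?c = "lead_coeff m" and ?c' = "coeff m' n" and ?b = "lead_coeff g" and ?b' = "coeff g' (degree g)"
      have cG: "(?c, ?c') \<in> G" and bG: "(?b, ?b') \<in> G"
        using m less.prems(1) by (auto simp: poly_pair_def)
      \<comment> \<open>The elements with a derivative form only a subring, so leading terms are
        cancelled by cross-multiplication instead of division; \<open>h'\<close> is the matching
        polynomial of derivatives.\<close>
      define h where "h = monom ?c 0 * g - monom ?b k * m"
      define h' where "h' = (monom ?c 0 * g' + monom ?c' 0 * g) - (monom ?b k * m' + monom ?b' k * m)"
      have hpair: "poly_pair G h h'"
        unfolding h_def h'_def diff_conv_add_uminus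
        by (intro poly_pair_add poly_pair_uminus poly_pair_mult poly_pair_monom cG bG less.prems(1) m(1))
      have hz: "poly h z = 0"
        using less.prems(2) m(3) by (simp add: h_def)
      have "extended_value z w h h' = ?c * extended_value z w g g' + ?c' * poly g z - (?b * z ^ k) * extended_value z w m m'
          - (of_nat k * ?b * z ^ (k - 1) * w + ?b' * z ^ k) * poly m z"
        by (simp add: h_def h'_def extended_value_def pderiv_diff pderiv_mult pderiv_monom poly_monom algebra_simps)
      then have val: "extended_value z w h h' = ?c * extended_value z w g g'"
        by (simp add: less.prems(2) m(3) mw)
      have "h = 0 \<or> degree h < degree g"
      proof -
        have "coeff h i = 0" if "degree g \<le> i" for i
        proof (cases "i = degree g")
          case True
          then show ?thesis
            using deg m(4) by (simp add: h_def k_def coeff_monom_mult)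
        next
          case False
          then have "degree g < i" "degree m < i - k"
            using that deg m(4) by (auto simp: k_def)
          then show ?thesis
            by (simp add: h_def coeff_monom_mult coeff_eq_0)
        qed
        then show ?thesis
          by (metis le_degree leI leading_coeff_0_iff)
      qed
      then have "extended_value z w h h' = 0"
      proof
        assume "h = 0"
        then have "h' = 0"
          using hpair derivation_graphD(4)[OF G] by (intro poly_eqI) (auto simp: poly_pair_def)
        then show ?thesis
          using \<open>h = 0\<close> by (simp add: extended_value_def)
      qed (rule less.hyps[OF _ hpair hz])
      then show ?thesis
        using val m(2) by simp
    qed
  qed
  show ?thesis
    using derivation_graph_adjoin[OF ext] by blast
qed

end

text \<open>There is a derivation that vanishes on the constants and takes the value 1 at f(u),
  because a transcendental element may get any derivative. It is extended to the coordinates,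
  \<open>d\<close> lists their derivatives, and the sums over \<open>t\<close> are the chain
  rule.\<close>

lemma derivation_along_transcendental:
  fixes e :: "real \<Rightarrow> 'k::field_char_0" and u :: "'n::finite \<Rightarrow> 'k"
  assumes e: "comm_ring_hom e" and trans: "\<And>q. poly (map_poly e q) (mp_eval e u f) = 0 \<Longrightarrow> q = 0"
  shows "\<exists>d. (\<forall>g. mp_eval e u g = 0 \<longrightarrow> (\<Sum>t\<in>UNIV. mp_eval e u (pderivv t g) * d t) = 0)
    \<and> (\<Sum>t\<in>UNIV. mp_eval e u (pderivv t f) * d t) = 1"
proof -
  interpret e: comm_ring_hom e by fact
  interpret ev: comm_ring_hom "mp_eval e u" by (rule comm_ring_hom_mp_eval[OF e])
  let ?\<tau> = "mp_eval e u f"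
  define G0 where "G0 = {(e r, 0 :: 'k) | r. True}"
  have e0: "r = 0" if "e r = 0" for r
    using trans[of "[:r:]"] that by (simp add: hom_distribs)
  have G0: "derivation_graph e G0"
    unfolding derivation_graph_def G0_def by (auto simp flip: e.hom_add e.hom_mult)
  \<comment> \<open>A relation with coefficients among the constants is the image of a real
    polynomial, which is 0 by transcendence.\<close>
  have ext0: "extended_value ?\<tau> 1 g g' = 0" if g: "poly_pair G0 g g'" "poly g ?\<tau> = 0" for g g'
  proof -
    have c: "\<exists>r. coeff g i = e r" and c': "coeff g' i = 0" for i
      using g(1) by (auto simp: poly_pair_def G0_def)
    define q where "q = (\<Sum>i\<le>degree g. monom (SOME r. coeff g i = e r) i)"
    have "coeff (map_poly e q) i = coeff g i" for i
    proof -
      have "coeff q i = (if i \<le> degree g then SOME r. coeff g i = e r else 0)"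
        by (simp add: q_def coeff_sum)
      then show ?thesis
        using someI_ex[OF c[of i]] by (simp add: coeff_map_poly coeff_eq_0)
    qed
    then have q: "map_poly e q = g"
      by (rule poly_eqI)
    then have "q = 0"
      using g(2) trans by blast
    then have "g = 0" "g' = 0"
      using q c' by (auto intro: poly_eqI)
    then show ?thesis
      by (simp add: extended_value_def)
  qed
  have "\<exists>d H. derivation_graph e H \<and> (?\<tau>, 1) \<in> H \<and> (\<forall>t\<in>V. (u t, d t) \<in> H)" if "finite V" for V
    using that
  proof (induction V rule: finite_induct)
    case empty
    then show ?case
      using derivation_graph_adjoin[OF e G0 ext0] by auto
  next
    case (insert s V)
    then obtain d H where H: "derivation_graph e H" "(?\<tau>, 1) \<in> H" "\<forall>t\<in>V. (u t, d t) \<in> H"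
      by blast
    obtain w H' where H': "derivation_graph e H'" "H \<subseteq> H'" "(u s, w) \<in> H'"
      using derivation_graph_extend[OF e H(1), of "u s"] by blast
    then show ?case
      using H(2,3) insert.hyps(2) by (intro exI[of _ "d(s := w)"] exI[of _ H']) auto
  qed
  from this[OF finite[of UNIV]] obtain d H where H: "derivation_graph e H" "(?\<tau>, 1) \<in> H" "\<And>t. (u t, d t) \<in> H"
    by blast
  note HD = derivation_graphD[OF H(1)]
  have all: "(mp_eval e u g, \<Sum>t\<in>UNIV. mp_eval e u (pderivv t g) * d t) \<in> H" for g
  proof (induction g rule: mpoly_induct)
    case (const r)
    then show ?case
      using HD(1)[of r] by (simp add: pderivv_const mp_eval_single)
  next
    case (var s)
    have "(\<Sum>t\<in>UNIV. mp_eval e u (pderivv t (mvar s)) * d t) = (\<Sum>t\<in>UNIV. if t = s then d t else 0)"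
      unfolding pderivv_var by (intro sum.cong) auto
    moreover have "mp_eval e u (mvar s) = u s"
      by (simp add: mp_eval_single mon_eval_single)
    ultimately show ?case
      using H(3)[of s] by simp
  next
    case (add p q)
    then show ?case
      using HD(2)[OF add] by (simp add: pderivv_add ev.hom_add distrib_right sum.distrib)
  next
    case (mult p q)
    then show ?case
      using HD(3)[OF mult] by (simp add: pderivv_mult ev.hom_add ev.hom_mult distrib_right distrib_left sum.distrib
          sum_distrib_left sum_distrib_right ac_simps)
  qed
  show ?thesis
  proof (intro exI[of _ d] conjI allI impI)
    fix g assume "mp_eval e u g = 0"
    then show "(\<Sum>t\<in>UNIV. mp_eval e u (pderivv t g) * d t) = 0"
      using all[of g] HD(4) by simp
  next
    show "(\<Sum>t\<in>UNIV. mp_eval e u (pderivv t f) * d t) = 1"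
      by (rule derivation_graph_unique[OF e H(1) all H(2)])
  qed
qed

text \<open>For a derivation D over the constants the critical equation gives D f = sum of a_i D
  c_i. Each term vanishes, since a_i = 0 or c_i = 0 at \<open>u\<close>, and in the latter case D
  c_i = 0. This contradicts D f = 1.\<close>

lemma critical_value_algebraic:
  fixes e :: "real \<Rightarrow> 'k::field_char_0" and u :: "'n::finite \<Rightarrow> 'k"
  assumes e: "comm_ring_hom e" and "\<And>i. i \<in> A \<Longrightarrow> mp_eval e u (a i * c i) = 0"
    and crit: "\<And>t. mp_eval e u (pderivv t f) = (\<Sum>i\<in>A. mp_eval e u (a i) * mp_eval e u (pderivv t (c i)))"
  shows "\<exists>q. q \<noteq> 0 \<and> poly (map_poly e q) (mp_eval e u f) = 0"
proof (rule ccontr)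
  assume "\<not> ?thesis"
  then obtain d where d: "\<And>g. mp_eval e u g = 0 \<Longrightarrow> (\<Sum>t\<in>UNIV. mp_eval e u (pderivv t g) * d t) = 0"
    "(\<Sum>t\<in>UNIV. mp_eval e u (pderivv t f) * d t) = 1"
    using derivation_along_transcendental[OF e, of u f] by blast
  interpret ev: comm_ring_hom "mp_eval e u" by (rule comm_ring_hom_mp_eval[OF e])
  have "(\<Sum>t\<in>UNIV. mp_eval e u (pderivv t f) * d t)
    = (\<Sum>t\<in>UNIV. \<Sum>i\<in>A. mp_eval e u (a i) * (mp_eval e u (pderivv t (c i)) * d t))"
    by (simp add: crit sum_distrib_right mult.assoc)
  also have "\<dots> = (\<Sum>i\<in>A. mp_eval e u (a i) * (\<Sum>t\<in>UNIV. mp_eval e u (pderivv t (c i)) * d t))"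
    by (subst sum.swap) (simp add: sum_distrib_left)
  also have "\<dots> = 0"
  proof (intro sum.neutral ballI)
    fix i assume "i \<in> A"
    then have "mp_eval e u (a i) = 0 \<or> mp_eval e u (c i) = 0"
      using assms(2)[of i] by (simp add: ev.hom_mult)
    then show "mp_eval e u (a i) * (\<Sum>t\<in>UNIV. mp_eval e u (pderivv t (c i)) * d t) = 0"
      using d(1) by auto
  qed
  finally show False
    using d(2) by simp
qed

text \<open>The transferred family also contains q(f) and all f - v for the real roots v of q. The
  first makes f(w) a root v of q; then the sign of f - v, which is 0 at \<open>w\<close>, shows that
  f(u) is the constant v.\<close>

lemma real_critical_point:
  fixes e :: "real \<Rightarrow> 'r::real_closed_field" and u :: "'n::finite \<Rightarrow> 'r"
  assumes e: "comm_ring_hom e" and "finite F" and "\<And>i. i \<in> A \<Longrightarrow> mp_eval e u (a i * c i) = 0"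
    and crit: "\<And>t. mp_eval e u (pderivv t f) = (\<Sum>i\<in>A. mp_eval e u (a i) * mp_eval e u (pderivv t (c i)))"
  shows "\<exists>w. (\<forall>g\<in>F. same_sign (mp_eval e u g) (peval g w)) \<and> mp_eval e u f = e (peval f w)"
proof -
  interpret e: comm_ring_hom e by fact
  interpret ev: comm_ring_hom "mp_eval e u" by (rule comm_ring_hom_mp_eval[OF e])
  obtain q where q: "q \<noteq> 0" "poly (map_poly e q) (mp_eval e u f) = 0"
    using critical_value_algebraic[OF assms(1,3,4)] by auto
  define qf where "qf = poly (map_poly mconst q) f"
  have hom_qf: "h qf = poly (map_poly (\<lambda>r. h (mconst r)) q) (h f)" if "comm_ring_hom h" for h :: "'n mpoly \<Rightarrow> 'c::comm_ring_1"
  proof -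
    interpret h: comm_ring_hom h by fact
    interpret hp: map_poly_comm_ring_hom h ..
    show ?thesis
      unfolding qf_def h.poly_map_poly[symmetric] by (subst map_poly_map_poly) (auto simp: o_def)
  qed
  have "mp_eval e u qf = 0"
    using hom_qf[OF ev.comm_ring_hom_axioms] q(2) by (simp add: mp_eval_single)
  define V where "V = {v. poly q v = 0}"
  have "finite V"
    unfolding V_def by (rule poly_roots_finite[OF q(1)])
  then have "finite (F \<union> {qf} \<union> (\<lambda>v. f - mconst v) ` V)"
    using assms(2) by simp
  from real_point_same_signs[OF e this, of u] obtain w where
    w: "\<And>g. g \<in> F \<union> {qf} \<union> (\<lambda>v. f - mconst v) ` V \<Longrightarrow> same_sign (mp_eval e u g) (peval g w)"
    by blast
  have "peval qf w = 0"
    using w[of qf] \<open>mp_eval e u qf = 0\<close> by simp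
  then have "peval f w \<in> V"
    using hom_qf[OF peval.comm_ring_hom_axioms, of w] by (simp add: V_def)
  then have "same_sign (mp_eval e u (f - mconst (peval f w))) (peval (f - mconst (peval f w)) w)"
    by (intro w) auto
  then have "mp_eval e u f = e (peval f w)"
    by (simp add: peval.hom_minus ev.hom_minus mp_eval_single)
  then show ?thesis
    using w by blast
qed

section \<open>Real points of prime cones\<close>

text \<open>The hypotheses are the critical equations in the residue field of \<open>Q\<close>, and
  the conclusion makes \<open>f\<close> a real constant there. The families are indexed by natural
  numbers because the definition cannot quantify over an index type.\<close>

definition realizable :: "'n::finite mpoly set \<Rightarrow> bool" where
  "realizable Q \<longleftrightarrow> (\<forall>f F a c (m::nat). finite F \<longrightarrow> (\<forall>i<m. a i * c i \<in> support Q) \<longrightarrow>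
     (\<forall>t. pderivv t f - (\<Sum>i<m. a i * pderivv t (c i)) \<in> support Q) \<longrightarrow>
     (\<exists>w. (\<forall>g\<in>F. g \<in> Q \<longrightarrow> 0 \<le> peval g w) \<and> f - mconst (peval f w) \<in> support Q))"

lemma realizableD:
  fixes m :: nat
  assumes "realizable Q" "finite F" "\<forall>i<m. a i * c i \<in> support Q"
    "\<forall>t. pderivv t f - (\<Sum>i<m. a i * pderivv t (c i)) \<in> support Q"
  shows "\<exists>w. (\<forall>g\<in>F. g \<in> Q \<longrightarrow> 0 \<le> peval g w) \<and> f - mconst (peval f w) \<in> support Q"
  by (rule assms(1)[unfolded realizable_def, THEN spec, THEN spec, THEN spec, THEN spec, THEN spec,
        THEN mp, THEN mp, THEN mp, OF assms(2-4)])

text \<open>A type cannot depend on a cone given as a term, so the residue field is formed for one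
  globally chosen prime cone: a counterexample to realizability, if there is one.\<close>

definition test_cone :: "'n::finite mpoly set" where
  "test_cone = (SOME Q. prime_cone Q \<and> ((\<exists>Q'::'n mpoly set. prime_cone Q' \<and> \<not> realizable Q') \<longrightarrow> \<not> realizable Q))"

text \<open>Provides a prime cone in any case, so \<open>test_cone\<close> is prime even if no
  counterexample exists.\<close>

lemma prime_cone_nonneg_at_point: "prime_cone {g. 0 \<le> peval g x}"
  by (auto simp: prime_cone_def precone_def support_def hom_distribs peval.hom_uminus)

lemma test_cone:
  "prime_cone (test_cone :: 'n::finite mpoly set)"
  "(\<exists>Q'::'n mpoly set. prime_cone Q' \<and> \<not> realizable Q') \<Longrightarrow> \<not> realizable (test_cone :: 'n mpoly set)"
proof -
  have "\<exists>Q::'n mpoly set. prime_cone Q \<and> ((\<exists>Q'::'n mpoly set. prime_cone Q' \<and> \<not> realizable Q') \<longrightarrow> \<not> realizable Q)"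
    using prime_cone_nonneg_at_point by blast
  from someI_ex[OF this, folded test_cone_def] show "prime_cone (test_cone :: 'n mpoly set)"
    and "(\<exists>Q'::'n mpoly set. prime_cone Q' \<and> \<not> realizable Q') \<Longrightarrow> \<not> realizable (test_cone :: 'n mpoly set)"
    by auto
qed

lemmas test_coneD = prime_coneD[OF test_cone(1)]
lemmas test_preconeD = preconeD[OF test_coneD(1)]
lemmas test_support_mult = support_mult[OF test_coneD(1) test_coneD(3)]
lemmas test_support_add = support_add[OF test_coneD(1)]

lemma test_support_0: "0 \<in> support test_cone"
  using test_preconeD(4) by (simp add: support_def)

lemma test_cone_cong:
  assumes "a - b \<in> support test_cone" "a \<in> test_cone" shows "b \<in> test_cone"
  using test_preconeD(2)[OF assms(2), of "- (a - b)"] assms(1) by (simp add: support_def)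

\<comment> \<open>The ordered residue ring of the chosen prime cone\<close>
quotient_type (overloaded) 'n residue = "'n::finite mpoly" / "\<lambda>a b. a - b \<in> support test_cone"
  morphisms residue_rep residue_class
proof (rule equivpI)
  show "reflp (\<lambda>a b :: 'n mpoly. a - b \<in> support test_cone)"
    by (auto intro!: reflpI test_support_0)
  show "symp (\<lambda>a b :: 'n mpoly. a - b \<in> support test_cone)"
  proof (rule sympI)
    fix a b :: "'n mpoly" assume "a - b \<in> support test_cone"
    from support_uminus[OF this] show "b - a \<in> support test_cone" by simp
  qed
  show "transp (\<lambda>a b :: 'n mpoly. a - b \<in> support test_cone)"
  proof (rule transpI)
    fix a b c :: "'n mpoly" assume "a - b \<in> support test_cone" "b - c \<in> support test_cone"
    from test_support_add[OF this] show "a - c \<in> support test_cone" by simp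
  qed
qed

instantiation residue :: (finite) comm_ring_1
begin

lift_definition zero_residue :: "'a residue" is 0 .
lift_definition one_residue :: "'a residue" is 1 .

lift_definition plus_residue :: "'a residue \<Rightarrow> 'a residue \<Rightarrow> 'a residue" is "(+)"
proof -
  fix a b c d :: "'a mpoly" assume "a - b \<in> support test_cone" "c - d \<in> support test_cone"
  from test_support_add[OF this] show "a + c - (b + d) \<in> support test_cone" by (simp add: algebra_simps)
qed

lift_definition uminus_residue :: "'a residue \<Rightarrow> 'a residue" is uminus
proof -
  fix a b :: "'a mpoly" assume "a - b \<in> support test_cone"
  from support_uminus[OF this] show "- a - - b \<in> support test_cone" by simp
qed

lift_definition minus_residue :: "'a residue \<Rightarrow> 'a residue \<Rightarrow> 'a residue" is "(-)"
proof -
  fix a b c d :: "'a mpoly" assume "a - b \<in> support test_cone" "c - d \<in> support test_cone"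
  from test_support_add[OF this(1) support_uminus[OF this(2)]] show "a - c - (b - d) \<in> support test_cone"
    by (simp add: algebra_simps)
qed

lift_definition times_residue :: "'a residue \<Rightarrow> 'a residue \<Rightarrow> 'a residue" is "(*)"
proof -
  fix a b c d :: "'a mpoly" assume "a - b \<in> support test_cone" "c - d \<in> support test_cone"
  from test_support_add[OF test_support_mult[OF this(1), of c] test_support_mult[OF this(2), of b]]
  show "a * c - b * d \<in> support test_cone"
    by (simp add: algebra_simps)
qed

instance
proof
  show "(0 :: 'a residue) \<noteq> 1"
    by transfer (use test_coneD(2) in \<open>auto simp: support_def\<close>)
qed (transfer; use test_support_0 in \<open>simp add: algebra_simps\<close>)+

end

instantiation residue :: (finite) linordered_idom
begin

lift_definition less_eq_residue :: "'a residue \<Rightarrow> 'a residue \<Rightarrow> bool" is "\<lambda>a b. b - a \<in> test_cone"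
proof -
  fix a b c d :: "'a mpoly" assume ab: "a - b \<in> support test_cone" and cd: "c - d \<in> support test_cone"
  have 1: "(c - a) - (d - b) \<in> support test_cone"
    using test_support_add[OF cd support_uminus[OF ab]] by (simp add: algebra_simps)
  have 2: "(d - b) - (c - a) \<in> support test_cone"
    using support_uminus[OF 1] by (simp add: algebra_simps)
  show "c - a \<in> test_cone \<longleftrightarrow> d - b \<in> test_cone"
    using test_cone_cong[OF 1] test_cone_cong[OF 2] by blast
qed

definition less_residue :: "'a residue \<Rightarrow> 'a residue \<Rightarrow> bool"
  where "less_residue x y \<longleftrightarrow> x \<le> y \<and> x \<noteq> y"

definition abs_residue :: "'a residue \<Rightarrow> 'a residue"
  where "abs_residue x = (if x < 0 then - x else x)"

definition sgn_residue :: "'a residue \<Rightarrow> 'a residue"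
  where "sgn_residue x = (if x = 0 then 0 else if 0 < x then 1 else - 1)"

instance
proof
  fix x y z :: "'a residue"
  show refl: "x \<le> x"
    by transfer (simp add: test_preconeD(4))
  show antisym: "x \<le> y \<Longrightarrow> y \<le> x \<Longrightarrow> x = y"
    by transfer (simp add: support_def)
  show trans: "x \<le> y \<Longrightarrow> y \<le> z \<Longrightarrow> x \<le> z"
    by transfer (use test_preconeD(2) in fastforce)
  show "x \<le> y \<or> y \<le> x"
  proof transfer
    fix x y :: "'a mpoly"
    show "y - x \<in> test_cone \<or> x - y \<in> test_cone"
      using test_coneD(3)[of "y - x"] by simp
  qed
  show "x < y \<longleftrightarrow> x \<le> y \<and> \<not> y \<le> x"
    using antisym refl by (auto simp: less_residue_def)
  show "x \<le> y \<Longrightarrow> z + x \<le> z + y"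
    by transfer simp
  show "\<bar>x\<bar> = (if x < 0 then - x else x)"
    by (fact abs_residue_def)
  show "sgn x = (if x = 0 then 0 else if 0 < x then 1 else - 1)"
    by (fact sgn_residue_def)
  have mult: "0 \<le> z \<Longrightarrow> x \<le> y \<Longrightarrow> z * x \<le> z * y"
  proof transfer
    fix x y z :: "'a mpoly"
    assume "z - 0 \<in> test_cone" "y - x \<in> test_cone"
    then show "z * y - z * x \<in> test_cone"
      using test_preconeD(3)[of z "y - x"] by (simp add: right_diff_distrib)
  qed
  have no_zero_divisors: "a = 0 \<or> b = 0" if "a * b = 0" for a b :: "'a residue"
    using that
  proof transfer
    fix a b :: "'a mpoly"
    assume "a * b - 0 \<in> support test_cone"
    then show "a - 0 \<in> support test_cone \<or> b - 0 \<in> support test_cone"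
      using test_coneD(4)[of a b] by simp
  qed
  show "x < y \<Longrightarrow> 0 < z \<Longrightarrow> z * x < z * y"
    using mult no_zero_divisors[of z "x - y"] unfolding less_residue_def by (auto simp: right_diff_distrib)
qed

end

text \<open>The canonical map through the residue ring and its fraction field into the real closure;
  it is evaluation at the tuple of images of the variables
  (\<open>residue_point_eq_mp_eval\<close>).\<close>

definition residue_point :: "'n::finite mpoly \<Rightarrow> 'n residue fract real_closure" where
  "residue_point p = to_rc (Fract (residue_class p) 1)"

lemma comm_ring_hom_residue_point: "comm_ring_hom residue_point"
proof -
  note * = zero_residue.abs_eq[symmetric] one_residue.abs_eq[symmetric] plus_residue.abs_eq[symmetric] times_residue.abs_eq[symmetric]
  show ?thesis
    by unfold_locales (auto simp: residue_point_def * to_rc_hom[symmetric] Zero_fract_def One_fract_def)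
qed

lemma residue_point_nonneg: "p \<in> test_cone \<Longrightarrow> 0 \<le> residue_point p"
proof -
  assume "p \<in> test_cone"
  then have "0 \<le> residue_class p"
    by (simp add: zero_residue.abs_eq less_eq_residue.abs_eq)
  then show ?thesis
    by (auto simp: residue_point_def zero_le_Fract_iff intro: to_rc_nonneg)
qed

lemma residue_point_eq_0: "residue_point p = 0 \<longleftrightarrow> p \<in> support test_cone"
proof
  interpret comm_ring_hom residue_point by (rule comm_ring_hom_residue_point)
  assume "p \<in> support test_cone"
  then have "0 \<le> residue_point p" "0 \<le> residue_point (- p)"
    by (auto simp: support_def intro: residue_point_nonneg)
  then show "residue_point p = 0"
    by (simp add: hom_uminus)
next
  assume "residue_point p = 0"
  then have "Fract (residue_class p) 1 = 0"
    by (simp add: residue_point_def to_rc_eq_0)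
  then have "residue_class p = 0"
    by (simp add: Zero_fract_def eq_fract)
  then show "p \<in> support test_cone"
    by (simp add: zero_residue.abs_eq residue.abs_eq_iff)
qed

lemma residue_point_eq_mp_eval:
  "residue_point p = mp_eval (\<lambda>r. residue_point (mconst r)) (\<lambda>t. residue_point (mvar t)) p"
  using hom_mp_eval[OF comm_ring_hom_residue_point, of mconst mvar p] unfolding mp_eval_mconst_mvar .

lemma realizable_test_cone: "realizable (test_cone :: 'n::finite mpoly set)"
  unfolding realizable_def
proof (intro allI impI)
  fix f :: "'n mpoly" and F :: "'n mpoly set" and a c :: "nat \<Rightarrow> 'n mpoly" and m :: nat
  assume F: "finite F" and ac: "\<forall>i<m. a i * c i \<in> support test_cone"
    and crit: "\<forall>t. pderivv t f - (\<Sum>i<m. a i * pderivv t (c i)) \<in> support test_cone"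
  interpret rp: comm_ring_hom "residue_point :: 'n mpoly \<Rightarrow> _" by (rule comm_ring_hom_residue_point)
  let ?e = "\<lambda>r. residue_point (mconst r :: 'n mpoly)" and ?u = "\<lambda>t :: 'n. residue_point (mvar t)"
  interpret mc: comm_ring_hom "mconst :: real \<Rightarrow> 'n mpoly" by (rule comm_ring_hom_mconst)
  have e: "comm_ring_hom ?e"
    by unfold_locales (simp_all add: mc.hom_add mc.hom_mult rp.hom_add rp.hom_mult)
  note rp_eq = residue_point_eq_mp_eval[symmetric]
  have "\<exists>w. (\<forall>g\<in>F. same_sign (mp_eval ?e ?u g) (peval g w)) \<and> mp_eval ?e ?u f = ?e (peval f w)"
  proof (rule real_critical_point[OF e F, of "{..<m}"])
    show "mp_eval ?e ?u (a i * c i) = 0" if "i \<in> {..<m}" for i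
      using ac that unfolding rp_eq residue_point_eq_0 by simp
    show "mp_eval ?e ?u (pderivv t f) = (\<Sum>i\<in>{..<m}. mp_eval ?e ?u (a i) * mp_eval ?e ?u (pderivv t (c i)))" for t
      using crit[rule_format, of t, folded residue_point_eq_0] unfolding rp_eq
      by (simp add: rp.hom_minus rp.hom_sum rp.hom_mult)
  qed
  then obtain w where w: "\<And>g. g \<in> F \<Longrightarrow> same_sign (residue_point g) (peval g w)"
    "residue_point f = residue_point (mconst (peval f w))"
    unfolding rp_eq by blast
  show "\<exists>w. (\<forall>g\<in>F. g \<in> test_cone \<longrightarrow> 0 \<le> peval g w) \<and> f - mconst (peval f w) \<in> support test_cone"
  proof (intro exI[of _ w] conjI ballI impI)
    fix g assume "g \<in> F" "g \<in> test_cone"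
    then show "0 \<le> peval g w"
      using w(1)[of g] residue_point_nonneg[of g] by (auto simp: same_sign_def not_less[symmetric])
  next
    show "f - mconst (peval f w) \<in> support test_cone"
      unfolding residue_point_eq_0[symmetric] using w(2) by (simp add: rp.hom_minus)
  qed
qed

theorem prime_cone_realizable: "prime_cone Q \<Longrightarrow> realizable Q"
  using test_cone(2) realizable_test_cone by blast

section \<open>Degrees and truncations\<close>

lemma mdeg_eq_sum: "mdeg \<alpha> = (\<Sum>t\<in>UNIV. lookup \<alpha> t)" for \<alpha> :: "'n::finite \<Rightarrow>\<^sub>0 nat"
  unfolding mdeg_def by (intro sum.mono_neutral_left) (auto simp: in_keys_iff)

lemma mdeg_add: "mdeg (\<alpha> + \<beta>) = mdeg \<alpha> + mdeg \<beta>" for \<alpha> \<beta> :: "'n::finite \<Rightarrow>\<^sub>0 nat"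
  by (simp add: mdeg_eq_sum lookup_add sum.distrib)

lemma mdeg_0 [simp]: "mdeg 0 = 0"
  by (simp add: mdeg_def)

lemma mdeg_single [simp]: "mdeg (single t n) = n" for t :: "'n::finite"
  by (simp add: mdeg_eq_sum lookup_single when_def)

lemma pdeg_le_iff: "pdeg p \<le> d \<longleftrightarrow> (\<forall>\<alpha>\<in>keys p. mdeg \<alpha> \<le> d)"
  unfolding pdeg_def by (subst Max_le_iff) auto

lemma mdeg_le_pdeg: "\<alpha> \<in> keys p \<Longrightarrow> mdeg \<alpha> \<le> pdeg p"
  using pdeg_le_iff[of p "pdeg p"] by blast

lemma pdeg_0 [simp]: "pdeg 0 = 0"
  by (simp add: pdeg_def)

lemma pdeg_add_le: "pdeg p \<le> d \<Longrightarrow> pdeg q \<le> d \<Longrightarrow> pdeg (p + q) \<le> d"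
  unfolding pdeg_le_iff using Poly_Mapping.keys_add[of p q] by blast

lemma pdeg_uminus [simp]: "pdeg (- p) = pdeg p"
  by (simp add: pdeg_def keys_def)

lemma pdeg_diff_le: "pdeg p \<le> d \<Longrightarrow> pdeg q \<le> d \<Longrightarrow> pdeg (p - q) \<le> d"
  using pdeg_add_le[of p d "- q"] by simp

lemma pdeg_sum_le: "(\<And>i. i \<in> A \<Longrightarrow> pdeg (f i) \<le> d) \<Longrightarrow> pdeg (sum f A) \<le> d"
  by (induction A rule: infinite_finite_induct) (auto intro: pdeg_add_le)

lemma pdeg_mult_le: "pdeg (p * q) \<le> pdeg p + pdeg q" for p q :: "'n::finite mpoly"
  unfolding pdeg_le_iff
proof
  fix \<gamma> assume "\<gamma> \<in> keys (p * q)"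
  then obtain \<alpha> \<beta> where "\<alpha> \<in> keys p" "\<beta> \<in> keys q" "\<gamma> = \<alpha> + \<beta>"
    using keys_mult[of p q] by blast
  then show "mdeg \<gamma> \<le> pdeg p + pdeg q"
    by (simp add: mdeg_add add_mono mdeg_le_pdeg)
qed

lemma pdeg_single_le: "pdeg (single \<alpha> c) \<le> mdeg \<alpha>"
  by (auto simp: pdeg_le_iff)

lemma pdeg_mconst [simp]: "pdeg (mconst r) = 0"
  using pdeg_single_le[of 0 r] by simp

lemma pdeg_1 [simp]: "pdeg 1 = 0"
  using pdeg_mconst[of 1] by simp

lemma pdeg_power_le: "pdeg (p ^ n) \<le> n * pdeg p" for p :: "'n::finite mpoly"
proof (induction n)
  case (Suc n)
  then show ?case
    using pdeg_mult_le[of p "p ^ n"] by simp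
qed simp

lemma pdeg_square_le: "pdeg (p\<^sup>2) \<le> 2 * pdeg p" for p :: "'n::finite mpoly"
  by (rule pdeg_power_le)

lemma finite_mdeg_le: "finite {\<alpha> :: 'n::finite \<Rightarrow>\<^sub>0 nat. mdeg \<alpha> \<le> d}"
proof (rule finite_imageD)
  have "lookup ` {\<alpha> :: 'n \<Rightarrow>\<^sub>0 nat. mdeg \<alpha> \<le> d} \<subseteq> PiE UNIV (\<lambda>_. {..d})"
  proof
    fix l assume "l \<in> lookup ` {\<alpha> :: 'n \<Rightarrow>\<^sub>0 nat. mdeg \<alpha> \<le> d}"
    then obtain \<alpha> :: "'n \<Rightarrow>\<^sub>0 nat" where \<alpha>: "mdeg \<alpha> \<le> d" "l = lookup \<alpha>" by auto
    have "lookup \<alpha> t \<le> mdeg \<alpha>" for t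
      unfolding mdeg_eq_sum by (intro member_le_sum) auto
    then show "l \<in> PiE UNIV (\<lambda>_. {..d})"
      using \<alpha> order_trans by (auto simp: PiE_def)
  qed
  then show "finite (lookup ` {\<alpha> :: 'n \<Rightarrow>\<^sub>0 nat. mdeg \<alpha> \<le> d})"
    by (rule finite_subset) (intro finite_PiE; simp)
  show "inj_on lookup {\<alpha> :: 'n \<Rightarrow>\<^sub>0 nat. mdeg \<alpha> \<le> d}"
    by (intro inj_onI) (simp only: poly_mapping_eq_iff)
qed

lemma monomial_split:
  fixes \<delta> :: "'n::finite \<Rightarrow>\<^sub>0 nat"
  assumes "m \<le> mdeg \<delta>"
  shows "\<exists>\<alpha> \<beta>. \<delta> = \<alpha> + \<beta> \<and> mdeg \<alpha> = m"
  using assms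
proof (induction m)
  case 0
  show ?case
    by (intro exI[of _ 0] exI[of _ \<delta>]) auto
next
  case (Suc m)
  then obtain \<alpha> \<beta> where ab: "\<delta> = \<alpha> + \<beta>" "mdeg \<alpha> = m"
    by auto
  then have "mdeg \<beta> \<noteq> 0"
    using Suc.prems by (simp add: mdeg_add)
  then obtain t where t: "lookup \<beta> t \<noteq> 0"
    by (auto simp: mdeg_eq_sum)
  let ?s = "single t (1 :: nat)"
  have "\<beta> = ?s + (\<beta> - ?s)"
    using t by (intro poly_mapping_eqI) (auto simp: lookup_add lookup_minus lookup_single when_def)
  then have "\<delta> = (\<alpha> + ?s) + (\<beta> - ?s)"
    unfolding ab(1) by (metis add.assoc)
  moreover have "mdeg (\<alpha> + ?s) = Suc m"
    using ab(2) by (simp add: mdeg_add)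
  ultimately show ?case
    by blast
qed

text \<open>Entries of localizing matrices are indexed by pairs of monomials, so a monomial
  multiplier has to be split evenly.\<close>

lemma monomial_halves:
  fixes \<delta> :: "'n::finite \<Rightarrow>\<^sub>0 nat"
  assumes "mdeg \<delta> \<le> 2 * n"
  shows "\<exists>\<alpha> \<beta>. \<delta> = \<alpha> + \<beta> \<and> mdeg \<alpha> \<le> n \<and> mdeg \<beta> \<le> n"
proof -
  obtain \<alpha> \<beta> where "\<delta> = \<alpha> + \<beta>" "mdeg \<alpha> = min n (mdeg \<delta>)"
    using monomial_split[of "min n (mdeg \<delta>)" \<delta>] by auto
  then show ?thesis
    using assms by (intro exI[of _ \<alpha>] exI[of _ \<beta>]) (auto simp: mdeg_add)
qed

lemma ceiling_half: "\<lceil>real d / 2\<rceil> = (int d + 1) div 2"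
  by (intro ceiling_unique) (auto simp: field_simps; linarith)+

lemma mem_loc_index: "\<alpha> \<in> loc_index k q \<longleftrightarrow> 2 * mdeg \<alpha> + pdeg q \<le> 2 * k"
  unfolding loc_index_def ceiling_half mem_Collect_eq by presburger

lemma finite_loc_index: "finite (loc_index k (q :: 'n::finite mpoly))"
  by (rule finite_subset[OF _ finite_mdeg_le[of k]]) (auto simp: mem_loc_index)

section \<open>The Riesz functional\<close>

lemma riesz_superset:
  assumes "finite A" "keys p \<subseteq> A"
  shows "riesz p y = (\<Sum>\<alpha>\<in>A. lookup p \<alpha> * y \<alpha>)"
  unfolding riesz_def using assms by (intro sum.mono_neutral_left) (auto simp: in_keys_iff)

lemma riesz_single: "riesz (single \<alpha> c) y = c * y \<alpha>"
  by (subst riesz_superset[of "{\<alpha>}"]) auto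

lemma riesz_add: "riesz (p + q) y = riesz p y + riesz q y"
  by (subst (1 2 3) riesz_superset[of "keys p \<union> keys q"])
    (use Poly_Mapping.keys_add[of p q] in \<open>auto simp: lookup_add distrib_right sum.distrib\<close>)

lemma riesz_0 [simp]: "riesz 0 y = 0"
  by (simp add: riesz_def)

lemma riesz_sum: "riesz (sum f A) y = (\<Sum>a\<in>A. riesz (f a) y)"
  by (induction A rule: infinite_finite_induct) (simp_all add: riesz_add)

lemma riesz_scale: "riesz (mconst c * p) y = c * riesz p y"
proof -
  have "mconst c * p = (\<Sum>\<alpha>\<in>keys p. mconst c * single \<alpha> (lookup p \<alpha>))"
    unfolding sum_distrib_left[symmetric] using mpoly_eq_sum[of p] by simp
  then show ?thesis
    by (simp add: riesz_sum riesz_single mult_single riesz_def[of p] sum_distrib_left mult.assoc)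
qed

text \<open>Products of two index monomials reach every degree up to 2n, where n is half of 2k -
  \<open>pdeg h\<close> rounded down. Rounding loses at most one degree, which the slack of 2
  absorbs.\<close>

lemma riesz_loc_zero:
  fixes h a :: "'n::finite mpoly"
  assumes "loc_zero k h y" "pdeg h + pdeg a + 2 \<le> 2 * k"
  shows "riesz (h * a) y = 0"
proof -
  have "riesz (h * single \<delta> c) y = 0" if \<delta>: "mdeg \<delta> \<le> pdeg a" for \<delta> c
  proof -
    define n where "n = (2 * k - pdeg h) div 2"
    obtain \<alpha> \<beta> where ab: "\<delta> = \<alpha> + \<beta>" "mdeg \<alpha> \<le> n" "mdeg \<beta> \<le> n"
      using monomial_halves[of \<delta> n] \<delta> assms(2) unfolding n_def by fastforce
    then have "\<alpha> \<in> loc_index k h" "\<beta> \<in> loc_index k h"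
      using assms(2) unfolding mem_loc_index n_def by presburger+
    then have "riesz (h * single \<alpha> 1 * single \<beta> 1) y = 0"
      using assms(1) by (simp add: loc_zero_def loc_matrix_def)
    moreover have "h * single \<delta> c = mconst c * (h * single \<alpha> 1 * single \<beta> 1)"
    proof -
      have "single \<delta> c = mconst c * (single \<alpha> 1 * single \<beta> 1)"
        by (simp add: ab(1) mult_single)
      then show ?thesis
        by (simp add: ac_simps)
    qed
    ultimately show ?thesis
      by (simp add: riesz_scale)
  qed
  moreover have "h * a = (\<Sum>\<delta>\<in>keys a. h * single \<delta> (lookup a \<delta>))"
    unfolding sum_distrib_left[symmetric] using mpoly_eq_sum[of a] by simp
  ultimately show ?thesis
    by (simp add: riesz_sum mdeg_le_pdeg)
qed

text \<open>The value is the quadratic form of the localizing matrix at the coefficient vector of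
  \<open>s\<close>.\<close>

lemma riesz_loc_psd:
  fixes g s :: "'n::finite mpoly"
  assumes "loc_psd k g y" "pdeg g + 2 * pdeg s \<le> 2 * k"
  shows "0 \<le> riesz (g * s\<^sup>2) y"
proof -
  let ?B = "loc_index k g" and ?v = "lookup s"
  have sub: "keys s \<subseteq> ?B"
    using assms(2) mdeg_le_pdeg[of _ s] by (fastforce simp: mem_loc_index)
  have s: "s = (\<Sum>\<alpha>\<in>?B. single \<alpha> (?v \<alpha>))"
  proof -
    have "(\<Sum>\<alpha>\<in>keys s. single \<alpha> (?v \<alpha>)) = (\<Sum>\<alpha>\<in>?B. single \<alpha> (?v \<alpha>))"
      using sub finite_loc_index by (intro sum.mono_neutral_left) (auto simp: in_keys_iff)
    then show ?thesis
      using mpoly_eq_sum[of s] by simp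
  qed
  have "g * s\<^sup>2 = (\<Sum>\<alpha>\<in>?B. \<Sum>\<beta>\<in>?B. mconst (?v \<alpha> * ?v \<beta>) * (g * single \<alpha> 1 * single \<beta> 1))"
  proof -
    have "s\<^sup>2 = (\<Sum>\<alpha>\<in>?B. \<Sum>\<beta>\<in>?B. single \<alpha> (?v \<alpha>) * single \<beta> (?v \<beta>))"
      unfolding power2_eq_square sum_product[symmetric] using s by simp
    also have "\<dots> = (\<Sum>\<alpha>\<in>?B. \<Sum>\<beta>\<in>?B. mconst (?v \<alpha> * ?v \<beta>) * (single \<alpha> 1 * single \<beta> 1))"
      by (simp add: mult_single)
    finally show ?thesis
      by (simp add: sum_distrib_left ac_simps)
  qed
  then have "riesz (g * s\<^sup>2) y = (\<Sum>\<alpha>\<in>?B. \<Sum>\<beta>\<in>?B. ?v \<alpha> * loc_matrix k g y \<alpha> \<beta> * ?v \<beta>)"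
    by (simp only: riesz_sum riesz_scale loc_matrix_def) (simp add: ac_simps)
  also have "\<dots> \<ge> 0"
    using assms(1) by (simp add: loc_psd_def psd_on_def)
  finally show ?thesis .
qed

text \<open>The truncated moment vector of the point mass at \<open>x\<close>.\<close>

definition point_moments :: "nat \<Rightarrow> ('n::finite \<Rightarrow> real) \<Rightarrow> ('n \<Rightarrow>\<^sub>0 nat) \<Rightarrow> real" where
  "point_moments k x \<alpha> = (if mdeg \<alpha> \<le> 2 * k then mon_eval x \<alpha> else 0)"

lemma point_moments_tms: "point_moments k x \<in> tms k"
  by (simp add: point_moments_def tms_def)

lemma riesz_point_moments: "pdeg p \<le> 2 * k \<Longrightarrow> riesz p (point_moments k x) = peval p x"
  unfolding riesz_def peval_eq_mp_eval mp_eval_def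
  by (intro sum.cong) (auto simp: point_moments_def dest: mdeg_le_pdeg)

lemma loc_matrix_point_moments:
  fixes q :: "'n::finite mpoly"
  assumes "\<alpha> \<in> loc_index k q" "\<beta> \<in> loc_index k q"
  shows "loc_matrix k q (point_moments k x) \<alpha> \<beta> = peval q x * mon_eval x \<alpha> * mon_eval x \<beta>"
proof -
  have "pdeg (q * single \<alpha> 1 * single \<beta> 1) \<le> pdeg q + mdeg \<alpha> + mdeg \<beta>"
    using pdeg_mult_le[of "q * single \<alpha> 1" "single \<beta> 1"] pdeg_mult_le[of q "single \<alpha> 1"]
      pdeg_single_le[of \<alpha> 1] pdeg_single_le[of \<beta> 1] by linarith
  also have "\<dots> \<le> 2 * k"
    using assms by (simp add: mem_loc_index)
  finally have "loc_matrix k q (point_moments k x) \<alpha> \<beta> = peval (q * single \<alpha> 1 * single \<beta> 1) x"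
    unfolding loc_matrix_def by (rule riesz_point_moments)
  then show ?thesis
    unfolding peval.hom_mult by (simp add: peval_eq_mp_eval mp_eval_single)
qed

lemma loc_zero_point_moments: "peval q x = 0 \<Longrightarrow> loc_zero k q (point_moments k x)" for q :: "'n::finite mpoly"
  by (simp add: loc_zero_def loc_matrix_point_moments)

lemma loc_psd_point_moments: "0 \<le> peval q x \<Longrightarrow> loc_psd k q (point_moments k x)" for q :: "'n::finite mpoly"
proof -
  assume q: "0 \<le> peval q x"
  have "(\<Sum>\<alpha>\<in>loc_index k q. \<Sum>\<beta>\<in>loc_index k q. v \<alpha> * loc_matrix k q (point_moments k x) \<alpha> \<beta> * v \<beta>)
    = peval q x * (\<Sum>\<alpha>\<in>loc_index k q. v \<alpha> * mon_eval x \<alpha>)\<^sup>2" for v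
    by (simp add: loc_matrix_point_moments power2_eq_square sum_product sum_distrib_left ac_simps)
  then show ?thesis
    using q by (simp add: loc_psd_def psd_on_def)
qed

section \<open>Square roots modulo a split polynomial\<close>

text \<open>A Hensel step for each factor: \<open>s\<close> is replaced by s + c Q. If v is a new
  root, c makes the value at v equal to the square root of v - \<gamma>; if v is repeated, the
  equation for c is linear with leading coefficient 2 s(v), which is nonzero because s(v)^2 = v -
  \<gamma>.\<close>

lemma sqrt_mod_split_poly:
  fixes \<gamma> :: real
  assumes "\<forall>v\<in>set vs. \<gamma> < v"
  shows "\<exists>s. (\<Prod>v\<leftarrow>vs. [:- v, 1:]) dvd s\<^sup>2 - [:- \<gamma>, 1:]"
  using assms
proof (induction vs)
  case (Cons v vs)
  let ?Q = "\<Prod>v\<leftarrow>vs. [:- v, 1:]"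
  obtain s h where s: "s\<^sup>2 - [:- \<gamma>, 1:] = ?Q * h"
    using Cons by (auto elim!: dvdE)
  have v: "\<gamma> < v"
    using Cons.prems by simp
  have ev: "poly s v * poly s v - (v - \<gamma>) = poly ?Q v * poly h v"
    using arg_cong[OF s, of "\<lambda>p. poly p v"] by (simp add: power2_eq_square)
  obtain c where c: "poly h v + 2 * c * poly s v + c\<^sup>2 * poly ?Q v = 0"
  proof (cases "poly ?Q v = 0")
    case True
    then have "poly s v \<noteq> 0"
      using ev v by auto
    then show ?thesis
      using that[of "- poly h v / (2 * poly s v)"] True by (simp add: field_simps)
  next
    case False
    define c where "c = (sqrt (v - \<gamma>) - poly s v) / poly ?Q v"
    have "poly s v + c * poly ?Q v = sqrt (v - \<gamma>)"
      using False by (simp add: c_def)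
    then have "(poly s v + c * poly ?Q v)\<^sup>2 = v - \<gamma>"
      using v by simp
    then have "poly ?Q v * (poly h v + 2 * c * poly s v + c\<^sup>2 * poly ?Q v) = 0"
      using ev by (simp add: power2_eq_square algebra_simps)
    then show ?thesis
      using that False by simp
  qed
  let ?k = "h + [:2 * c:] * s + [:c\<^sup>2:] * ?Q"
  have "poly ?k v = 0"
    using c by simp
  then have "[:- v, 1:] dvd ?k"
    by (simp only: poly_eq_0_iff_dvd)
  moreover have "(s + [:c:] * ?Q)\<^sup>2 - [:- \<gamma>, 1:] = ?Q * ?k"
  proof -
    have "(s + C * q)\<^sup>2 - g = (s\<^sup>2 - g) + q * ((C + C) * s + (C * C) * q)" for C q g :: "real poly"
      by (simp add: power2_eq_square algebra_simps)
    note * = this[of "[:c:]" ?Q "[:- \<gamma>, 1:]"]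
    have cc: "[:c:] + [:c:] = [:2 * c:]" "[:c:] * [:c:] = [:c\<^sup>2:]"
      by (simp_all add: power2_eq_square)
    show ?thesis
      using * unfolding s cc by (simp only: distrib_left add.assoc)
  qed
  ultimately have "[:- v, 1:] * ?Q dvd (s + [:c:] * ?Q)\<^sup>2 - [:- \<gamma>, 1:]"
    using mult_dvd_mono[of "[:- v, 1:]" ?k ?Q ?Q] by (simp only: mult.commute[of ?Q] dvd_refl)
  then show ?case
    unfolding list.map prod_list.Cons by (rule exI)
qed simp

text \<open>Taking the square root modulo \<open>Q\<close> bounds both degrees by that of
  \<open>Q\<close>, whatever \<gamma> is.\<close>

lemma linear_eq_square_plus_multiple:
  fixes \<gamma> :: real
  assumes "\<forall>v\<in>set vs. \<gamma> < v"
  defines "Q \<equiv> (\<Prod>v\<leftarrow>vs. [:- v, 1:])"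
  shows "\<exists>s w. [:- \<gamma>, 1:] = s\<^sup>2 + w * Q \<and> degree s \<le> degree Q \<and> degree w \<le> 2 * degree Q + 1"
proof -
  have Q: "Q \<noteq> 0"
    unfolding Q_def by (auto simp: prod_list_zero_iff)
  obtain r where r: "Q dvd r\<^sup>2 - [:- \<gamma>, 1:]"
    using sqrt_mod_split_poly[OF assms(1)] unfolding Q_def by blast
  define s where "s = r mod Q"
  have "Q dvd r - s"
    unfolding s_def by (simp add: minus_mod_eq_mult_div)
  then have "Q dvd (r - s) * (r + s)"
    by (rule dvd_mult2)
  then have "Q dvd (r\<^sup>2 - [:- \<gamma>, 1:]) - (r - s) * (r + s)"
    using r by (rule dvd_diff[rotated])
  then have "Q dvd s\<^sup>2 - [:- \<gamma>, 1:]"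
    by (simp add: power2_eq_square algebra_simps)
  then obtain k where k: "s\<^sup>2 - [:- \<gamma>, 1:] = Q * k"
    by (elim dvdE)
  have ds: "degree s \<le> degree Q"
    unfolding s_def using degree_mod_less[OF Q, of r] by (cases "r mod Q = 0") auto
  have "degree k \<le> 2 * degree Q + 1"
  proof (cases "k = 0")
    case False
    then have "degree Q + degree k = degree (s\<^sup>2 - [:- \<gamma>, 1:])"
      unfolding k using Q by (simp add: degree_mult_eq)
    also have "\<dots> \<le> 2 * degree Q + 1"
    proof (rule degree_diff_le)
      have "degree (s\<^sup>2) \<le> degree s * 2"
        by (rule degree_power_le)
      then show "degree (s\<^sup>2) \<le> 2 * degree Q + 1"
        using ds by linarith
    qed simp
    finally show ?thesis
      by simp
  qed simp
  moreover have "[:- \<gamma>, 1:] = s\<^sup>2 + (- k) * Q"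
    using k by (simp add: algebra_simps)
  ultimately show ?thesis
    using ds by (intro exI[of _ s] exI[of _ "- k"]) auto
qed

section \<open>Certificates of bounded degree\<close>

inductive_set preord :: "'a set \<Rightarrow> ('a \<Rightarrow> 'n::finite mpoly) \<Rightarrow> 'n mpoly set" for G g where
  zero: "0 \<in> preord G g"
| add: "b \<in> preord G g \<Longrightarrow> S \<subseteq> G \<Longrightarrow> b + gpow g S * q\<^sup>2 \<in> preord G g"

lemma preord_add:
  assumes "a \<in> preord G g" "b \<in> preord G g" shows "a + b \<in> preord G g"
  using assms(2)
proof induction
  case (add b S q)
  then show ?case
    using preord.add[of "a + b" G g S q] by (simp add: add.assoc)
qed (use assms(1) in simp)

lemma preord_gen: "S \<subseteq> G \<Longrightarrow> gpow g S * q\<^sup>2 \<in> preord G g"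
  using preord.add[OF preord.zero, of S G g q] by simp

text \<open>Common factors occur twice and form a square; this is why products of distinct
  generators suffice for a multiplicatively closed cone.\<close>

lemma gpow_mult:
  assumes "finite S" "finite S'"
  shows "gpow g S * gpow g S' = gpow g ((S - S') \<union> (S' - S)) * (gpow g (S \<inter> S'))\<^sup>2"
proof -
  have "gpow g S = gpow g (S - S') * gpow g (S \<inter> S')"
    unfolding gpow_def using assms by (subst prod.union_disjoint[symmetric]) (auto intro: arg_cong2[where f = prod])
  moreover have "gpow g S' = gpow g (S' - S) * gpow g (S \<inter> S')"
    unfolding gpow_def using assms by (subst prod.union_disjoint[symmetric]) (auto intro: arg_cong2[where f = prod])
  moreover have "gpow g ((S - S') \<union> (S' - S)) = gpow g (S - S') * gpow g (S' - S)"
    unfolding gpow_def using assms by (intro prod.union_disjoint) auto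
  ultimately show ?thesis
    by (simp add: power2_eq_square ac_simps)
qed

lemma preord_mult:
  assumes "finite G" "a \<in> preord G g" "b \<in> preord G g" shows "a * b \<in> preord G g"
  using assms(3)
proof induction
  case (add b S q)
  have "a * (gpow g S * q\<^sup>2) \<in> preord G g"
    using assms(2)
  proof induction
    case (add c S' r)
    have fin: "finite S" "finite S'"
      using add.hyps \<open>S \<subseteq> G\<close> assms(1) finite_subset by blast+
    have "(gpow g S' * r\<^sup>2) * (gpow g S * q\<^sup>2) = (gpow g S' * gpow g S) * (r * q)\<^sup>2"
      by (simp add: power_mult_distrib ac_simps)
    also have "\<dots> = gpow g ((S' - S) \<union> (S - S')) * (gpow g (S' \<inter> S) * (r * q))\<^sup>2"
      unfolding gpow_mult[OF fin(2,1)] by (simp add: power_mult_distrib ac_simps)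
    finally have "(gpow g S' * r\<^sup>2) * (gpow g S * q\<^sup>2) \<in> preord G g"
      using add.hyps \<open>S \<subseteq> G\<close> by (simp only:) (intro preord_gen, blast)
    then show ?case
      using preord_add[OF add.IH] by (simp only: distrib_right)
  qed (simp add: preord.zero)
  then show ?case
    using preord_add[OF add.IH] by (simp only: distrib_left)
qed (simp add: preord.zero)

lemma preord_normal_form:
  assumes "finite G" "b \<in> preord G g"
  shows "\<exists>\<sigma> (m::nat). b = (\<Sum>S\<in>Pow G. gpow g S * (\<Sum>j<m. (\<sigma> S j)\<^sup>2))"
  using assms(2)
proof induction
  case zero
  show ?case
    by (intro exI[of _ "\<lambda>_ _. 0"] exI[of _ 0]) simp
next
  case (add b S q)
  then obtain \<sigma> and m :: nat where b: "b = (\<Sum>S\<in>Pow G. gpow g S * (\<Sum>j<m. (\<sigma> S j)\<^sup>2))"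
    by blast
  \<comment> \<open>The same number of squares is used for every subset, so the new square is
    matched by a 0 elsewhere.\<close>
  define \<tau> where "\<tau> = (\<lambda>S' j. if j = m then (if S' = S then q else 0) else \<sigma> S' j)"
  have "(\<Sum>S'\<in>Pow G. gpow g S' * (\<Sum>j<Suc m. (\<tau> S' j)\<^sup>2))
    = (\<Sum>S'\<in>Pow G. gpow g S' * (\<Sum>j<m. (\<sigma> S' j)\<^sup>2) + (if S' = S then gpow g S * q\<^sup>2 else 0))"
    by (intro sum.cong) (auto simp: \<tau>_def distrib_left)
  also have "\<dots> = b + gpow g S * q\<^sup>2"
    using add.hyps assms(1) by (simp add: sum.distrib b sum.delta')
  finally show ?case
    by (intro exI[of _ \<tau>] exI[of _ "Suc m"]) (rule sym)
qed

text \<open>The squares are bounded one by one because the Riesz functional is applied to them one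
  by one.\<close>

definition certified :: "'b set \<Rightarrow> ('b \<Rightarrow> 'n::finite mpoly) \<Rightarrow> 'a set \<Rightarrow> ('a \<Rightarrow> 'n mpoly) \<Rightarrow> nat \<Rightarrow> 'n mpoly \<Rightarrow> bool" where
  "certified H h G g k p \<longleftrightarrow> (\<exists>a \<sigma> (m::nat).
     p = (\<Sum>i\<in>H. h i * a i) + (\<Sum>S\<in>Pow G. gpow g S * (\<Sum>j<m. (\<sigma> S j)\<^sup>2)) \<and>
     (\<forall>i\<in>H. pdeg (h i) + pdeg (a i) \<le> 2 * k) \<and>
     (\<forall>S\<in>Pow G. \<forall>j<m. pdeg (gpow g S) + 2 * pdeg (\<sigma> S j) \<le> 2 * k) \<and>
     (\<forall>S\<in>Pow G. pdeg (gpow g S) \<le> 2 * k))"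

lemma certified_truncations:
  assumes "certified H h G g k p" "k \<le> k'"
  shows "\<exists>a b. a \<in> trunc_ideal H h k' \<and> b \<in> trunc_preord G g k' \<and> p = a + b"
proof -
  from assms(1) obtain a \<sigma> and m :: nat where p: "p = (\<Sum>i\<in>H. h i * a i) + (\<Sum>S\<in>Pow G. gpow g S * (\<Sum>j<m. (\<sigma> S j)\<^sup>2))"
    and a': "\<forall>i\<in>H. pdeg (h i) + pdeg (a i) \<le> 2 * k"
    and \<sigma>': "\<forall>S\<in>Pow G. \<forall>j<m. pdeg (gpow g S) + 2 * pdeg (\<sigma> S j) \<le> 2 * k"
    and \<sigma>0': "\<forall>S\<in>Pow G. pdeg (gpow g S) \<le> 2 * k"
    unfolding certified_def by (elim exE conjE)
  note a = a'[rule_format] and \<sigma> = \<sigma>'[rule_format] and \<sigma>0 = \<sigma>0'[rule_format]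
  have "(\<Sum>i\<in>H. h i * a i) \<in> trunc_ideal H h k'"
    unfolding trunc_ideal_def polys_le_def
  proof (intro CollectI exI[of _ a] conjI ballI refl)
    fix i assume "i \<in> H"
    then show "a i = 0 \<or> int (pdeg (a i)) \<le> 2 * int k' - int (pdeg (h i))"
      using a[of i] assms(2) by simp
  qed
  moreover have "(\<Sum>S\<in>Pow G. gpow g S * (\<Sum>j<m. (\<sigma> S j)\<^sup>2)) \<in> trunc_preord G g k'"
    unfolding trunc_preord_def SOS_le_def polys_le_def
  proof (intro CollectI exI[of _ "\<lambda>S. \<Sum>j<m. (\<sigma> S j)\<^sup>2"] conjI ballI refl IntI)
    fix S assume S: "S \<in> Pow G"
    show "(\<Sum>j<m. (\<sigma> S j)\<^sup>2) \<in> SOS"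
      unfolding SOS_def by (intro CollectI exI[of _ "{..<m}"] exI[of _ "\<sigma> S"]) simp
    have "pdeg (\<Sum>j<m. (\<sigma> S j)\<^sup>2) \<le> 2 * k - pdeg (gpow g S)"
    proof (rule pdeg_sum_le)
      fix j assume "j \<in> {..<m}"
      then show "pdeg ((\<sigma> S j)\<^sup>2) \<le> 2 * k - pdeg (gpow g S)"
        using pdeg_square_le[of "\<sigma> S j"] \<sigma>[OF S, of j] by simp
    qed
    then show "(\<Sum>j<m. (\<sigma> S j)\<^sup>2) = 0 \<or> int (pdeg (\<Sum>j<m. (\<sigma> S j)\<^sup>2)) \<le> 2 * int k' - int (pdeg (gpow g S))"
      using \<sigma>0[OF S] assms(2) by linarith
  qed
  ultimately show ?thesis
    using p by blast
qed

text \<open>The order is raised by one because the localizing matrix of a polynomial of odd degree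
  does not see multipliers of the maximal degree allowed in the truncated ideal.\<close>

lemma certified_riesz_nonneg:
  assumes "certified H h G g k p" "k < k'" "\<forall>s\<in>H. loc_zero k' (h s) y" "\<forall>S\<in>Pow G. loc_psd k' (gpow g S) y"
  shows "0 \<le> riesz p y"
proof -
  from assms(1) obtain a \<sigma> and m :: nat where p: "p = (\<Sum>i\<in>H. h i * a i) + (\<Sum>S\<in>Pow G. gpow g S * (\<Sum>j<m. (\<sigma> S j)\<^sup>2))"
    and a': "\<forall>i\<in>H. pdeg (h i) + pdeg (a i) \<le> 2 * k"
    and \<sigma>': "\<forall>S\<in>Pow G. \<forall>j<m. pdeg (gpow g S) + 2 * pdeg (\<sigma> S j) \<le> 2 * k"
    and \<sigma>0': "\<forall>S\<in>Pow G. pdeg (gpow g S) \<le> 2 * k"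
    unfolding certified_def by (elim exE conjE)
  note a = a'[rule_format] and \<sigma> = \<sigma>'[rule_format] and \<sigma>0 = \<sigma>0'[rule_format]
  have "riesz (\<Sum>i\<in>H. h i * a i) y = 0"
    unfolding riesz_sum
  proof (intro sum.neutral ballI)
    fix i assume i: "i \<in> H"
    then show "riesz (h i * a i) y = 0"
      using assms(2,3) a[OF i] by (intro riesz_loc_zero[of k']) auto
  qed
  moreover have "0 \<le> riesz (\<Sum>S\<in>Pow G. gpow g S * (\<Sum>j<m. (\<sigma> S j)\<^sup>2)) y"
    unfolding sum_distrib_left riesz_sum
  proof (intro sum_nonneg)
    fix S j assume S: "S \<in> Pow G" and "j \<in> {..<m}"
    then show "0 \<le> riesz (gpow g S * (\<sigma> S j)\<^sup>2) y"
      using assms(2,4) \<sigma>[OF S, of j] by (intro riesz_loc_psd[of k']) auto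
  qed
  ultimately show ?thesis
    unfolding p riesz_add by simp
qed

lemma pdeg_poly_map_poly:
  fixes f :: "'n::finite mpoly"
  shows "pdeg (poly (map_poly mconst r) f) \<le> degree r * pdeg f"
  unfolding poly_altdef
proof (rule pdeg_sum_le)
  fix i assume i: "i \<in> {..degree (map_poly mconst r :: 'n mpoly poly)}"
  have "pdeg (coeff (map_poly mconst r) i * f ^ i) \<le> pdeg (f ^ i)"
    using pdeg_mult_le[of "coeff (map_poly mconst r) i" "f ^ i"] by (simp add: coeff_map_poly)
  also have "\<dots> \<le> i * pdeg f"
    by (rule pdeg_power_le)
  also have "\<dots> \<le> degree r * pdeg f"
    using i degree_map_poly_le[of "mconst :: real \<Rightarrow> 'n mpoly" r] by (intro mult_right_mono) auto
  finally show "pdeg (coeff (map_poly mconst r) i * f ^ i) \<le> degree r * pdeg f" .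
qed

text \<open>From \<open>-q(f)\<^sup>2\<close> in the cone, where all roots of \<open>q\<close> exceed \<open>\<gamma>\<close>: writing
  \<open>t - \<gamma> = s\<^sup>2 + w q\<^sup>2\<close> and \<open>w\<close> as a difference of two squares puts \<open>f - \<gamma>\<close> into the cone, with
  degrees that do not depend on \<open>\<gamma>\<close>.\<close>

lemma certified_uniformly:
  fixes f :: "'n::finite mpoly"
  assumes fin: "finite H" "finite G" and b: "b \<in> preord G g"
    and neg: "- ((\<Prod>v\<leftarrow>vs. f - mconst v) * (\<Prod>v\<leftarrow>vs. f - mconst v)) = (\<Sum>i\<in>H. h i * a i) + b"
  shows "\<exists>k. \<forall>\<gamma>. (\<forall>v\<in>set vs. \<gamma> < v) \<longrightarrow> certified H h G g k (f - mconst \<gamma>)"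
proof -
  let ?q = "\<Prod>v\<leftarrow>vs. f - mconst v"
  obtain \<sigma> and m :: nat where b_eq: "b = (\<Sum>S\<in>Pow G. gpow g S * (\<Sum>j<m. (\<sigma> S j)\<^sup>2))"
    using preord_normal_form[OF fin(2) b] by blast
  \<comment> \<open>The modulus is q^2, hence the doubled list. \<open>W\<close> bounds the degrees
    of all factors that will depend on \<gamma>, and \<open>k\<close> adds up everything else;
    neither depends on \<gamma>.\<close>
  define D where "D = degree (\<Prod>v\<leftarrow>vs @ vs. [:- v, 1 :: real:])"
  define W where "W = (2 * D + 1) * pdeg f + pdeg ?q"
  define k where "k = (\<Sum>i\<in>H. pdeg (h i) + pdeg (a i)) + (\<Sum>S\<in>Pow G. pdeg (gpow g S) + (\<Sum>j<m. pdeg (\<sigma> S j))) + W"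
  have kH: "pdeg (h i) + pdeg (a i) + W \<le> k" if "i \<in> H" for i
    using member_le_sum[OF that, of "\<lambda>i. pdeg (h i) + pdeg (a i)"] fin(1) unfolding k_def by simp
  have kG: "pdeg (gpow g S) + (\<Sum>j<m. pdeg (\<sigma> S j)) + W \<le> k" if "S \<in> Pow G" for S
    using member_le_sum[OF that, of "\<lambda>S. pdeg (gpow g S) + (\<Sum>j<m. pdeg (\<sigma> S j))"] fin(2) unfolding k_def by simp
  have kS: "pdeg (gpow g S) + pdeg (\<sigma> S j) + W \<le> k" if "S \<in> Pow G" "j < m" for S j
    using kG[OF that(1)] member_le_sum[of j "{..<m}" "\<lambda>j. pdeg (\<sigma> S j)"] that(2) by simp
  interpret mc: comm_ring_hom "mconst :: real \<Rightarrow> 'n mpoly" by (rule comm_ring_hom_mconst)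
  \<comment> \<open>Substitution of \<open>f\<close> for the variable.\<close>
  define \<theta> where "\<theta> = (\<lambda>r. poly (map_poly mconst r) f)"
  interpret \<theta>: comm_ring_hom \<theta>
    unfolding \<theta>_def by (rule comm_ring_hom_poly_map_poly[OF comm_ring_hom_mconst])
  have lin: "\<theta> [:- v, 1:] = f - mconst v" for v
    by (simp add: \<theta>_def hom_distribs mc.hom_uminus)
  have prod: "\<theta> (\<Prod>v\<leftarrow>us. [:- v, 1:]) = (\<Prod>v\<leftarrow>us. f - mconst v)" for us
    by (induction us) (simp_all only: list.map prod_list.Cons prod_list.Nil \<theta>.hom_mult \<theta>.hom_one lin)
  have "certified H h G g k (f - mconst \<gamma>)" if \<gamma>: "\<forall>v\<in>set vs. \<gamma> < v" for \<gamma>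
  proof -
    have "\<forall>v\<in>set (vs @ vs). \<gamma> < v"
      using \<gamma> by simp
    from linear_eq_square_plus_multiple[OF this] obtain s w where
      sw: "[:- \<gamma>, 1:] = s\<^sup>2 + w * (\<Prod>v\<leftarrow>vs @ vs. [:- v, 1:])" "degree s \<le> D" "degree w \<le> 2 * D + 1"
      unfolding D_def by blast
    have "\<theta> [:- \<gamma>, 1:] = (\<theta> s)\<^sup>2 + \<theta> w * \<theta> (\<Prod>v\<leftarrow>vs @ vs. [:- v, 1:])"
      unfolding sw(1) by (simp only: \<theta>.hom_add \<theta>.hom_mult \<theta>.hom_power)
    then have eq: "f - mconst \<gamma> = (\<theta> s)\<^sup>2 + \<theta> w * (?q * ?q)"
      unfolding lin prod by (simp only: map_append prod_list.append)
    \<comment> \<open>w = ((w + 1)/2)^2 - ((w - 1)/2)^2. The negative square then multiplies q(f)^2,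
      whose negative is in the cone.\<close>
    define wp where "wp = mconst (1/2) * (\<theta> w + 1)"
    define wm where "wm = mconst (1/2) * (\<theta> w - 1)"
    have "mconst (1/2) * mconst (1/2) * (4 :: 'n mpoly) = 1"
      by (simp add: mult_single flip: single_numeral)
    moreover have "wp\<^sup>2 - wm\<^sup>2 = mconst (1/2) * mconst (1/2) * 4 * \<theta> w"
      unfolding wp_def wm_def by (simp add: power2_eq_square algebra_simps)
    ultimately have w: "wp\<^sup>2 - wm\<^sup>2 = \<theta> w"
      by (simp only: mult_1)
    have "f - mconst \<gamma> = (\<theta> s)\<^sup>2 + (wp * ?q)\<^sup>2 + wm\<^sup>2 * - (?q * ?q)"
      unfolding eq w[symmetric] by (simp add: power2_eq_square algebra_simps)
    then have rep: "f - mconst \<gamma> = (\<Sum>i\<in>H. h i * (a i * wm\<^sup>2)) +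
        (wm\<^sup>2 * b + ((\<theta> s)\<^sup>2 + (wp * ?q)\<^sup>2))"
      unfolding neg by (simp add: distrib_left sum_distrib_left ac_simps)
    \<comment> \<open>The two additional squares belong to the empty product of generators.\<close>
    define \<tau> where "\<tau> = (\<lambda>S j. if j < m then \<sigma> S j * wm else if S = {} then (if j = m then \<theta> s else wp * ?q) else 0)"
    have "(\<Sum>S\<in>Pow G. gpow g S * (\<Sum>j<Suc (Suc m). (\<tau> S j)\<^sup>2))
      = (\<Sum>S\<in>Pow G. wm\<^sup>2 * (gpow g S * (\<Sum>j<m. (\<sigma> S j)\<^sup>2)) + (if S = {} then (\<theta> s)\<^sup>2 + (wp * ?q)\<^sup>2 else 0))"
    proof (intro sum.cong refl)
      fix S
      have "(\<Sum>j<m. (\<tau> S j)\<^sup>2) = wm\<^sup>2 * (\<Sum>j<m. (\<sigma> S j)\<^sup>2)"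
        unfolding sum_distrib_left by (intro sum.cong) (auto simp: \<tau>_def power_mult_distrib mult.commute)
      moreover have "(\<tau> S m)\<^sup>2 + (\<tau> S (Suc m))\<^sup>2 = (if S = {} then (\<theta> s)\<^sup>2 + (wp * ?q)\<^sup>2 else 0)"
        by (auto simp: \<tau>_def)
      ultimately have *: "(\<Sum>j<Suc (Suc m). (\<tau> S j)\<^sup>2) = wm\<^sup>2 * (\<Sum>j<m. (\<sigma> S j)\<^sup>2) + (if S = {} then (\<theta> s)\<^sup>2 + (wp * ?q)\<^sup>2 else 0)"
        by (simp add: add.assoc)
      show "gpow g S * (\<Sum>j<Suc (Suc m). (\<tau> S j)\<^sup>2)
        = wm\<^sup>2 * (gpow g S * (\<Sum>j<m. (\<sigma> S j)\<^sup>2)) + (if S = {} then (\<theta> s)\<^sup>2 + (wp * ?q)\<^sup>2 else 0)"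
        unfolding * by (cases "S = {}") (simp_all add: gpow_def mult.left_commute)
    qed
    also have "\<dots> = wm\<^sup>2 * b + ((\<theta> s)\<^sup>2 + (wp * ?q)\<^sup>2)"
      unfolding b_eq using fin(2) by (simp add: sum.distrib sum_distrib_left)
    finally have rep2: "f - mconst \<gamma> = (\<Sum>i\<in>H. h i * (a i * wm\<^sup>2)) + (\<Sum>S\<in>Pow G. gpow g S * (\<Sum>j<Suc (Suc m). (\<tau> S j)\<^sup>2))"
      unfolding rep by simp
    have \<theta>w: "pdeg (\<theta> w) \<le> (2 * D + 1) * pdeg f"
      unfolding \<theta>_def using pdeg_poly_map_poly[of w f] sw(3) by (meson mult_le_mono1 order_trans)
    have "pdeg wm \<le> (2 * D + 1) * pdeg f" "pdeg wp \<le> (2 * D + 1) * pdeg f"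
      unfolding wm_def wp_def
      using pdeg_mult_le[of "mconst (1/2)" "\<theta> w - 1"] pdeg_mult_le[of "mconst (1/2)" "\<theta> w + 1"]
        pdeg_diff_le[OF \<theta>w, of 1] pdeg_add_le[OF \<theta>w, of 1] by auto
    then have degs: "pdeg wm \<le> W" "pdeg (wp * ?q) \<le> W"
      using pdeg_mult_le[of wp ?q] unfolding W_def by auto
    have "pdeg (\<theta> s) \<le> D * pdeg f"
      unfolding \<theta>_def using pdeg_poly_map_poly[of s f] sw(2) by (meson mult_le_mono1 order_trans)
    then have \<theta>s: "pdeg (\<theta> s) \<le> W"
      unfolding W_def by (simp add: add_mult_distrib)
    show ?thesis
      unfolding certified_def
    proof (intro exI[of _ "\<lambda>i. a i * wm\<^sup>2"] exI[of _ \<tau>] exI[of _ "Suc (Suc m)"] conjI ballI allI impI rep2)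
      fix i assume "i \<in> H"
      then show "pdeg (h i) + pdeg (a i * wm\<^sup>2) \<le> 2 * k"
        using kH[of i] pdeg_mult_le[of "a i" "wm\<^sup>2"] pdeg_square_le[of wm] degs(1) by linarith
    next
      fix S assume S: "S \<in> Pow G"
      then show "pdeg (gpow g S) \<le> 2 * k"
        using kG[of S] by linarith
      fix j assume "j < Suc (Suc m)"
      have "pdeg (gpow g S) + pdeg (\<tau> S j) \<le> k"
      proof (cases "j < m")
        case True
        then show ?thesis
          using kS[OF S True] pdeg_mult_le[of "\<sigma> S j" wm] degs(1) by (simp add: \<tau>_def)
      next
        case False
        then have "pdeg (\<tau> S j) \<le> W"
          using \<theta>s degs(2) by (simp add: \<tau>_def)
        then show ?thesis
          using kG[OF S] by linarith
      qed
      then show "pdeg (gpow g S) + 2 * pdeg (\<tau> S j) \<le> 2 * k"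
        by linarith
    qed
  qed
  then show ?thesis
    by blast
qed

section \<open>Nonnegative multipliers at a minimizer\<close>

lemma peval_has_derivative:
  "((\<lambda>x. peval p (vec_nth x)) has_derivative (\<lambda>v. (\<chi> t. peval (pderivv t p) (vec_nth x)) \<bullet> v)) (at x)"
  for x :: "real ^ 'n::finite"
proof (induction p rule: mpoly_induct)
  case (const r)
  then show ?case
    by (simp add: pderivv_const inner_vec_def)
next
  case (var s)
  have "(\<chi> t. peval (pderivv t (mvar s)) (vec_nth x)) \<bullet> v = v $ s" for v
  proof -
    have "(\<chi> t. peval (pderivv t (mvar s)) (vec_nth x)) \<bullet> v = (\<Sum>t\<in>UNIV. if t = s then v $ t else 0)"
      unfolding inner_vec_def pderivv_var by (intro sum.cong) auto
    then show ?thesis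
      by simp
  qed
  moreover have "peval (mvar s) (vec_nth x) = x $ s" for x :: "real ^ 'n"
    by (simp add: peval_eq_mp_eval mp_eval_single mon_eval_single)
  ultimately show ?case
    using bounded_linear_imp_has_derivative[OF bounded_linear_vec_nth[of s], of "at x"] by simp
next
  case (add p q)
  have "(\<chi> t. peval (pderivv t (p + q)) (vec_nth x)) =
    (\<chi> t. peval (pderivv t p) (vec_nth x)) + (\<chi> t. peval (pderivv t q) (vec_nth x))"
    by (simp add: Finite_Cartesian_Product.vec_eq_iff pderivv_add peval.hom_add)
  then show ?case
    using has_derivative_add[OF add] by (simp add: peval.hom_add inner_add_left)
next
  case (mult p q)
  have "(\<chi> t. peval (pderivv t (p * q)) (vec_nth x)) =
    peval p (vec_nth x) *\<^sub>R (\<chi> t. peval (pderivv t q) (vec_nth x)) + peval q (vec_nth x) *\<^sub>R (\<chi> t. peval (pderivv t p) (vec_nth x))"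
    by (simp add: Finite_Cartesian_Product.vec_eq_iff pderivv_mult peval.hom_add peval.hom_mult)
  then show ?case
    using has_derivative_mult[OF mult] by (simp add: peval.hom_mult inner_add_left mult.commute)
qed

lemma continuous_peval: "continuous_on S (\<lambda>x :: real ^ 'n::finite. peval p (vec_nth x))"
  using has_derivative_continuous[OF peval_has_derivative] by (intro continuous_at_imp_continuous_on) blast

text \<open>The component of \<open>a i\<close> orthogonal to the span of the others is nonzero by
  independence; rescaled, it is the dual vector.\<close>

lemma dual_vector_exists:
  fixes a :: "'i \<Rightarrow> 'a::euclidean_space"
  assumes "finite A" "i \<in> A" and indep: "\<And>\<mu>. (\<Sum>k\<in>A. \<mu> k *\<^sub>R a k) = 0 \<Longrightarrow> \<forall>k\<in>A. \<mu> k = 0"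
  shows "\<exists>e. \<forall>k\<in>A. a k \<bullet> e = (if k = i then 1 else 0)"
proof -
  let ?B = "A - {i}" and ?T = "range (\<lambda>\<mu>. \<Sum>k\<in>A - {i}. \<mu> k *\<^sub>R a k)"
  obtain y z where yz: "y \<in> span (a ` ?B)" "\<And>w. w \<in> span (a ` ?B) \<Longrightarrow> Linear_Algebra.orthogonal z w" "a i = y + z"
    using orthogonal_subspace_decomp_exists[of "a ` ?B" "a i"] by metis
  have "subspace ?T"
  proof (rule subspaceI)
    show "0 \<in> ?T"
      by (intro range_eqI[of _ _ "\<lambda>_. 0"]) simp
    fix x y assume "x \<in> ?T"
    then obtain \<mu> where \<mu>: "x = (\<Sum>k\<in>?B. \<mu> k *\<^sub>R a k)" by blast
    show "c *\<^sub>R x \<in> ?T" for c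
      by (intro range_eqI[of _ _ "\<lambda>k. c * \<mu> k"]) (simp add: \<mu> scaleR_sum_right)
    assume "y \<in> ?T"
    then obtain \<nu> where \<nu>: "y = (\<Sum>k\<in>?B. \<nu> k *\<^sub>R a k)" by blast
    show "x + y \<in> ?T"
      by (intro range_eqI[of _ _ "\<lambda>k. \<mu> k + \<nu> k"]) (simp add: \<mu> \<nu> scaleR_add_left sum.distrib)
  qed
  moreover have "a ` ?B \<subseteq> ?T"
  proof
    fix x assume "x \<in> a ` ?B"
    then obtain k where k: "k \<in> ?B" "x = a k" by blast
    have "(\<Sum>l\<in>?B. (if l = k then 1 else 0) *\<^sub>R a l) = (\<Sum>l\<in>?B. if l = k then a l else 0)"
      by (intro sum.cong) auto
    also have "\<dots> = x"
      using k assms(1) by simp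
    finally show "x \<in> ?T"
      by (intro range_eqI[of _ _ "\<lambda>l. if l = k then 1 else 0"]) simp
  qed
  ultimately have "span (a ` ?B) \<subseteq> ?T"
    using span_minimal by blast
  then obtain \<mu> where \<mu>: "y = (\<Sum>k\<in>?B. \<mu> k *\<^sub>R a k)"
    using yz(1) by blast
  have "z \<noteq> 0"
  proof
    assume "z = 0"
    define \<nu> where "\<nu> = (\<lambda>k. if k = i then - 1 else \<mu> k)"
    have "(\<Sum>k\<in>A. \<nu> k *\<^sub>R a k) = \<nu> i *\<^sub>R a i + (\<Sum>k\<in>?B. \<nu> k *\<^sub>R a k)"
      using assms(1,2) by (rule sum.remove)
    also have "(\<Sum>k\<in>?B. \<nu> k *\<^sub>R a k) = y"
      unfolding \<mu> by (intro sum.cong) (auto simp: \<nu>_def)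
    finally have "(\<Sum>k\<in>A. \<nu> k *\<^sub>R a k) = 0"
      using yz(3) \<open>z = 0\<close> by (simp add: \<nu>_def)
    then have "\<nu> i = 0"
      using indep assms(2) by blast
    then show False
      by (simp add: \<nu>_def)
  qed
  have orth: "w \<bullet> z = 0" if "w \<in> span (a ` ?B)" for w
    using yz(2)[OF that] by (simp add: Linear_Algebra.orthogonal_def inner_commute)
  have "a i \<bullet> z = z \<bullet> z"
    unfolding yz(3) using orth[OF yz(1)] by (simp add: inner_add_left)
  moreover have "a k \<bullet> z = 0" if "k \<in> ?B" for k
    using orth that by (simp add: span_base)
  ultimately show ?thesis
    using \<open>z \<noteq> 0\<close> by (intro exI[of _ "z /\<^sub>R (z \<bullet> z)"]) auto
qed

text \<open>A multiplier of the wrong sign produces a descent direction; Brouwer's theorem corrects the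
  straight line along it to a point on which the other active constraints stay exactly zero.\<close>

lemma descent_along_constraint:
  fixes c :: "'i \<Rightarrow> 'a::euclidean_space \<Rightarrow> real" and f :: "'a \<Rightarrow> real"
  assumes A: "finite A" and cont: "\<And>i. i \<in> A \<Longrightarrow> continuous_on UNIV (c i)"
    and der: "\<And>i. i \<in> A \<Longrightarrow> (c i has_derivative (\<lambda>v. a i \<bullet> v)) (at u)" and zero: "\<And>i. i \<in> A \<Longrightarrow> c i u = 0"
    and indep: "\<And>\<mu>. (\<Sum>k\<in>A. \<mu> k *\<^sub>R a k) = 0 \<Longrightarrow> \<forall>k\<in>A. \<mu> k = 0"
    and fder: "(f has_derivative (\<lambda>v. (\<Sum>i\<in>A. lam i *\<^sub>R a i) \<bullet> v)) (at u)"
    and j: "j \<in> A" "lam j < 0" and \<epsilon>: "0 < \<epsilon>"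
  shows "\<exists>x. norm (x - u) < \<epsilon> \<and> (\<forall>i\<in>A - {j}. c i x = 0) \<and> 0 < c j x \<and> f x < f u"
proof -
  have "\<forall>i. \<exists>e. i \<in> A \<longrightarrow> (\<forall>k\<in>A. a k \<bullet> e = (if k = i then 1 else 0))"
    using dual_vector_exists[OF A _ indep] by blast
  then obtain e where e: "\<And>i k. i \<in> A \<Longrightarrow> k \<in> A \<Longrightarrow> a k \<bullet> e i = (if k = i then 1 else 0)"
    by metis
  define K where "K = (\<Sum>i\<in>A. norm (e i))"
  \<comment> \<open>The summand 1 pays for the remainder of \<open>f\<close> itself, the others for
    the remainders of the constraints.\<close>
  define L where "L = 1 + (\<Sum>i\<in>A. \<bar>lam i\<bar>)"
  define n where "n = norm (e j)"
  have K: "0 \<le> K" and L: "0 < L"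
    by (auto simp: K_def L_def intro!: sum_nonneg add_pos_nonneg)
  have "e j \<noteq> 0"
    using e[OF j(1) j(1)] by auto
  then have n: "0 < n"
    by (simp add: n_def)
  \<comment> \<open>The first bound makes the correction at most half the radius, so the ball is
    mapped into itself; the second keeps all remainders below the linear gain
    \<open>- lam j\<close>.\<close>
  define \<delta> where "\<delta> = min (1 / (2 * (K + 1))) (- lam j / (4 * L * n))"
  have \<delta>: "0 < \<delta>"
    using K L n j(2) by (auto simp: \<delta>_def divide_neg_pos)
  have \<delta>K: "\<delta> * K \<le> 1 / 2"
  proof -
    have "\<delta> * K \<le> 1 / (2 * (K + 1)) * K"
      using K by (intro mult_right_mono) (auto simp: \<delta>_def)
    also have "\<dots> \<le> 1 / 2"
      using K by (simp add: field_simps)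
    finally show ?thesis .
  qed
  have \<delta>L: "\<delta> * L * (2 * n) < - lam j"
  proof -
    have "\<delta> * L * (2 * n) \<le> (- lam j / (4 * L * n)) * L * (2 * n)"
      using L n by (intro mult_right_mono) (auto simp: \<delta>_def)
    also have "\<dots> = - lam j / 2"
      using L n by (simp add: field_simps)
    also have "\<dots> < - lam j"
      using j(2) by simp
    finally show ?thesis .
  qed
  define r where "r = (\<lambda>i x. c i x - a i \<bullet> (x - u))"
  have ev: "\<forall>\<^sub>F x in nhds u. norm (g x - g u - g' (x - u)) \<le> \<delta> * norm (x - u)"
    if "(g has_derivative g') (at u)" for g :: "'a \<Rightarrow> real" and g'
    using that \<delta> unfolding has_derivative_at_alt eventually_nhds_metric dist_norm by blast
  have "\<forall>\<^sub>F x in nhds u. \<forall>i\<in>A. \<bar>r i x\<bar> \<le> \<delta> * norm (x - u)"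
    using ev[OF der] zero by (intro eventually_ball_finite[OF A]) (auto simp: r_def)
  moreover have "\<forall>\<^sub>F x in nhds u. \<bar>f x - f u - (\<Sum>i\<in>A. lam i *\<^sub>R a i) \<bullet> (x - u)\<bar> \<le> \<delta> * norm (x - u)"
    using ev[OF fder] by simp
  ultimately obtain d where d: "0 < d" and rd: "\<And>x i. norm (x - u) < d \<Longrightarrow> i \<in> A \<Longrightarrow> \<bar>r i x\<bar> \<le> \<delta> * norm (x - u)"
    and fd: "\<And>x. norm (x - u) < d \<Longrightarrow> \<bar>f x - f u - (\<Sum>i\<in>A. lam i *\<^sub>R a i) \<bullet> (x - u)\<bar> \<le> \<delta> * norm (x - u)"
    using eventually_conj unfolding eventually_nhds_metric dist_norm by (smt (verit, best))
  \<comment> \<open>The step s e_j has length \<rho>/2, which leaves the other half of the radius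
    \<rho> for the correction.\<close>
  define s where "s = min d \<epsilon> / (4 * n)"
  define \<rho> where "\<rho> = 2 * s * n"
  have s: "0 < s"
    using d \<epsilon> n by (simp add: s_def)
  have \<rho>: "0 < \<rho>" "\<rho> < d" "\<rho> < \<epsilon>"
    using d \<epsilon> n by (auto simp: \<rho>_def s_def)
  \<comment> \<open>Pairing a fixed point x with \<open>a k\<close> gives a_k . (x - u) = s [k = j]
    - r_k(x), that is, c_k(x) = s [k = j].\<close>
  define \<Phi> where "\<Phi> = (\<lambda>x. u + s *\<^sub>R e j - (\<Sum>i\<in>A. r i x *\<^sub>R e i))"
  have "continuous_on (cball u \<rho>) \<Phi>"
    unfolding \<Phi>_def r_def by (intro continuous_intros continuous_on_subset[OF cont]) auto
  moreover have "\<Phi> \<in> cball u \<rho> \<rightarrow> cball u \<rho>"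
  proof
    fix x assume "x \<in> cball u \<rho>"
    then have x: "norm (x - u) \<le> \<rho>"
      by (simp add: dist_norm norm_minus_commute[of u])
    have "norm (\<Sum>i\<in>A. r i x *\<^sub>R e i) \<le> (\<Sum>i\<in>A. (\<delta> * \<rho>) * norm (e i))"
    proof (intro sum_norm_le)
      fix i assume "i \<in> A"
      then have "\<bar>r i x\<bar> \<le> \<delta> * norm (x - u)"
        using rd[of x i] x \<rho>(2) by simp
      also have "\<dots> \<le> \<delta> * \<rho>"
        using x \<delta> by simp
      finally show "norm (r i x *\<^sub>R e i) \<le> (\<delta> * \<rho>) * norm (e i)"
        by (simp add: mult_right_mono)
    qed
    also have "\<dots> = \<rho> * (\<delta> * K)"
      by (simp add: K_def sum_distrib_left ac_simps)
    also have "\<dots> \<le> \<rho> * (1 / 2)"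
      using \<delta>K \<rho>(1) by (intro mult_left_mono) auto
    finally have "norm (\<Sum>i\<in>A. r i x *\<^sub>R e i) \<le> \<rho> / 2"
      by simp
    moreover have "norm (s *\<^sub>R e j) = \<rho> / 2"
      using s by (simp add: \<rho>_def n_def)
    ultimately have "norm (s *\<^sub>R e j - (\<Sum>i\<in>A. r i x *\<^sub>R e i)) \<le> \<rho>"
      using norm_triangle_ineq4[of "s *\<^sub>R e j" "\<Sum>i\<in>A. r i x *\<^sub>R e i"] by linarith
    moreover have "\<Phi> x - u = s *\<^sub>R e j - (\<Sum>i\<in>A. r i x *\<^sub>R e i)"
      by (simp add: \<Phi>_def)
    ultimately show "\<Phi> x \<in> cball u \<rho>"
      by (simp add: dist_norm norm_minus_commute[of u])
  qed
  ultimately obtain x where x: "x \<in> cball u \<rho>" "\<Phi> x = x"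
    using brouwer[of "cball u \<rho>" \<Phi>] \<rho>(1) by (auto simp: less_imp_le)
  have xu: "norm (x - u) \<le> \<rho>"
    using x(1) by (simp add: dist_norm norm_minus_commute[of u])
  have "x - u = s *\<^sub>R e j - (\<Sum>i\<in>A. r i x *\<^sub>R e i)"
    using x(2) by (simp add: \<Phi>_def algebra_simps)
  then have a_x: "a k \<bullet> (x - u) = (if k = j then s else 0) - r k x" if k: "k \<in> A" for k
  proof -
    have "a k \<bullet> (x - u) = s * (a k \<bullet> e j) - (\<Sum>i\<in>A. r i x * (a k \<bullet> e i))"
      unfolding \<open>x - u = _\<close> by (simp add: inner_diff_right inner_sum_right)
    also have "(\<Sum>i\<in>A. r i x * (a k \<bullet> e i)) = (\<Sum>i\<in>A. if i = k then r i x else 0)"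
      using e k by (intro sum.cong) auto
    also have "\<dots> = r k x"
      using A k by simp
    finally show ?thesis
      using e[OF j(1) k] by simp
  qed
  have c_x: "c k x = (if k = j then s else 0)" if "k \<in> A" for k
    using a_x[OF that] by (simp add: r_def)
  have rx: "\<bar>r i x\<bar> \<le> \<delta> * \<rho>" if "i \<in> A" for i
    using rd[of x i] xu \<rho>(2) that \<delta> mult_left_mono[OF xu, of \<delta>] by linarith
  have "(\<Sum>i\<in>A. lam i *\<^sub>R a i) \<bullet> (x - u) = (\<Sum>i\<in>A. lam i * ((if i = j then s else 0) - r i x))"
    by (simp add: inner_sum_left a_x)
  also have "\<dots> = (\<Sum>i\<in>A. (if i = j then lam i * s else 0) + - (lam i * r i x))"
    by (intro sum.cong) (auto simp: algebra_simps)
  also have "\<dots> = lam j * s + (\<Sum>i\<in>A. - (lam i * r i x))"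
    unfolding sum.distrib using A j(1) by simp
  also have "(\<Sum>i\<in>A. - (lam i * r i x)) \<le> (\<Sum>i\<in>A. \<bar>lam i\<bar> * (\<delta> * \<rho>))"
  proof (intro sum_mono)
    fix i assume "i \<in> A"
    have "- (lam i * r i x) \<le> \<bar>lam i\<bar> * \<bar>r i x\<bar>"
      using abs_ge_minus_self[of "lam i * r i x"] by (simp add: abs_mult)
    also have "\<dots> \<le> \<bar>lam i\<bar> * (\<delta> * \<rho>)"
      using rx[OF \<open>i \<in> A\<close>] by (intro mult_left_mono) auto
    finally show "- (lam i * r i x) \<le> \<bar>lam i\<bar> * (\<delta> * \<rho>)" .
  qed
  finally have lin: "(\<Sum>i\<in>A. lam i *\<^sub>R a i) \<bullet> (x - u) \<le> lam j * s + (L - 1) * (\<delta> * \<rho>)"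
    by (simp add: L_def sum_distrib_right)
  have "f x - f u \<le> (\<Sum>i\<in>A. lam i *\<^sub>R a i) \<bullet> (x - u) + \<delta> * \<rho>"
    using fd[of x] xu \<rho>(2) mult_left_mono[OF xu, of \<delta>] \<delta> by linarith
  also have "\<dots> \<le> lam j * s + L * (\<delta> * \<rho>)"
    using lin by (simp add: algebra_simps)
  also have "\<dots> = s * (lam j + \<delta> * L * (2 * n))"
    by (simp add: \<rho>_def algebra_simps)
  also have "\<dots> < 0"
    using \<delta>L s by (intro mult_pos_neg) auto
  finally have "f x < f u"
    by simp
  then show ?thesis
    using c_x j(1) s xu \<rho>(3) by (intro exI[of _ x]) auto
qed

section \<open>Tightness\<close>

definition basic_set :: "'b set \<Rightarrow> ('b \<Rightarrow> 'n::finite mpoly) \<Rightarrow> 'a set \<Rightarrow> ('a \<Rightarrow> 'n mpoly) \<Rightarrow> ('n \<Rightarrow> real) set" where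
  "basic_set H h G g = {x. (\<forall>i\<in>H. peval (h i) x = 0) \<and> (\<forall>i\<in>G. 0 \<le> peval (g i) x)}"

text \<open>Otherwise some prime cone over \<open>M\<close> has a support that avoids every product
  of f - v. Realizability then yields a point w of the basic set with f - f(w) in the support,
  although f - f(w) is one of these products.\<close>

lemma critical_values_positivstellensatz:
  fixes f :: "'n::finite mpoly" and h :: "'b \<Rightarrow> 'n mpoly" and g :: "'a \<Rightarrow> 'n mpoly" and c p :: "'i \<Rightarrow> 'n mpoly"
  assumes fin: "finite H" "finite G" "finite A"
    and crit: "\<And>t. \<exists>s\<in>H. h s = pderivv t f - (\<Sum>i\<in>A. p i * pderivv t (c i))"
    and slack: "\<And>i. i \<in> A \<Longrightarrow> \<exists>s\<in>H. \<exists>q. p i * c i = h s * q"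
  shows "\<exists>vs a b. set vs \<subseteq> peval f ` basic_set H h G g \<and> b \<in> preord G g \<and>
    - ((\<Prod>v\<leftarrow>vs. f - mconst v) * (\<Prod>v\<leftarrow>vs. f - mconst v)) = (\<Sum>i\<in>H. h i * a i) + b"
proof (rule ccontr)
  assume neg: "\<not> ?thesis"
  let ?T = "basic_set H h G g"
  define M where "M = {(\<Sum>i\<in>H. h i * a i) + b | a b. b \<in> preord G g}"
  define S where "S = {\<Prod>v\<leftarrow>vs. f - mconst v | vs. set vs \<subseteq> peval f ` ?T}"
  have MI: "(\<Sum>i\<in>H. h i * a i) + b \<in> M" if "b \<in> preord G g" for a b
    unfolding M_def using that by (intro CollectI exI[of _ a] exI[of _ b] conjI refl)
  have preM: "b \<in> M" if "b \<in> preord G g" for b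
    using MI[OF that, of "\<lambda>_. 0"] by simp
  have "precone M"
    unfolding precone_def
  proof (intro conjI allI ballI)
    fix x show "x * x \<in> M"
      using preM[OF preord_gen[of "{}" G g x]] by (simp add: gpow_def power2_eq_square)
  next
    fix x y assume "x \<in> M" "y \<in> M"
    then obtain a b a' b' where ab: "b \<in> preord G g" "b' \<in> preord G g"
      and xy: "x = (\<Sum>i\<in>H. h i * a i) + b" "y = (\<Sum>i\<in>H. h i * a' i) + b'"
      unfolding M_def by blast
    have "x + y = (\<Sum>i\<in>H. h i * (a i + a' i)) + (b + b')"
      by (simp add: xy distrib_left sum.distrib)
    then show "x + y \<in> M"
      by (simp only: MI[OF preord_add[OF ab]])
    have "x * y = (\<Sum>i\<in>H. h i * a i) * y + b * (\<Sum>i\<in>H. h i * a' i) + b * b'"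
      by (simp add: xy algebra_simps)
    also have "\<dots> = (\<Sum>i\<in>H. h i * (a i * y + b * a' i)) + b * b'"
      by (simp add: sum_distrib_left sum_distrib_right distrib_left sum.distrib ac_simps)
    finally show "x * y \<in> M"
      by (simp only: MI[OF preord_mult[OF fin(2) ab]])
  qed
  moreover have "1 \<in> S"
    unfolding S_def by (intro CollectI exI[of _ "[]"]) simp
  moreover have "s * t \<in> S" if st: "s \<in> S" "t \<in> S" for s t
  proof -
    obtain us vs where "set us \<subseteq> peval f ` ?T" "s = (\<Prod>v\<leftarrow>us. f - mconst v)"
      "set vs \<subseteq> peval f ` ?T" "t = (\<Prod>v\<leftarrow>vs. f - mconst v)"
      using st unfolding S_def by blast
    then show ?thesis
      unfolding S_def by (intro CollectI exI[of _ "us @ vs"]) simp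
  qed
  moreover have "- (s * s) \<notin> M" if s: "s \<in> S" for s
  proof
    assume "- (s * s) \<in> M"
    then obtain a b where "b \<in> preord G g" "- (s * s) = (\<Sum>i\<in>H. h i * a i) + b"
      unfolding M_def by blast
    moreover obtain vs where "set vs \<subseteq> peval f ` ?T" "s = (\<Prod>v\<leftarrow>vs. f - mconst v)"
      using s unfolding S_def by blast
    ultimately show False
      using neg by blast
  qed
  ultimately obtain Q where Q: "prime_cone Q" "M \<subseteq> Q" "support Q \<inter> S = {}"
    using prime_cone_exists[of M S] by blast
  note QP = prime_coneD(1)[OF Q(1)]
  have hM: "h s * q \<in> M" if "s \<in> H" for s q
  proof -
    have "(\<Sum>i\<in>H. h i * (if i = s then q else 0)) = (\<Sum>i\<in>H. if i = s then h s * q else 0)"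
      by (intro sum.cong) auto
    also have "\<dots> = h s * q"
      using fin(1) that by simp
    finally show ?thesis
      using MI[OF preord.zero, of "\<lambda>i. if i = s then q else 0"] by simp
  qed
  have hQ: "h s * q \<in> support Q" if "s \<in> H" for s q
    using hM[OF that, of q] hM[OF that, of "- q"] Q(2) by (auto simp: support_def)
  have gQ: "g i \<in> Q" if "i \<in> G" for i
    using preM[OF preord_gen[of "{i}" G g 1]] that Q(2) by (auto simp: gpow_def)
  obtain \<beta> where \<beta>: "bij_betw \<beta> {0..<card A} A"
    using ex_bij_betw_nat_finite[OF fin(3)] by blast
  have \<beta>': "bij_betw \<beta> {..<card A} A"
    using \<beta> by (simp add: atLeast0LessThan)
  \<comment> \<open>Realizability transfers only nonnegativity, so the equations enter with both
    signs.\<close>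
  let ?F = "h ` H \<union> uminus ` h ` H \<union> g ` G"
  have "realizable Q"
    by (rule prime_cone_realizable[OF Q(1)])
  moreover have "finite ?F"
    using fin by simp
  moreover have "\<forall>i<card A. p (\<beta> i) * c (\<beta> i) \<in> support Q"
  proof (intro allI impI)
    fix i assume "i < card A"
    then have "\<beta> i \<in> A"
      using bij_betwE[OF \<beta>'] by simp
    then show "p (\<beta> i) * c (\<beta> i) \<in> support Q"
      using slack[of "\<beta> i"] hQ by auto
  qed
  moreover have "\<forall>t. pderivv t f - (\<Sum>i<card A. p (\<beta> i) * pderivv t (c (\<beta> i))) \<in> support Q"
  proof
    fix t
    obtain s where s: "s \<in> H" "h s = pderivv t f - (\<Sum>i\<in>A. p i * pderivv t (c i))"
      using crit by blast
    have "(\<Sum>i<card A. p (\<beta> i) * pderivv t (c (\<beta> i))) = (\<Sum>i\<in>A. p i * pderivv t (c i))"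
      by (rule sum.reindex_bij_betw[OF \<beta>'])
    then show "pderivv t f - (\<Sum>i<card A. p (\<beta> i) * pderivv t (c (\<beta> i))) \<in> support Q"
      using hQ[OF s(1), of 1] s(2) by simp
  qed
  ultimately have "\<exists>w. (\<forall>x\<in>?F. x \<in> Q \<longrightarrow> 0 \<le> peval x w) \<and> f - mconst (peval f w) \<in> support Q"
    by (rule realizableD)
  then obtain w where w': "\<forall>x\<in>?F. x \<in> Q \<longrightarrow> 0 \<le> peval x w" "f - mconst (peval f w) \<in> support Q"
    by (elim exE conjE)
  note w = w'(1)[rule_format] w'(2)
  have "w \<in> ?T"
    unfolding basic_set_def
  proof (intro CollectI conjI ballI)
    fix s assume s: "s \<in> H"
    then have "h s \<in> support Q"
      using hQ[OF s, of 1] by simp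
    then show "peval (h s) w = 0"
      using w(1)[of "h s"] w(1)[of "- h s"] s by (simp add: support_def peval.hom_uminus)
  next
    fix i assume "i \<in> G"
    then show "0 \<le> peval (g i) w"
      using w(1)[of "g i"] gQ by simp
  qed
  then have "f - mconst (peval f w) \<in> S"
    unfolding S_def by (intro CollectI exI[of _ "[peval f w]"]) simp
  then show False
    using w(2) Q(3) by blast
qed

lemma ereal_le_if_real_below:
  assumes "\<And>\<gamma>. ereal \<gamma> < y \<Longrightarrow> ereal \<gamma> \<le> x" shows "y \<le> x"
proof (rule ccontr)
  assume "\<not> y \<le> x"
  then have "x < y"
    by simp
  from ereal_dense2[OF this] obtain z where "x < ereal z" "ereal z < y"
    by (elim exE conjE)
  then show False
    using assms[of z] by simp
qed

context
  fixes f :: "'n::finite mpoly" and c p :: "'i \<Rightarrow> 'n mpoly" and E I :: "'i set"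
  assumes finE: "finite E" and finI: "finite I"
begin

lemma finite_eq_idx: "finite (eq_idx E I :: ('i + 'n + 'i) set)"
  using finE finI by (simp add: eq_idx_def phi_idx_def)

lemma finite_in_idx: "finite (in_idx I)"
  using finI by (simp add: in_idx_def)

abbreviation (input) "feasible_critical \<equiv> basic_set (eq_idx E I) (eq_tuple f c E I p) (in_idx I) (in_tuple c p)"

lemma feasible_critical_iff:
  "x \<in> feasible_critical \<longleftrightarrow> (\<forall>i\<in>E. peval (c i) x = 0) \<and> (\<forall>j\<in>I. peval (c j) x \<ge> 0)
        \<and> (\<forall>s\<in>phi_idx I. peval (phi f c E I p s) x = 0) \<and> (\<forall>j\<in>I. peval (p j) x \<ge> 0)"
  by (auto simp: basic_set_def eq_idx_def in_idx_def eq_tuple_def in_tuple_def ball_Un)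

lemma f_c_eq: "f_c f c E I p = (INF x \<in> feasible_critical. ereal (peval f x))"
  unfolding f_c_def by (intro INF_cong) (auto simp: feasible_critical_iff)

lemma f_pre_le_f_c: "f_pre f c E I p k \<le> f_c f c E I p"
  unfolding f_pre_def f_c_eq
proof (intro SUP_least INF_greatest, clarify)
  fix \<gamma> x a b assume x: "x \<in> feasible_critical" and a: "a \<in> trunc_ideal (eq_idx E I) (eq_tuple f c E I p) k"
    and b: "b \<in> trunc_preord (in_idx I) (in_tuple c p) k" and eq: "f - mconst \<gamma> = a + b"
  have "peval a x = 0"
    using a x by (auto simp: trunc_ideal_def basic_set_def peval.hom_sum peval.hom_mult)
  moreover have "0 \<le> peval b x"
  proof -
    obtain \<sigma> where \<sigma>: "\<forall>S\<in>Pow (in_idx I). \<sigma> S \<in> SOS" "b = (\<Sum>S\<in>Pow (in_idx I). gpow (in_tuple c p) S * \<sigma> S)"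
      using b unfolding trunc_preord_def SOS_le_def by blast
    have sos: "0 \<le> peval s x" if "s \<in> SOS" for s
      using that by (auto simp: SOS_def peval.hom_sum peval.hom_power intro!: sum_nonneg)
    show ?thesis
      unfolding \<sigma>(2) peval.hom_sum peval.hom_mult gpow_def peval.hom_prod
    proof (intro sum_nonneg mult_nonneg_nonneg prod_nonneg)
      fix S assume "S \<in> Pow (in_idx I)"
      then show "0 \<le> peval (\<sigma> S) x"
        using \<sigma>(1) sos by blast
      fix i assume "i \<in> S"
      then show "0 \<le> peval (in_tuple c p i) x"
        using x \<open>S \<in> Pow (in_idx I)\<close> by (auto simp: basic_set_def)
    qed
  qed
  moreover have "peval f x - \<gamma> = peval a x + peval b x"
    using arg_cong[OF eq, of "\<lambda>q. peval q x"] by (simp add: peval.hom_minus peval.hom_add)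
  ultimately show "ereal \<gamma> \<le> ereal (peval f x)"
    by simp
qed

text \<open>Feasible critical points give feasible moment vectors; the bound on the degree ensures
  that no monomial of \<open>f\<close> is cut off in the objective.\<close>

lemma f_pre'_le_f_c:
  assumes "pdeg f \<le> 2 * k" shows "f_pre' f c E I p k \<le> f_c f c E I p"
  unfolding f_pre'_def f_c_eq
proof (intro INF_greatest)
  fix x assume x: "x \<in> feasible_critical"
  let ?y = "point_moments k x"
  have "(INF y\<in>{y \<in> tms k. riesz 1 y = 1 \<and> (\<forall>s\<in>eq_idx E I. loc_zero k (eq_tuple f c E I p s) y)
      \<and> (\<forall>S\<in>Pow (in_idx I). loc_psd k (gpow (in_tuple c p) S) y)}. ereal (riesz f y)) \<le> ereal (riesz f ?y)"
  proof (intro INF_lower CollectI conjI ballI)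
    show "?y \<in> tms k"
      by (rule point_moments_tms)
    show "riesz 1 ?y = 1"
      using riesz_point_moments[of 1 k x] by simp
    show "loc_zero k (eq_tuple f c E I p s) ?y" if "s \<in> eq_idx E I" for s
      using x that by (intro loc_zero_point_moments) (auto simp: basic_set_def)
    show "loc_psd k (gpow (in_tuple c p) S) ?y" if "S \<in> Pow (in_idx I)" for S
      using x that unfolding gpow_def
      by (intro loc_psd_point_moments) (auto simp: basic_set_def peval.hom_prod intro!: prod_nonneg)
  qed
  also have "riesz f ?y = peval f x"
    by (rule riesz_point_moments[OF assms])
  finally show "(INF y\<in>{y \<in> tms k. riesz 1 y = 1 \<and> (\<forall>s\<in>eq_idx E I. loc_zero k (eq_tuple f c E I p s) y)
      \<and> (\<forall>S\<in>Pow (in_idx I). loc_psd k (gpow (in_tuple c p) S) y)}. ereal (riesz f y)) \<le> ereal (peval f x)" .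
qed

text \<open>The roots are values at feasible critical points, so every \<gamma> below
  \<open>f_c\<close> is below all of them, and one \<open>k\<close> serves all \<gamma>. An infinite
  \<open>f_c\<close> corresponds to the empty list.\<close>

lemma certified_below_f_c:
  "\<exists>k. \<forall>\<gamma>. ereal \<gamma> < f_c f c E I p \<longrightarrow>
    certified (eq_idx E I) (eq_tuple f c E I p) (in_idx I) (in_tuple c p) k (f - mconst \<gamma>)"
proof -
  have crit: "\<exists>s\<in>eq_idx E I. eq_tuple f c E I p s = pderivv t f - (\<Sum>i\<in>E \<union> I. p i * pderivv t (c i))" for t
    by (intro bexI[of _ "Inr (Inl t)"]) (auto simp: eq_tuple_def phi_def eq_idx_def phi_idx_def)
  have slack: "\<exists>s\<in>eq_idx E I. \<exists>q. p i * c i = eq_tuple f c E I p s * q" if "i \<in> E \<union> I" for i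
  proof (cases "i \<in> E")
    case True
    then show ?thesis
      by (intro bexI[of _ "Inl i"] exI[of _ "p i"]) (auto simp: eq_tuple_def eq_idx_def mult.commute)
  next
    case False
    then show ?thesis
      using that by (intro bexI[of _ "Inr (Inr i)"] exI[of _ 1]) (auto simp: eq_tuple_def phi_def eq_idx_def phi_idx_def)
  qed
  have "finite (E \<union> I)"
    using finE finI by simp
  from critical_values_positivstellensatz[OF finite_eq_idx finite_in_idx this crit slack, of "in_tuple c p"]
  obtain vs a b where vs: "set vs \<subseteq> peval f ` feasible_critical" and b: "b \<in> preord (in_idx I) (in_tuple c p)"
    and eq: "- ((\<Prod>v\<leftarrow>vs. f - mconst v) * (\<Prod>v\<leftarrow>vs. f - mconst v)) = (\<Sum>i\<in>eq_idx E I. eq_tuple f c E I p i * a i) + b"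
    by blast
  from certified_uniformly[OF finite_eq_idx finite_in_idx b eq] obtain k where
    k: "\<And>\<gamma>. (\<forall>v\<in>set vs. \<gamma> < v) \<Longrightarrow> certified (eq_idx E I) (eq_tuple f c E I p) (in_idx I) (in_tuple c p) k (f - mconst \<gamma>)"
    by blast
  have "\<forall>v\<in>set vs. \<gamma> < v" if "ereal \<gamma> < f_c f c E I p" for \<gamma>
  proof
    fix v assume "v \<in> set vs"
    then obtain x where "x \<in> feasible_critical" "v = peval f x"
      using vs by blast
    then have "f_c f c E I p \<le> ereal v"
      unfolding f_c_eq by (auto intro: INF_lower2)
    then show "\<gamma> < v"
      using that by (metis ereal_less(2) less_ereal.simps(1) order_less_le_trans)
  qed
  then show ?thesis
    using k by blast
qed

lemma relaxations_eventually_tight: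
  "\<exists>k0. \<forall>k\<ge>k0. f_pre f c E I p k = f_c f c E I p \<and> f_pre' f c E I p k = f_c f c E I p"
proof -
  obtain k1 where k1: "\<And>\<gamma>. ereal \<gamma> < f_c f c E I p \<Longrightarrow>
    certified (eq_idx E I) (eq_tuple f c E I p) (in_idx I) (in_tuple c p) k1 (f - mconst \<gamma>)"
    using certified_below_f_c by blast
  show ?thesis
  \<comment> \<open>The successor is the extra order required by
    \<open>certified_riesz_nonneg\<close>; \<open>pdeg f\<close> keeps the objective within the
    truncation.\<close>
  proof (intro exI[of _ "Suc k1 + pdeg f"] allI impI conjI)
    fix k assume k: "Suc k1 + pdeg f \<le> k"
    have "f_c f c E I p \<le> f_pre f c E I p k"
    proof (rule ereal_le_if_real_below)
      fix \<gamma> assume "ereal \<gamma> < f_c f c E I p"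
      from certified_truncations[OF k1[OF this], of k] k show "ereal \<gamma> \<le> f_pre f c E I p k"
        unfolding f_pre_def by (intro SUP_upper) auto
    qed
    then show "f_pre f c E I p k = f_c f c E I p"
      using f_pre_le_f_c[of k] by (rule antisym[rotated])
    have "f_c f c E I p \<le> f_pre' f c E I p k"
    proof (rule ereal_le_if_real_below)
      fix \<gamma> assume \<gamma>: "ereal \<gamma> < f_c f c E I p"
      show "ereal \<gamma> \<le> f_pre' f c E I p k"
        unfolding f_pre'_def
      proof (intro INF_greatest)
        fix y assume y: "y \<in> {y \<in> tms k. riesz 1 y = 1 \<and> (\<forall>s\<in>eq_idx E I. loc_zero k (eq_tuple f c E I p s) y)
          \<and> (\<forall>S\<in>Pow (in_idx I). loc_psd k (gpow (in_tuple c p) S) y)}"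
        have "0 \<le> riesz (f - mconst \<gamma>) y"
          using certified_riesz_nonneg[OF k1[OF \<gamma>], of k y] k y by simp
        moreover have "riesz (f - mconst \<gamma>) y = riesz f y - \<gamma>"
          using riesz_add[of f "mconst (- \<gamma>)" y] riesz_scale[of "- \<gamma>" 1 y] y by (simp add: single_uminus)
        ultimately show "ereal \<gamma> \<le> ereal (riesz f y)"
          by simp
      qed
    qed
    moreover have "f_pre' f c E I p k \<le> f_c f c E I p"
      using k by (intro f_pre'_le_f_c) simp
    ultimately show "f_pre' f c E I p k = f_c f c E I p"
      by (rule antisym[rotated])
  qed
qed

lemma f_c_eq_f_min:
  assumes disj: "E \<inter> I = {}" and A: "assumptionA f c E I p" and u: "u \<in> feasible c E I" "u \<in> crit_points f c E I"
    and min: "ereal (peval f u) = f_min f c E I"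
  shows "f_c f c E I p = f_min f c E I"
proof -
  obtain lam where lam: "(u, lam) \<in> crit_pairs f c E I"
    using u(2) by (auto simp: crit_points_def)
  have lam_eq: "lam i = peval (p i) u" if "i \<in> E \<union> I" for i
    using A lam that unfolding assumptionA_def by blast
  define B where "B = {i \<in> E \<union> I. peval (c i) u = 0}"
  have B: "finite B" "B \<subseteq> E \<union> I"
    using finE finI by (auto simp: B_def)
  have lamB: "lam i = 0" if "i \<notin> B" for i
    using lam that by (auto simp: crit_pairs_def B_def)
  define x0 :: "real ^ 'n" where "x0 = vec_lambda u"
  have x0: "vec_nth x0 = u"
    by (simp add: x0_def vec_lambda_inverse)
  define a where "a = (\<lambda>i. \<chi> t. peval (pderivv t (c i)) u)"
  have a_nth: "a i $ t = peval (pderivv t (c i)) u" for i t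
    by (simp add: a_def)
  have indep: "\<forall>k\<in>B. \<mu> k = 0" if \<mu>: "(\<Sum>k\<in>B. \<mu> k *\<^sub>R a k) = 0" for \<mu>
  proof -
    \<comment> \<open>A linear dependency among the active gradients, added to the multipliers,
      gives another critical pair at \<open>u\<close>. Assumption A identifies both multiplier
      vectors.\<close>
    define lam' where "lam' = (\<lambda>i. lam i + (if i \<in> B then \<mu> i else 0))"
    have "(u, lam') \<in> crit_pairs f c E I"
      unfolding crit_pairs_def
    proof (intro CollectI, unfold prod.case, intro conjI allI impI ballI)
      show "lam' i = 0" if "i \<notin> E \<union> I" for i
        using lam that B(2) by (auto simp: crit_pairs_def lam'_def)
      show "peval (c i) u = 0" if "i \<in> E" for i
        using lam that by (auto simp: crit_pairs_def)
      show "lam' j * peval (c j) u = 0" if "j \<in> I" for j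
        using lam that by (auto simp: crit_pairs_def lam'_def B_def)
      fix t
      have "(\<Sum>i\<in>E \<union> I. lam' i * peval (pderivv t (c i)) u)
        = (\<Sum>i\<in>E \<union> I. lam i * peval (pderivv t (c i)) u) + (\<Sum>i\<in>E \<union> I. (if i \<in> B then \<mu> i else 0) * a i $ t)"
        by (simp add: lam'_def distrib_right sum.distrib a_nth)
      also have "(\<Sum>i\<in>E \<union> I. (if i \<in> B then \<mu> i else 0) * a i $ t) = (\<Sum>i\<in>B. \<mu> i * a i $ t)"
        using finE finI B by (intro sum.mono_neutral_cong_right) auto
      also have "\<dots> = (\<Sum>k\<in>B. \<mu> k *\<^sub>R a k) $ t"
        by (simp add: sum_component)
      also have "\<dots> = 0"
        by (simp add: \<mu>)
      finally show "peval (pderivv t f) u = (\<Sum>i\<in>E \<union> I. lam' i * peval (pderivv t (c i)) u)"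
        using lam by (simp add: crit_pairs_def)
    qed
    then have eq: "lam' i = peval (p i) u" if "i \<in> E \<union> I" for i
      using A that unfolding assumptionA_def by blast
    show ?thesis
    proof
      fix k assume k: "k \<in> B"
      then have "lam' k = lam k"
        using eq lam_eq B(2) by (simp add: subset_iff)
      then show "\<mu> k = 0"
        using k by (simp add: lam'_def)
    qed
  qed
  have nonneg: "0 \<le> lam j" if j: "j \<in> I" for j
  proof (rule ccontr)
    assume "\<not> 0 \<le> lam j"
    then have neg: "lam j < 0" and jB: "j \<in> B"
      using lamB[of j] by auto
    have grad: "(\<chi> t. peval (pderivv t f) u) = (\<Sum>i\<in>B. lam i *\<^sub>R a i)"
    proof (unfold Finite_Cartesian_Product.vec_eq_iff, intro allI)
      fix t
      have "(\<chi> t. peval (pderivv t f) u) $ t = (\<Sum>i\<in>E \<union> I. lam i * a i $ t)"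
        using lam by (simp add: crit_pairs_def a_nth)
      also have "\<dots> = (\<Sum>i\<in>B. lam i * a i $ t)"
        using finE finI B lamB by (intro sum.mono_neutral_right) auto
      finally show "(\<chi> t. peval (pderivv t f) u) $ t = (\<Sum>i\<in>B. lam i *\<^sub>R a i) $ t"
        by (simp add: sum_component)
    qed
    \<comment> \<open>Inactive inequalities stay strict near \<open>u\<close>, so only the active
      constraints matter for the descent.\<close>
    have "\<forall>\<^sub>F x in nhds x0. \<forall>i\<in>I - B. 0 < peval (c i) (vec_nth x)"
    proof (rule eventually_ball_finite)
      show "finite (I - B)"
        using finI by simp
      show "\<forall>i\<in>I - B. \<forall>\<^sub>F x in nhds x0. 0 < peval (c i) (vec_nth x)"
      proof
        fix i assume i: "i \<in> I - B"
        then have "0 \<le> peval (c i) u" "peval (c i) u \<noteq> 0"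
          using u(1) by (auto simp: feasible_def B_def)
        then have "0 < peval (c i) (vec_nth x0)"
          by (simp add: x0)
        moreover have "open {x :: real ^ 'n. 0 < peval (c i) (vec_nth x)}"
          by (intro open_Collect_less continuous_on_const continuous_peval)
        ultimately show "\<forall>\<^sub>F x in nhds x0. 0 < peval (c i) (vec_nth x)"
          unfolding eventually_nhds by blast
      qed
    qed
    then obtain \<epsilon> where \<epsilon>: "0 < \<epsilon>" "\<And>x i. norm (x - x0) < \<epsilon> \<Longrightarrow> i \<in> I - B \<Longrightarrow> 0 < peval (c i) (vec_nth x)"
      unfolding eventually_nhds_metric dist_norm by blast
    have "\<exists>x. norm (x - x0) < \<epsilon> \<and> (\<forall>i\<in>B - {j}. peval (c i) (vec_nth x) = 0) \<and> 0 < peval (c j) (vec_nth x)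
      \<and> peval f (vec_nth x) < peval f (vec_nth x0)"
    proof (rule descent_along_constraint[OF B(1), where a = a and lam = lam])
      show "continuous_on UNIV (\<lambda>x :: real ^ 'n. peval (c i) (vec_nth x))" for i
        by (rule continuous_peval)
      show "((\<lambda>x. peval (c i) (vec_nth x)) has_derivative (\<lambda>v. a i \<bullet> v)) (at x0)" for i
        using peval_has_derivative[of "c i" x0] by (simp add: x0 a_def)
      show "peval (c i) (vec_nth x0) = 0" if "i \<in> B" for i
        using that by (simp add: x0 B_def)
      show "((\<lambda>x. peval f (vec_nth x)) has_derivative (\<lambda>v. (\<Sum>i\<in>B. lam i *\<^sub>R a i) \<bullet> v)) (at x0)"
        using peval_has_derivative[of f x0] unfolding x0 grad .
    qed (use indep jB neg \<epsilon>(1) in auto)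
    then obtain x where x: "norm (x - x0) < \<epsilon>" "\<And>i. i \<in> B - {j} \<Longrightarrow> peval (c i) (vec_nth x) = 0"
      "0 < peval (c j) (vec_nth x)" "peval f (vec_nth x) < peval f u"
      unfolding x0 by blast
    have "E \<subseteq> B"
      using u(1) by (auto simp: feasible_def B_def)
    have "vec_nth x \<in> feasible c E I"
      unfolding feasible_def
    proof (intro CollectI conjI ballI)
      fix i assume i: "i \<in> I"
      show "0 \<le> peval (c i) (vec_nth x)"
        using x(2)[of i] x(3) \<epsilon>(2)[OF x(1), of i] i by (cases "i = j"; cases "i \<in> B") auto
    next
      fix i assume i: "i \<in> E"
      show "peval (c i) (vec_nth x) = 0"
      \<comment> \<open>The descent makes \<open>c j\<close> positive, which is harmless only
        because \<open>j\<close>, an inequality index, is not an equality index.\<close>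
      proof (cases "i = j")
        case True
        then show ?thesis
          using i j disj by blast
      next
        case False
        then show ?thesis
          using x(2)[of i] i \<open>E \<subseteq> B\<close> by blast
      qed
    qed
    then have "f_min f c E I \<le> ereal (peval f (vec_nth x))"
      unfolding f_min_def by (rule INF_lower)
    then show False
      using x(4) unfolding min[symmetric] by simp
  qed
  have "u \<in> feasible_critical"
    unfolding feasible_critical_iff
  proof (intro conjI ballI)
    show "peval (c i) u = 0" if "i \<in> E" for i
      using u(1) that by (simp add: feasible_def)
    show "0 \<le> peval (c j) u" if "j \<in> I" for j
      using u(1) that by (simp add: feasible_def)
    show "0 \<le> peval (p j) u" if "j \<in> I" for j
      using nonneg[OF that] lam_eq[of j] that by simp
    fix s :: "'n + 'i" assume "s \<in> phi_idx I"
    then consider t where "s = Inl t" | j where "s = Inr j" "j \<in> I"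
      by (auto simp: phi_idx_def)
    then show "peval (phi f c E I p s) u = 0"
    proof cases
      case 1
      then show ?thesis
        using lam lam_eq by (simp add: phi_def crit_pairs_def peval.hom_minus peval.hom_sum peval.hom_mult)
    next
      case 2
      then have "lam j * peval (c j) u = 0" "lam j = peval (p j) u"
        using lam lam_eq[of j] by (auto simp: crit_pairs_def)
      then show ?thesis
        using 2(1) by (simp add: phi_def peval.hom_mult)
    qed
  qed
  then have "f_c f c E I p \<le> f_min f c E I"
    unfolding f_c_eq min[symmetric] by (rule INF_lower)
  moreover have "f_min f c E I \<le> f_c f c E I p"
    unfolding f_min_def f_c_eq by (intro INF_superset_mono) (auto simp: feasible_critical_iff feasible_def)
  ultimately show ?thesis
    by (rule antisym)
qed

end

theorem theorem7p1:
  fixes f :: "'n::finite mpoly" and c p :: "'i \<Rightarrow> 'n mpoly" and E I :: "'i set"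
  assumes "finite E" and "finite I" and "E \<inter> I = {}"
    and "crit_points f c E I \<noteq> {}"
    and "assumptionA f c E I p"
  shows "(\<exists>k0. \<forall>k\<ge>k0. f_pre f c E I p k = f_c f c E I p \<and> f_pre' f c E I p k = f_c f c E I p)
    \<and> ((\<exists>u\<in>feasible c E I \<inter> crit_points f c E I. ereal (peval f u) = f_min f c E I)
        \<longrightarrow> (\<exists>k0. \<forall>k\<ge>k0. f_pre f c E I p k = f_min f c E I \<and> f_pre' f c E I p k = f_min f c E I))"
proof (intro conjI impI)
  show tight: "\<exists>k0. \<forall>k\<ge>k0. f_pre f c E I p k = f_c f c E I p \<and> f_pre' f c E I p k = f_c f c E I p"
    by (rule relaxations_eventually_tight[OF assms(1,2)])
  assume "\<exists>u\<in>feasible c E I \<inter> crit_points f c E I. ereal (peval f u) = f_min f c E I"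
  then have "f_c f c E I p = f_min f c E I"
    using f_c_eq_f_min[OF assms(1-3,5)] by blast
  then show "\<exists>k0. \<forall>k\<ge>k0. f_pre f c E I p k = f_min f c E I \<and> f_pre' f c E I p k = f_min f c E I"
    using tight by simp
qed

end
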